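(* Let $W$ be the Coxeter group of type $H_3$ and let $w\in W$ be a proper quasi-Coxeter element in the conjugacy class $H_3(a_2)$. Then the interval group $G([1,w])$ admits a presentation with three generators $\boldsymbol{s}_1,\boldsymbol{s}_2,\boldsymbol{s}_3$ and relations $$\boldsymbol{s}_1\boldsymbol{s}_2\boldsymbol{s}_1=\boldsymbol{s}_2\boldsymbol{s}_1\boldsymbol{s}_2,\quad \boldsymbol{s}_1\boldsymbol{s}_3\boldsymbol{s}_1=\boldsymbol{s}_3\boldsymbol{s}_1\boldsymbol{s}_3,\quad \boldsymbol{s}_2\boldsymbol{s}_3\boldsymbol{s}_2\boldsymbol{s}_3\boldsymbol{s}_2=\boldsymbol{s}_3\boldsymbol{s}_2\boldsymbol{s}_3\boldsymbol{s}_2\boldsymbol{s}_3,$$ $$\boldsymbol{s}_2\boldsymbol{s}_3\boldsymbol{s}_2\boldsymbol{s}_1\boldsymbol{s}_3\boldsymbol{s}_2=\boldsymbol{s}_3\boldsymbol{s}_2\boldsymbol{s}_1\boldsymbol{s}_3\boldsymbol{s}_2\boldsymbol{s}_3,\qquad (\boldsymbol{s}_3\boldsymbol{s}_2\boldsymbol{s}_1)^3=(\boldsymbol{s}_1\boldsymbol{s}_3\boldsymbol{s}_2)^3.$$ Moreover the poset $([1,w],\preceq)$ is a lattice, and $G([1,w])$ is a Garside group.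
   Context: Let $(W,R)$ be a finite Coxeter system and $T=\bigcup_{g\in W}g^{-1}Rg$ its set of reflections. The reflection length $\ell_T(g)$ is the least $k$ such that $g$ is a product of $k$ elements of $T$; a factorization of $g$ into $\ell_T(g)$ reflections is a reduced decomposition. A Coxeter element is any conjugate of the product of all elements of $R$ in some order. An element $w$ is quasi-Coxeter if it has a reduced decomposition $w=t_1\cdots t_m$ with $\langle t_1,\dots,t_m\rangle=W$; it is proper if it is not a Coxeter element. Write $x\preceq y$ if $\ell_T(y)=\ell_T(x)+\ell_T(x^{-1}y)$, and $[1,w]=\{x\in W: x\preceq w\}$. The interval group $G([1,w])$ is the group with generators $\boldsymbol{x}$ in bijection with $x\in[1,w]$ and relations $\boldsymbol{u}\boldsymbol{v}=\boldsymbol{r}$ whenever $u,v,r\in[1,w]$, $uv=r$ and $\ell_T(r)=\ell_T(u)+\ell_T(v)$. In type $H_3$ there are two conjugacy classes of proper quasi-Coxeter elements, denoted $H_3(a_1)$ and $H_3(a_2)$; $H_3(a_1)$ consists of elements of order $10$ and $H_3(a_2)$ of elements of order $6$. A Garside monoid is a cancellative monoid in which 1 is the only invertible element, in which any two elements have left and right lcms and gcds, and which has an element whose left and right divisors coincide, are finite in number and generate the monoid; a Garside group is the group of fractions of a Garside monoid. *)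

theory Defs
  imports
    "HOL-Algebra.Divisibility"
    "HOL-Algebra.Generated_Groups"
    "HOL-Algebra.Multiplicative_Group"
begin

section \<open>Group presentations\<close>

text \<open>
  A letter is a pair \<open>(x, b)\<close>: \<open>(x, True)\<close> stands for the generator \<open>x\<close> and \<open>(x, False)\<close> for its
  formal inverse. A relation \<open>l = r\<close> is a pair of words. The group \<open>\<langle>X | E\<rangle>\<close> is the set of words over
  \<open>X\<close> and the formal inverses, modulo the congruence generated by free cancellation and \<open>E\<close>.
\<close>

type_synonym 'a word = "('a \<times> bool) list"

definition words :: "'a set \<Rightarrow> 'a word set" where
  "words X = lists (X \<times> UNIV)"

inductive_set word_eq :: "'a set \<Rightarrow> ('a word \<times> 'a word) set \<Rightarrow> ('a word \<times> 'a word) set"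
  for X :: "'a set" and E :: "('a word \<times> 'a word) set" where
  refl: "u \<in> words X \<Longrightarrow> (u, u) \<in> word_eq X E"
| sym: "(u, v) \<in> word_eq X E \<Longrightarrow> (v, u) \<in> word_eq X E"
| trans: "(u, v) \<in> word_eq X E \<Longrightarrow> (v, z) \<in> word_eq X E \<Longrightarrow> (u, z) \<in> word_eq X E"
| cancel: "u \<in> words X \<Longrightarrow> v \<in> words X \<Longrightarrow> x \<in> X \<Longrightarrow>
    (u @ [(x, b), (x, \<not> b)] @ v, u @ v) \<in> word_eq X E"
| rel: "u \<in> words X \<Longrightarrow> v \<in> words X \<Longrightarrow> (l, r) \<in> E \<Longrightarrow> l \<in> words X \<Longrightarrow> r \<in> words X \<Longrightarrow>
    (u @ l @ v, u @ r @ v) \<in> word_eq X E"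

definition presented_group :: "'a set \<Rightarrow> ('a word \<times> 'a word) set \<Rightarrow> 'a word set monoid" where
  "presented_group X E =
    \<lparr>carrier = words X // word_eq X E,
     mult = (\<lambda>A B. \<Union>a\<in>A. \<Union>b\<in>B. word_eq X E `` {a @ b}),
     one = word_eq X E `` {[]}\<rparr>"

definition presented_gen :: "'a set \<Rightarrow> ('a word \<times> 'a word) set \<Rightarrow> 'a \<Rightarrow> 'a word set" where
  "presented_gen X E x = word_eq X E `` {[(x, True)]}"

definition positive :: "'a list \<Rightarrow> 'a word" where
  "positive xs = map (\<lambda>x. (x, True)) xs"

lemma words_Nil [simp]: "[] \<in> words X"
  by (simp add: words_def)

lemma words_append [simp]: "u @ v \<in> words X \<longleftrightarrow> u \<in> words X \<and> v \<in> words X"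
  by (simp add: words_def)

lemma words_Cons [simp]: "p # u \<in> words X \<longleftrightarrow> fst p \<in> X \<and> u \<in> words X"
  by (cases p) (simp add: words_def)

lemma word_eq_words:
  assumes "(u, v) \<in> word_eq X E"
  shows "u \<in> words X" "v \<in> words X"
  using assms by (induction rule: word_eq.induct) auto

lemma equiv_word_eq: "equiv (words X) (word_eq X E)"
proof (rule equivI)
  show "word_eq X E \<subseteq> words X \<times> words X" using word_eq_words by fastforce
  show "refl_on (words X) (word_eq X E)" by (auto intro!: refl_onI word_eq.refl)
  show "sym_on UNIV (word_eq X E)" by (auto intro!: symI word_eq.sym)
  show "trans_on UNIV (word_eq X E)" by (rule transI) (rule word_eq.trans)
qed

lemma word_eq_ctxt:
  assumes "(u, v) \<in> word_eq X E" "p \<in> words X" "q \<in> words X"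
  shows "(p @ u @ q, p @ v @ q) \<in> word_eq X E"
  using assms
proof (induction rule: word_eq.induct)
  case (cancel u v x b)
  then show ?case using word_eq.cancel[of "p @ u" X "v @ q" x b E] by simp
next
  case (rel u v l r)
  then show ?case using word_eq.rel[of "p @ u" X "v @ q" l r E] by simp
qed (simp_all add: word_eq.refl, (blast intro: word_eq.sym word_eq.trans)+)

lemma word_eq_append:
  assumes "(u, u') \<in> word_eq X E" "(v, v') \<in> word_eq X E"
  shows "(u @ v, u' @ v') \<in> word_eq X E"
proof (rule word_eq.trans)
  show "(u @ v, u' @ v) \<in> word_eq X E"
    using word_eq_ctxt[OF assms(1), of "[]" v] word_eq_words[OF assms(2)] by simp
  show "(u' @ v, u' @ v') \<in> word_eq X E"
    using word_eq_ctxt[OF assms(2), of u' "[]"] word_eq_words[OF assms(1)] by simp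
qed

lemma presented_group_mult:
  assumes "u \<in> words X" "v \<in> words X"
  shows "word_eq X E `` {u} \<otimes>\<^bsub>presented_group X E\<^esub> word_eq X E `` {v} = word_eq X E `` {u @ v}"
proof -
  let ?A = "word_eq X E `` {u}" and ?B = "word_eq X E `` {v}"
  have "word_eq X E `` {a @ b} = word_eq X E `` {u @ v}" if "a \<in> ?A" "b \<in> ?B" for a b
    using equiv_class_eq[OF equiv_word_eq word_eq_append[of u a X E v b]] that by simp
  moreover have "u \<in> ?A" "v \<in> ?B"
    using assms by (simp_all add: word_eq.refl)
  ultimately have "(\<Union>a\<in>?A. \<Union>b\<in>?B. word_eq X E `` {a @ b}) = word_eq X E `` {u @ v}"
    by (intro equalityI UN_least) blast+
  then show ?thesis by (simp add: presented_group_def)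
qed

lemma word_inverse:
  "u \<in> words X \<Longrightarrow> \<exists>v\<in>words X. (v @ u, []) \<in> word_eq X E"
proof (induction u)
  case Nil
  then show ?case by (auto intro!: bexI[of _ "[]"] word_eq.refl)
next
  case (Cons p u)
  then obtain v where v: "v \<in> words X" "(v @ u, []) \<in> word_eq X E" by auto
  obtain x b where p: "p = (x, b)" by (cases p)
  have "((v @ [(x, \<not> b)]) @ p # u, v @ u) \<in> word_eq X E"
    using word_eq.cancel[of v X u x "\<not> b" E] v Cons.prems p by simp
  then have "((v @ [(x, \<not> b)]) @ p # u, []) \<in> word_eq X E"
    using v(2) by (rule word_eq.trans)
  moreover have "v @ [(x, \<not> b)] \<in> words X" using v Cons.prems p by simp
  ultimately show ?case by blast
qed

lemma group_presented_group: "group (presented_group X E)"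
proof (rule groupI)
  fix A B C
  assume A: "A \<in> carrier (presented_group X E)" and B: "B \<in> carrier (presented_group X E)"
  then obtain a b where a: "a \<in> words X" "A = word_eq X E `` {a}"
    and b: "b \<in> words X" "B = word_eq X E `` {b}"
    by (auto simp: presented_group_def elim!: quotientE)
  show "A \<otimes>\<^bsub>presented_group X E\<^esub> B \<in> carrier (presented_group X E)"
    using a b presented_group_mult[of a X b E]
    by (auto simp: presented_group_def intro!: quotientI)
  assume C: "C \<in> carrier (presented_group X E)"
  then obtain c where c: "c \<in> words X" "C = word_eq X E `` {c}"
    by (auto simp: presented_group_def elim!: quotientE)
  show "A \<otimes>\<^bsub>presented_group X E\<^esub> B \<otimes>\<^bsub>presented_group X E\<^esub> C =
      A \<otimes>\<^bsub>presented_group X E\<^esub> (B \<otimes>\<^bsub>presented_group X E\<^esub> C)"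
    using a b c by (simp add: presented_group_mult)
next
  show "\<one>\<^bsub>presented_group X E\<^esub> \<in> carrier (presented_group X E)"
    by (auto simp: presented_group_def intro!: quotientI)
next
  fix A assume "A \<in> carrier (presented_group X E)"
  then obtain a where a: "a \<in> words X" "A = word_eq X E `` {a}"
    by (auto simp: presented_group_def elim!: quotientE)
  have one: "\<one>\<^bsub>presented_group X E\<^esub> = word_eq X E `` {[]}"
    by (simp add: presented_group_def)
  show "\<one>\<^bsub>presented_group X E\<^esub> \<otimes>\<^bsub>presented_group X E\<^esub> A = A"
    using a by (simp add: one presented_group_mult)
  obtain v where v: "v \<in> words X" "(v @ a, []) \<in> word_eq X E"
    using word_inverse a by blast
  show "\<exists>B\<in>carrier (presented_group X E). B \<otimes>\<^bsub>presented_group X E\<^esub> A = \<one>\<^bsub>presented_group X E\<^esub>"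
  proof (rule bexI[of _ "word_eq X E `` {v}"])
    show "word_eq X E `` {v} \<otimes>\<^bsub>presented_group X E\<^esub> A = \<one>\<^bsub>presented_group X E\<^esub>"
      using a v equiv_class_eq[OF equiv_word_eq v(2)] by (simp add: one presented_group_mult)
    show "word_eq X E `` {v} \<in> carrier (presented_group X E)"
      using v by (auto simp: presented_group_def intro!: quotientI)
  qed
qed

section \<open>Coxeter systems\<close>

text \<open>
  The relators \<open>(r s)\<^sup>m\<close> with \<open>m\<close> the order of \<open>r s\<close> in \<open>W\<close>. For \<open>r = s\<close> the order of \<open>r s = 1\<close> is
  1, which gives \<open>r r = 1\<close>; infinite order is \<open>ord = 0\<close>, which gives the empty relator.
\<close>

definition coxeter_relations :: "('a, 'b) monoid_scheme \<Rightarrow> 'a set \<Rightarrow> ('a word \<times> 'a word) set" where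
  "coxeter_relations W R =
    {(positive (concat (replicate (group.ord W (r \<otimes>\<^bsub>W\<^esub> s)) [r, s])), []) | r s. r \<in> R \<and> s \<in> R}"

definition finite_coxeter_system :: "('a, 'b) monoid_scheme \<Rightarrow> 'a set \<Rightarrow> bool" where
  "finite_coxeter_system W R \<longleftrightarrow>
     group W \<and> finite (carrier W) \<and> R \<subseteq> carrier W \<and> (\<forall>r\<in>R. group.ord W r = 2) \<and>
     (\<exists>\<phi>\<in>iso (presented_group R (coxeter_relations W R)) W.
        \<forall>r\<in>R. \<phi> (presented_gen R (coxeter_relations W R) r) = r)"

definition type_H3 :: "('a, 'b) monoid_scheme \<Rightarrow> 'a set \<Rightarrow> bool" where
  "type_H3 W R \<longleftrightarrow> finite_coxeter_system W R \<and>
     (\<exists>r s t. R = {r, s, t} \<and> distinct [r, s, t] \<and>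
        group.ord W (r \<otimes>\<^bsub>W\<^esub> s) = 5 \<and> group.ord W (s \<otimes>\<^bsub>W\<^esub> t) = 3 \<and> group.ord W (r \<otimes>\<^bsub>W\<^esub> t) = 2)"

definition reflections :: "('a, 'b) monoid_scheme \<Rightarrow> 'a set \<Rightarrow> 'a set" where
  "reflections W R = (\<Union>g\<in>carrier W. {inv\<^bsub>W\<^esub> g \<otimes>\<^bsub>W\<^esub> r \<otimes>\<^bsub>W\<^esub> g | r. r \<in> R})"

definition list_prod :: "('a, 'b) monoid_scheme \<Rightarrow> 'a list \<Rightarrow> 'a" where
  "list_prod W xs = foldr (\<otimes>\<^bsub>W\<^esub>) xs \<one>\<^bsub>W\<^esub>"

definition refl_length :: "('a, 'b) monoid_scheme \<Rightarrow> 'a set \<Rightarrow> 'a \<Rightarrow> nat" where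
  "refl_length W R g =
    (LEAST k. \<exists>ts. set ts \<subseteq> reflections W R \<and> length ts = k \<and> list_prod W ts = g)"

definition reduced_decomposition :: "('a, 'b) monoid_scheme \<Rightarrow> 'a set \<Rightarrow> 'a list \<Rightarrow> 'a \<Rightarrow> bool" where
  "reduced_decomposition W R ts g \<longleftrightarrow>
     set ts \<subseteq> reflections W R \<and> list_prod W ts = g \<and> length ts = refl_length W R g"

definition coxeter_element :: "('a, 'b) monoid_scheme \<Rightarrow> 'a set \<Rightarrow> 'a \<Rightarrow> bool" where
  "coxeter_element W R w \<longleftrightarrow>
     (\<exists>rs. distinct rs \<and> set rs = R \<and>
       (\<exists>g\<in>carrier W. w = inv\<^bsub>W\<^esub> g \<otimes>\<^bsub>W\<^esub> list_prod W rs \<otimes>\<^bsub>W\<^esub> g))"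

definition quasi_coxeter :: "('a, 'b) monoid_scheme \<Rightarrow> 'a set \<Rightarrow> 'a \<Rightarrow> bool" where
  "quasi_coxeter W R w \<longleftrightarrow> w \<in> carrier W \<and>
     (\<exists>ts. reduced_decomposition W R ts w \<and> generate W (set ts) = carrier W)"

definition proper_quasi_coxeter :: "('a, 'b) monoid_scheme \<Rightarrow> 'a set \<Rightarrow> 'a \<Rightarrow> bool" where
  "proper_quasi_coxeter W R w \<longleftrightarrow> quasi_coxeter W R w \<and> \<not> coxeter_element W R w"

text \<open>
  In type \<open>H\<^sub>3\<close> there are two conjugacy classes of proper quasi-Coxeter elements, \<open>H\<^sub>3(a\<^sub>1)\<close> with
  elements of order 10 and \<open>H\<^sub>3(a\<^sub>2)\<close> with elements of order 6, so the order singles out the class.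
\<close>

definition H3_a2 :: "('a, 'b) monoid_scheme \<Rightarrow> 'a set \<Rightarrow> 'a set" where
  "H3_a2 W R = {w. proper_quasi_coxeter W R w \<and> group.ord W w = 6}"

section \<open>Intervals and interval groups\<close>

definition abs_le :: "('a, 'b) monoid_scheme \<Rightarrow> 'a set \<Rightarrow> 'a \<Rightarrow> 'a \<Rightarrow> bool" where
  "abs_le W R x y \<longleftrightarrow>
     refl_length W R y = refl_length W R x + refl_length W R (inv\<^bsub>W\<^esub> x \<otimes>\<^bsub>W\<^esub> y)"

definition interval :: "('a, 'b) monoid_scheme \<Rightarrow> 'a set \<Rightarrow> 'a \<Rightarrow> 'a set" where
  "interval W R w = {x \<in> carrier W. abs_le W R x w}"

definition interval_order :: "('a, 'b) monoid_scheme \<Rightarrow> 'a set \<Rightarrow> 'a \<Rightarrow> 'a gorder" where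
  "interval_order W R w = \<lparr>carrier = interval W R w, eq = (=), le = abs_le W R\<rparr>"

definition interval_relations ::
  "('a, 'b) monoid_scheme \<Rightarrow> 'a set \<Rightarrow> 'a \<Rightarrow> ('a word \<times> 'a word) set" where
  "interval_relations W R w =
    {(positive [u, v], positive [r]) | u v r.
       u \<in> interval W R w \<and> v \<in> interval W R w \<and> r \<in> interval W R w \<and>
       u \<otimes>\<^bsub>W\<^esub> v = r \<and> refl_length W R r = refl_length W R u + refl_length W R v}"

definition interval_group :: "('a, 'b) monoid_scheme \<Rightarrow> 'a set \<Rightarrow> 'a \<Rightarrow> 'a word set monoid" where
  "interval_group W R w = presented_group (interval W R w) (interval_relations W R w)"

section \<open>Garside monoids and Garside groups\<close>

text \<open>
  The notions \<open>divides\<close>, \<open>gcdof\<close> and \<open>lcmof\<close> of HOL-Algebra make sense in noncommutative monoids,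
  where \<open>a divides b\<close> means \<open>b = a c\<close> for some \<open>c\<close>, that is, left divisibility. Right divisibility
  is left divisibility in the opposite monoid.
\<close>

definition opp :: "('a, 'b) monoid_scheme \<Rightarrow> ('a, 'b) monoid_scheme" where
  "opp M = M\<lparr>mult := (\<lambda>x y. y \<otimes>\<^bsub>M\<^esub> x)\<rparr>"

definition has_gcds_lcms :: "('a, 'b) monoid_scheme \<Rightarrow> bool" where
  "has_gcds_lcms M \<longleftrightarrow> (\<forall>a\<in>carrier M. \<forall>b\<in>carrier M.
     (\<exists>d\<in>carrier M. d gcdof\<^bsub>M\<^esub> a b) \<and> (\<exists>m\<in>carrier M. m lcmof\<^bsub>M\<^esub> a b))"

definition divisors :: "('a, 'b) monoid_scheme \<Rightarrow> 'a \<Rightarrow> 'a set" where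
  "divisors M d = {x \<in> carrier M. x divides\<^bsub>M\<^esub> d}"

definition garside_element :: "('a, 'b) monoid_scheme \<Rightarrow> 'a \<Rightarrow> bool" where
  "garside_element M d \<longleftrightarrow> d \<in> carrier M \<and>
     divisors M d = divisors (opp M) d \<and> finite (divisors M d) \<and>
     (\<forall>x\<in>carrier M. \<exists>ds. set ds \<subseteq> divisors M d \<and> list_prod M ds = x)"

definition garside_monoid :: "('a, 'b) monoid_scheme \<Rightarrow> bool" where
  "garside_monoid M \<longleftrightarrow> monoid_cancel M \<and> Units M = {\<one>\<^bsub>M\<^esub>} \<and>
     has_gcds_lcms M \<and> has_gcds_lcms (opp M) \<and> (\<exists>d. garside_element M d)"

definition group_of_fractions ::
  "('m, 'c) monoid_scheme \<Rightarrow> ('a, 'b) monoid_scheme \<Rightarrow> ('m \<Rightarrow> 'a) \<Rightarrow> bool" where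
  "group_of_fractions M G \<iota> \<longleftrightarrow> group G \<and> \<iota> \<in> hom M G \<and> inj_on \<iota> (carrier M) \<and>
     carrier G = {inv\<^bsub>G\<^esub> (\<iota> a) \<otimes>\<^bsub>G\<^esub> \<iota> b | a b. a \<in> carrier M \<and> b \<in> carrier M}"

text \<open>
  Taking \<open>M\<close> on the same type as \<open>G\<close> loses no generality: \<open>M\<close> embeds in its group of fractions, so
  it can be replaced by its image.
\<close>

definition garside_group :: "('a, 'b) monoid_scheme \<Rightarrow> bool" where
  "garside_group G \<longleftrightarrow> (\<exists>(M :: 'a monoid) \<iota>. garside_monoid M \<and> group_of_fractions M G \<iota>)"

section \<open>The presentation for the class \<open>H\<^sub>3(a\<^sub>2)\<close>\<close>

definition H3_a2_relations :: "(nat word \<times> nat word) set" where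
  "H3_a2_relations =
    {(positive [1, 2, 1], positive [2, 1, 2]),
     (positive [1, 3, 1], positive [3, 1, 3]),
     (positive [2, 3, 2, 3, 2], positive [3, 2, 3, 2, 3]),
     (positive [2, 3, 2, 1, 3, 2], positive [3, 2, 1, 3, 2, 3]),
     (positive [3, 2, 1, 3, 2, 1, 3, 2, 1], positive [1, 3, 2, 1, 3, 2, 1, 3, 2])}"

end

theory Submission
  imports Defs
begin

text \<open>
  The proof combines a general theorem on interval groups with the combinatorics of one class.

  The general theorem, \<open>garside_interval_group\<close>, says that a lattice interval \<open>P = [1, w]\<close> of a finite
  Coxeter group has a Garside interval group. Reflection length is subadditive and invariant under
  conjugation, so \<open>P\<close> with its partial product is closed under the complement \<open>x \<mapsto> x\<^sup>-\<^sup>1 w\<close> and under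
  conjugation by \<open>w\<close>. Let \<open>M\<close> be the monoid of words over \<open>P\<close> modulo the partial product. With meets in
  \<open>P\<close>, every \<open>m \<in> M\<close> has a largest divisor in \<open>P\<close> (\<open>head\<close>), and \<open>x\<close>, \<open>head\<close> and the remaining word of \<open>x m\<close>
  determine \<open>m\<close>; hence \<open>M\<close> is left cancellative (\<open>peq_left_cancel\<close>). Conjugation by \<open>w\<close> turns this into
  right cancellation of \<open>w\<close>, and every element of the group is a fraction \<open>m w\<^sup>-\<^sup>k\<close>, so \<open>M\<close> embeds into
  the group (\<open>cls_eq_iff\<close>). A common multiple of \<open>x, y \<in> P\<close> has a head above \<open>x\<close> and \<open>y\<close>, hence above
  their join; so joins in \<open>P\<close> are least common multiples in \<open>M\<close>, and those of arbitrary elements are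
  assembled from squares with sides in \<open>P\<close> (\<open>left_lcm\<close>). The other axioms follow from lengths and from
  the order-reversing map \<open>x \<mapsto> w\<^sup>k x\<^sup>-\<^sup>1\<close>.

  The group \<open>W\<close> is the direct product of the alternating group of degree 5 with a group of order
  two, and \<open>w\<close> is minus a rotation of order three. All fifteen reflections lie below \<open>w\<close>, so \<open>P\<close>
  consists of \<open>1\<close>, the reflections, their complements and \<open>w\<close>, and the interval group is generated by
  the reflections and \<open>\<Delta>\<close> with one relation \<open>t\<^sub>1 t\<^sub>2 t\<^sub>3 = \<Delta>\<close> for each of the 54 factorizations of \<open>w\<close>.
  Conjugation by \<open>w\<close> permutes the reflections in five orbits \<open>a\<^sub>k, b\<^sub>k, c\<^sub>k, d\<^sub>k, e\<^sub>k\<close> of length three. A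
  relation stays valid under \<open>(t\<^sub>1, t\<^sub>2, t\<^sub>3) \<mapsto> (t\<^sub>2, t\<^sub>3, \<Delta>\<^sup>-\<^sup>1 t\<^sub>1 \<Delta>)\<close>, and this rotation leaves only six
  relations up to symmetry. Such a \<open>conj_system\<close> in a group is the same as a triple \<open>a, b, c\<close> with the
  five stated relations, where \<open>\<Delta> = c b a\<close>: the relations make \<open>\<Delta>\<^sup>3\<close> central, and then each of the six
  relations is a short computation (\<open>conj_system_exists\<close>, \<open>H3_a2_triple_if_conj_system\<close>). Inspection
  of the 54 factorizations also shows that no two reflections have two common upper bounds of
  length two, and in rank three this is the lattice property (\<open>lattice_if_no_bowtie\<close>).

  It remains to recognize these 54 factorizations in an abstract group of type H3. A coset
  enumeration writes every element as one of 120 words in the generators, a permutation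
  representation in which only the empty one of these words acts trivially is faithful, and the
  statements on reflections become computations with permutations (\<open>H3_a2_interval_if_order_6\<close>).
\<close>

section \<open>Homomorphisms out of presented groups\<close>

definition eval_word :: "('a, 'b) monoid_scheme \<Rightarrow> ('x \<Rightarrow> 'a) \<Rightarrow> 'x word \<Rightarrow> 'a" where
  "eval_word K f u = list_prod K (map (\<lambda>(x, b). if b then f x else inv\<^bsub>K\<^esub> f x) u)"

lemma list_prod_simps [simp]:
  "list_prod K [] = \<one>\<^bsub>K\<^esub>" "list_prod K (x # xs) = x \<otimes>\<^bsub>K\<^esub> list_prod K xs"
  by (simp_all add: list_prod_def)

lemma (in monoid) list_prod_closed [simp, intro]:
  "set xs \<subseteq> carrier G \<Longrightarrow> list_prod G xs \<in> carrier G"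
  by (induction xs) auto

lemma (in monoid) list_prod_append:
  "set xs \<subseteq> carrier G \<Longrightarrow> set ys \<subseteq> carrier G \<Longrightarrow>
    list_prod G (xs @ ys) = list_prod G xs \<otimes> list_prod G ys"
  by (induction xs) (auto simp: m_assoc)

lemma eval_word_Nil [simp]: "eval_word K f [] = \<one>\<^bsub>K\<^esub>"
  by (simp add: eval_word_def)

lemma eval_word_Cons [simp]:
  "eval_word K f ((x, b) # u) = (if b then f x else inv\<^bsub>K\<^esub> f x) \<otimes>\<^bsub>K\<^esub> eval_word K f u"
  by (simp add: eval_word_def)

lemma eval_word_positive: "eval_word K f (positive xs) = list_prod K (map f xs)"
  by (simp add: eval_word_def positive_def o_def)

context group
begin

lemma eval_word_closed [simp]:
  "f \<in> X \<rightarrow> carrier G \<Longrightarrow> u \<in> words X \<Longrightarrow> eval_word G f u \<in> carrier G"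
  by (induction u) (auto simp: Pi_iff)

lemma eval_word_append:
  "f \<in> X \<rightarrow> carrier G \<Longrightarrow> u \<in> words X \<Longrightarrow> v \<in> words X \<Longrightarrow>
    eval_word G f (u @ v) = eval_word G f u \<otimes> eval_word G f v"
proof (induction u)
  case (Cons p u)
  then show ?case by (cases p) (auto simp: m_assoc Pi_iff)
qed simp

text \<open>
  The universal property of a presented group, at the level of words.
\<close>

lemma eval_word_word_eq:
  assumes f: "f \<in> X \<rightarrow> carrier G"
    and E: "\<And>l r. (l, r) \<in> E \<Longrightarrow> l \<in> words X \<Longrightarrow> r \<in> words X \<Longrightarrow> eval_word G f l = eval_word G f r"
    and "(u, v) \<in> word_eq X E"
  shows "eval_word G f u = eval_word G f v"
  using assms(3)
proof (induction rule: word_eq.induct)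
  case (cancel u v x b)
  have "f x \<in> carrier G" using f cancel by blast
  then have "eval_word G f ([(x, b), (x, \<not> b)]) = \<one>" by (cases b) simp_all
  moreover have "[(x, b), (x, \<not> b)] \<in> words X" using cancel by simp
  ultimately show ?case
    using cancel f by (simp only: eval_word_append[OF f] words_append) simp
next
  case (rel u v l r)
  then show ?case using E[of l r] by (simp add: eval_word_append[OF f])
qed simp_all

end

lemma presented_group_carrier: "carrier (presented_group X E) = (\<lambda>u. word_eq X E `` {u}) ` words X"
  by (auto simp: presented_group_def quotient_def)

lemma presented_group_one: "\<one>\<^bsub>presented_group X E\<^esub> = word_eq X E `` {[]}"
  by (simp add: presented_group_def)

lemma presented_gen_closed [simp]: "x \<in> X \<Longrightarrow> presented_gen X E x \<in> carrier (presented_group X E)"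
  by (auto simp: presented_group_carrier presented_gen_def)

lemma class_eqI: "(u, v) \<in> word_eq X E \<Longrightarrow> word_eq X E `` {u} = word_eq X E `` {v}"
  by (rule equiv_class_eq[OF equiv_word_eq])

lemma class_eqD: "word_eq X E `` {u} = word_eq X E `` {v} \<Longrightarrow> v \<in> words X \<Longrightarrow> (u, v) \<in> word_eq X E"
  by (rule eq_equiv_class[OF _ equiv_word_eq])

lemma eval_word_presented_gen:
  assumes "u \<in> words X"
  shows "eval_word (presented_group X E) (presented_gen X E) u = word_eq X E `` {u}"
  using assms
proof (induction u)
  case Nil
  then show ?case by (simp add: presented_group_one)
next
  case (Cons p u)
  interpret P: group "presented_group X E" by (rule group_presented_group)
  obtain x b where p: "p = (x, b)" by (cases p)
  then have x: "x \<in> X" and u: "u \<in> words X" using Cons.prems by auto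
  have "inv\<^bsub>presented_group X E\<^esub> presented_gen X E x = word_eq X E `` {[(x, False)]}"
  proof (rule P.inv_equality)
    show "word_eq X E `` {[(x, False)]} \<otimes>\<^bsub>presented_group X E\<^esub> presented_gen X E x
        = \<one>\<^bsub>presented_group X E\<^esub>"
      using x word_eq.cancel[of "[]" X "[]" x False E]
      by (simp add: presented_gen_def presented_group_mult presented_group_one class_eqI)
    show "word_eq X E `` {[(x, False)]} \<in> carrier (presented_group X E)"
      using x by (auto simp: presented_group_carrier)
  qed (use x in simp)
  then have "(if b then presented_gen X E x else inv\<^bsub>presented_group X E\<^esub> presented_gen X E x)
      = word_eq X E `` {[(x, b)]}" by (simp add: presented_gen_def)
  then show ?case
    using x u Cons.IH by (simp add: p presented_group_mult)
qed

text \<open>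
  The defining relations used here are relations between positive words, and this is the form in
  which they are applied.
\<close>

lemma presented_group_rel:
  assumes "(positive xs, positive ys) \<in> E" "set xs \<subseteq> X" "set ys \<subseteq> X"
  shows "list_prod (presented_group X E) (map (presented_gen X E) xs)
    = list_prod (presented_group X E) (map (presented_gen X E) ys)"
proof -
  have w: "positive xs \<in> words X" "positive ys \<in> words X"
    using assms(2,3) by (auto simp: positive_def words_def)
  then have "(positive xs, positive ys) \<in> word_eq X E"
    using word_eq.rel[of "[]" X "[]" "positive xs" "positive ys" E] assms(1) by simp
  then show ?thesis
    using w by (simp add: eval_word_presented_gen class_eqI flip: eval_word_positive)
qed

lemma (in group) presented_group_hom:
  assumes f: "f \<in> X \<rightarrow> carrier G"
    and E: "\<And>l r. (l, r) \<in> E \<Longrightarrow> l \<in> words X \<Longrightarrow> r \<in> words X \<Longrightarrow> eval_word G f l = eval_word G f r"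
  obtains h where "h \<in> hom (presented_group X E) G" "\<And>x. x \<in> X \<Longrightarrow> h (presented_gen X E x) = f x"
proof -
  define h where "h A = eval_word G f (SOME u. u \<in> A)" for A
  have h: "h (word_eq X E `` {u}) = eval_word G f u" if "u \<in> words X" for u
  proof -
    have "(SOME v. v \<in> word_eq X E `` {u}) \<in> word_eq X E `` {u}"
      by (rule someI[of _ u]) (simp add: that word_eq.refl)
    then show ?thesis
      unfolding h_def using eval_word_word_eq[OF f E] by auto
  qed
  have "h \<in> hom (presented_group X E) G"
    by (rule homI)
      (auto simp: presented_group_carrier presented_group_mult h eval_word_closed[OF f]
        eval_word_append[OF f])
  moreover have "h (presented_gen X E x) = f x" if "x \<in> X" for x
    using that f by (simp add: presented_gen_def h Pi_iff)
  ultimately show thesis using that by blast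
qed

lemma hom_eval_word:
  assumes "group P" "group K" and h: "h \<in> hom P K" and f: "f \<in> X \<rightarrow> carrier P"
    and "u \<in> words X"
  shows "h (eval_word P f u) = eval_word K (h \<circ> f) u"
proof -
  interpret group_hom P K h using assms by (simp add: group_hom_def group_hom_axioms_def)
  show ?thesis
    using assms(5) f by (induction u) (auto simp: Pi_iff G.eval_word_closed[OF f])
qed

lemma hom_list_prod:
  assumes "group P" "group K" and h: "h \<in> hom P K" and "set xs \<subseteq> carrier P"
  shows "h (list_prod P xs) = list_prod K (map h xs)"
proof -
  interpret group_hom P K h using assms by (simp add: group_hom_def group_hom_axioms_def)
  show ?thesis using assms(4) by (induction xs) auto
qed

lemma hom_presented_group_eqI:
  assumes "group K" "h \<in> hom (presented_group X E) K" "h' \<in> hom (presented_group X E) K"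
    and "\<And>x. x \<in> X \<Longrightarrow> h (presented_gen X E x) = h' (presented_gen X E x)"
    and "A \<in> carrier (presented_group X E)"
  shows "h A = h' A"
proof -
  obtain u where u: "u \<in> words X" "A = word_eq X E `` {u}"
    using assms(5) by (auto simp: presented_group_carrier)
  have "eval_word K (h \<circ> presented_gen X E) u = eval_word K (h' \<circ> presented_gen X E) u"
    using u(1) assms(4) by (induction u) auto
  then show ?thesis
    using u hom_eval_word[OF group_presented_group assms(1) assms(2), of "presented_gen X E" X u]
      hom_eval_word[OF group_presented_group assms(1) assms(3), of "presented_gen X E" X u]
    by (simp add: eval_word_presented_gen)
qed

text \<open>
  Mutually inverse homomorphisms need to be compared on generators only; this replaces Tietze
  transformations.
\<close>

lemma presented_group_isoI:
  assumes h: "h \<in> hom (presented_group X E) (presented_group Y F)"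
    and k: "k \<in> hom (presented_group Y F) (presented_group X E)"
    and kh: "\<And>x. x \<in> X \<Longrightarrow> k (h (presented_gen X E x)) = presented_gen X E x"
    and hk: "\<And>y. y \<in> Y \<Longrightarrow> h (k (presented_gen Y F y)) = presented_gen Y F y"
  shows "presented_group X E \<cong> presented_group Y F"
proof -
  have id: "(\<lambda>A. A) \<in> hom (presented_group X E) (presented_group X E)" for X :: "'c set" and E
    by (simp add: hom_def)
  have "k (h A) = A" if "A \<in> carrier (presented_group X E)" for A
    using hom_presented_group_eqI[OF group_presented_group hom_compose[OF h k] id] kh that by simp
  moreover have "h (k B) = B" if "B \<in> carrier (presented_group Y F)" for B
  proof -
    have "(\<lambda>A. A) \<in> hom (presented_group Y F) (presented_group Y F)" by (simp add: hom_def)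
    from hom_presented_group_eqI[OF group_presented_group hom_compose[OF k h] this] hk that
    show ?thesis by simp
  qed
  ultimately have "bij_betw h (carrier (presented_group X E)) (carrier (presented_group Y F))"
    using h k by (intro bij_betwI[where g = k]) (auto simp: hom_def)
  then show ?thesis using h by (auto simp: is_iso_def iso_def)
qed

section \<open>Garside monoids inside a group\<close>

context group
begin

lemma inv_mult_cancel [simp]:
  "x \<in> carrier G \<Longrightarrow> y \<in> carrier G \<Longrightarrow> inv x \<otimes> (x \<otimes> y) = y"
  "x \<in> carrier G \<Longrightarrow> y \<in> carrier G \<Longrightarrow> x \<otimes> (inv x \<otimes> y) = y"
  by (simp_all flip: m_assoc)

text \<open>Rewriting with these rules decides equality in a free group.\<close>

lemmas free_group_simps = m_assoc inv_mult_group

end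

text \<open>
  This section is independent of Coxeter groups. It isolates what makes a submonoid \<open>M\<close> of a group \<open>G\<close>
  Garside, with Garside element \<open>D\<close> and simple elements \<open>S\<close>. Left divisibility \<open>a | b\<close> in \<open>M\<close> is \<open>a\<^sup>-\<^sup>1 b \<in> M\<close>
  and right divisibility is \<open>b a\<^sup>-\<^sup>1 \<in> M\<close>, so all arguments are calculations in \<open>G\<close>, and cancellativity
  is inherited from \<open>G\<close>. The last assumption says that simple elements have simple least common
  multiples with simple complements.
\<close>

locale garside_submonoid = group G for G (structure) +
  fixes M S :: "'a set" and D :: 'a and len :: "'a \<Rightarrow> nat"
  assumes M_carrier: "M \<subseteq> carrier G"
    and one_M [simp, intro]: "\<one> \<in> M"
    and mult_M [simp, intro]: "x \<in> M \<Longrightarrow> y \<in> M \<Longrightarrow> x \<otimes> y \<in> M"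
    and finite_S: "finite S"
    and S_M: "S \<subseteq> M"
    and M_products: "x \<in> M \<Longrightarrow> \<exists>xs. set xs \<subseteq> S \<and> list_prod G xs = x"
    and generate_S: "generate G S = carrier G"
    and len_mult: "x \<in> M \<Longrightarrow> y \<in> M \<Longrightarrow> len (x \<otimes> y) = len x + len y"
    and len_0: "x \<in> M \<Longrightarrow> len x = 0 \<Longrightarrow> x = \<one>"
    and D_M: "D \<in> M"
    and S_D: "s \<in> S \<Longrightarrow> inv s \<otimes> D \<in> M"
    and conj_D: "x \<in> M \<Longrightarrow> inv D \<otimes> x \<otimes> D \<in> M"
    and conj_inv_D: "x \<in> M \<Longrightarrow> D \<otimes> x \<otimes> inv D \<in> M"
    and join_S: "s \<in> S \<Longrightarrow> t \<in> S \<Longrightarrow> \<exists>z\<in>S. inv s \<otimes> z \<in> S \<and> inv t \<otimes> z \<in> S \<and>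
      (\<forall>m\<in>M. inv s \<otimes> m \<in> M \<longrightarrow> inv t \<otimes> m \<in> M \<longrightarrow> inv z \<otimes> m \<in> M)"
begin

lemma M_closed [simp]: "x \<in> M \<Longrightarrow> x \<in> carrier G"
  using M_carrier by blast

lemma S_closed [simp]: "s \<in> S \<Longrightarrow> s \<in> M"
  using S_M by blast

lemma D_closed [simp]: "D \<in> M" "D \<in> carrier G"
  using D_M by auto

lemma len_one [simp]: "len \<one> = 0"
  using len_mult[of \<one> \<one>] by simp

lemma M_induct [consumes 1, case_names one mult]:
  assumes "x \<in> M" "P \<one>" "\<And>s x. s \<in> S \<Longrightarrow> x \<in> M \<Longrightarrow> P x \<Longrightarrow> P (s \<otimes> x)"
  shows "P x"
proof -
  obtain xs where xs: "set xs \<subseteq> S" "list_prod G xs = x" using M_products assms(1) by blast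
  have "list_prod G xs \<in> M \<and> P (list_prod G xs)"
    using xs(1) by (induction xs) (auto simp: assms(2,3))
  then show ?thesis using xs(2) by simp
qed

lemma pow_D_M [simp]: "D [^] (k :: nat) \<in> M"
  by (induction k) auto

lemma D_pow_commute: "D [^] (k :: nat) \<otimes> D = D \<otimes> D [^] k"
  using nat_pow_Suc2[of D k] by simp

lemma conj_pow_D: "x \<in> M \<Longrightarrow> inv (D [^] (k :: nat)) \<otimes> x \<otimes> D [^] k \<in> M"
proof (induction k)
  case (Suc k)
  have "inv (D [^] Suc k) \<otimes> x \<otimes> D [^] Suc k = inv D \<otimes> (inv (D [^] k) \<otimes> x \<otimes> D [^] k) \<otimes> D"
    using Suc.prems by (simp add: free_group_simps)
  then show ?case using conj_D[OF Suc.IH[OF Suc.prems]] by simp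
qed simp

lemma conj_inv_pow_D: "x \<in> M \<Longrightarrow> D [^] (k :: nat) \<otimes> x \<otimes> inv (D [^] k) \<in> M"
proof (induction k arbitrary: x)
  case (Suc k)
  have "D [^] Suc k \<otimes> x \<otimes> inv (D [^] Suc k) = D [^] k \<otimes> (D \<otimes> x \<otimes> inv D) \<otimes> inv (D [^] k)"
    using Suc.prems by (simp add: free_group_simps)
  then show ?case using Suc.IH[OF conj_inv_D[OF Suc.prems]] by simp
qed simp

text \<open>
  If \<open>x\<close> divides \<open>D\<^sup>k\<close>, then \<open>s x\<close> divides \<open>D\<^sup>k\<^sup>+\<^sup>1\<close>, because the complement of \<open>s\<close> in \<open>D\<close> can be moved past \<open>D\<^sup>k\<close>.
\<close>

lemma left_divides_pow_D: "x \<in> M \<Longrightarrow> \<exists>k :: nat. inv x \<otimes> D [^] k \<in> M"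
proof (induction rule: M_induct)
  case one
  show ?case by (rule exI[of _ 0]) simp
next
  case (mult s x)
  then obtain k :: nat where k: "inv x \<otimes> D [^] k \<in> M" by blast
  have "inv (s \<otimes> x) \<otimes> D [^] Suc k
      = (inv x \<otimes> D [^] k) \<otimes> (inv (D [^] k) \<otimes> (inv s \<otimes> D) \<otimes> D [^] k)"
    using mult by (simp add: free_group_simps D_pow_commute)
  then show ?case using mult_M[OF k conj_pow_D[OF S_D[OF mult(1)], of k]] by metis
qed

lemma right_divides_pow_D:
  assumes "x \<in> M" "y \<in> M"
  shows "\<exists>k :: nat. D [^] k \<otimes> inv x \<in> M \<and> D [^] k \<otimes> inv y \<in> M"
proof -
  have *: "\<exists>k :: nat. D [^] k \<otimes> inv x \<in> M" if x: "x \<in> M" for x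
  proof -
    obtain k :: nat where "inv x \<otimes> D [^] k \<in> M" using left_divides_pow_D[OF x] by blast
    from conj_inv_pow_D[OF this, of k] have "D [^] k \<otimes> inv x \<in> M"
      using x by (simp add: free_group_simps)
    then show ?thesis by blast
  qed
  obtain k l :: nat where "D [^] k \<otimes> inv x \<in> M" "D [^] l \<otimes> inv y \<in> M"
    using *[OF assms(1)] *[OF assms(2)] by blast
  then have "D [^] l \<otimes> (D [^] k \<otimes> inv x) \<in> M" "D [^] k \<otimes> (D [^] l \<otimes> inv y) \<in> M"
    by auto
  then show ?thesis
    using assms nat_pow_mult[of D l k] nat_pow_mult[of D k l]
    by (intro exI[of _ "k + l"]) (simp add: add.commute flip: m_assoc)
qed

lemma fraction:
  assumes "g \<in> carrier G"
  shows "\<exists>a\<in>M. \<exists>b\<in>M. g = inv a \<otimes> b"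
proof -
  have "g \<in> generate G S" using assms generate_S by simp
  then have "\<exists>k :: nat. \<exists>b\<in>M. g = inv (D [^] k) \<otimes> b"
  proof (induction rule: generate.induct)
    case one
    show ?case by (intro exI[of _ 0] bexI[of _ \<one>]) auto
  next
    case (incl s)
    then show ?case by (intro exI[of _ 0] bexI[of _ s]) auto
  next
    case (inv s)
    have "D \<otimes> (inv s \<otimes> D) \<otimes> inv D \<in> M" using inv by (intro conj_inv_D S_D)
    then show ?case
      using inv by (intro exI[of _ 1] bexI[of _ "D \<otimes> inv s"]) (auto simp: free_group_simps)
  next
    case (eng g h)
    obtain k l :: nat and b c where *: "b \<in> M" "c \<in> M"
      "g = inv (D [^] k) \<otimes> b" "h = inv (D [^] l) \<otimes> c"
      using eng by blast
    have "g \<otimes> h = inv (D [^] (l + k)) \<otimes> ((D [^] l \<otimes> b \<otimes> inv (D [^] l)) \<otimes> c)"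
      using * by (simp add: free_group_simps nat_pow_mult[symmetric])
    moreover have "(D [^] l \<otimes> b \<otimes> inv (D [^] l)) \<otimes> c \<in> M"
      using * conj_inv_pow_D by blast
    ultimately show ?case by blast
  qed
  then show ?thesis using pow_D_M by blast
qed

abbreviation monoid_M :: "'a monoid" where
  "monoid_M \<equiv> \<lparr>carrier = M, mult = (\<otimes>), one = \<one>\<rparr>"

lemma monoid_M: "monoid monoid_M"
  by unfold_locales (auto simp: m_assoc)

lemma divides_iff: "a \<in> M \<Longrightarrow> b \<in> M \<Longrightarrow> a divides\<^bsub>monoid_M\<^esub> b \<longleftrightarrow> inv a \<otimes> b \<in> M"
  unfolding factor_def by (auto intro!: bexI[of _ "inv a \<otimes> b"])

lemma divides_opp_iff: "a \<in> M \<Longrightarrow> b \<in> M \<Longrightarrow> a divides\<^bsub>opp monoid_M\<^esub> b \<longleftrightarrow> b \<otimes> inv a \<in> M"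
  unfolding factor_def opp_def by (auto intro!: bexI[of _ "b \<otimes> inv a"] simp: m_assoc)

text \<open>
  The least common multiple of \<open>s\<close> and \<open>t b\<close> is built from two squares: the one of \<open>s\<close> and \<open>t\<close>, and the
  one of \<open>t\<^sup>-\<^sup>1 (s \<or> t)\<close>, which is again simple, and \<open>b\<close>. Hence the complement \<open>x\<close> of \<open>b\<close> stays simple
  throughout the induction.
\<close>

lemma left_lcm_simple:
  assumes "b \<in> M" "s \<in> S"
  shows "\<exists>x\<in>S. inv s \<otimes> (b \<otimes> x) \<in> M \<and>
    (\<forall>m\<in>M. inv s \<otimes> m \<in> M \<longrightarrow> inv b \<otimes> m \<in> M \<longrightarrow> inv (b \<otimes> x) \<otimes> m \<in> M)"
  using assms
proof (induction arbitrary: s rule: M_induct)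
  case one
  then show ?case by (intro bexI[of _ s]) auto
next
  case (mult t b)
  obtain z where z: "z \<in> S" "inv s \<otimes> z \<in> S" "inv t \<otimes> z \<in> S"
    "\<And>m. m \<in> M \<Longrightarrow> inv s \<otimes> m \<in> M \<Longrightarrow> inv t \<otimes> m \<in> M \<Longrightarrow> inv z \<otimes> m \<in> M"
    using join_S[OF \<open>s \<in> S\<close> \<open>t \<in> S\<close>] by blast
  obtain x where x: "x \<in> S" "inv (inv t \<otimes> z) \<otimes> (b \<otimes> x) \<in> M"
    "\<And>m. m \<in> M \<Longrightarrow> inv (inv t \<otimes> z) \<otimes> m \<in> M \<Longrightarrow> inv b \<otimes> m \<in> M \<Longrightarrow> inv (b \<otimes> x) \<otimes> m \<in> M"
    using mult.IH[OF z(3)] by blast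
  have "inv s \<otimes> (t \<otimes> b \<otimes> x) = (inv s \<otimes> z) \<otimes> (inv (inv t \<otimes> z) \<otimes> (b \<otimes> x))"
    using mult.hyps mult.prems z(1) x(1) by (simp add: free_group_simps)
  then have "inv s \<otimes> (t \<otimes> b \<otimes> x) \<in> M" using z(2) x(2) by simp
  moreover have "inv (t \<otimes> b \<otimes> x) \<otimes> m \<in> M"
    if m: "m \<in> M" "inv s \<otimes> m \<in> M" "inv (t \<otimes> b) \<otimes> m \<in> M" for m
  proof -
    have "inv t \<otimes> m = b \<otimes> (inv (t \<otimes> b) \<otimes> m)"
      using mult.hyps m(1) by (simp add: free_group_simps)
    then have tm: "inv t \<otimes> m \<in> M" using mult.hyps m by auto
    have "inv (inv t \<otimes> z) \<otimes> (inv t \<otimes> m) = inv z \<otimes> m" "inv b \<otimes> (inv t \<otimes> m) = inv (t \<otimes> b) \<otimes> m"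
      using mult.hyps z(1) m(1) by (simp_all add: free_group_simps)
    then have "inv (b \<otimes> x) \<otimes> (inv t \<otimes> m) \<in> M"
      using x(3)[OF tm] z(4)[OF m(1,2) tm] m(3) by simp
    then show ?thesis using mult.hyps x(1) m(1) by (simp add: free_group_simps)
  qed
  ultimately show ?case by (intro bexI[OF _ x(1)] conjI ballI impI)
qed

text \<open>
  Stacking the rows of \<open>left_lcm_simple\<close>: the least common multiple of \<open>s a\<close> and \<open>b\<close> is \<open>s\<close> times the one
  of \<open>a\<close> and \<open>s\<^sup>-\<^sup>1 (s \<or> b)\<close>.
\<close>

lemma left_lcm:
  assumes "a \<in> M" "b \<in> M"
  shows "\<exists>c\<in>M. inv a \<otimes> c \<in> M \<and> inv b \<otimes> c \<in> M \<and>
    (\<forall>m\<in>M. inv a \<otimes> m \<in> M \<longrightarrow> inv b \<otimes> m \<in> M \<longrightarrow> inv c \<otimes> m \<in> M)"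
  using assms
proof (induction arbitrary: b rule: M_induct)
  case one
  then show ?case by (intro bexI[of _ b]) auto
next
  case (mult s a)
  obtain x where x: "x \<in> S" "inv s \<otimes> (b \<otimes> x) \<in> M"
    "\<And>m. m \<in> M \<Longrightarrow> inv s \<otimes> m \<in> M \<Longrightarrow> inv b \<otimes> m \<in> M \<Longrightarrow> inv (b \<otimes> x) \<otimes> m \<in> M"
    using left_lcm_simple[OF \<open>b \<in> M\<close> \<open>s \<in> S\<close>] by blast
  obtain c where c: "c \<in> M" "inv a \<otimes> c \<in> M" "inv (inv s \<otimes> (b \<otimes> x)) \<otimes> c \<in> M"
    "\<And>m. m \<in> M \<Longrightarrow> inv a \<otimes> m \<in> M \<Longrightarrow> inv (inv s \<otimes> (b \<otimes> x)) \<otimes> m \<in> M \<Longrightarrow> inv c \<otimes> m \<in> M"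
    using mult.IH[OF x(2)] by blast
  have "inv b \<otimes> (s \<otimes> c) = x \<otimes> (inv (inv s \<otimes> (b \<otimes> x)) \<otimes> c)"
    "inv (s \<otimes> a) \<otimes> (s \<otimes> c) = inv a \<otimes> c"
    using mult.hyps mult.prems x(1) c(1) by (simp_all add: free_group_simps)
  then have "inv b \<otimes> (s \<otimes> c) \<in> M" "inv (s \<otimes> a) \<otimes> (s \<otimes> c) \<in> M" using x(1) c(1-3) by auto
  moreover have "inv (s \<otimes> c) \<otimes> m \<in> M"
    if m: "m \<in> M" "inv (s \<otimes> a) \<otimes> m \<in> M" "inv b \<otimes> m \<in> M" for m
  proof -
    have "inv s \<otimes> m = a \<otimes> (inv (s \<otimes> a) \<otimes> m)"
      using mult.hyps m(1) by (simp add: free_group_simps)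
    then have sm: "inv s \<otimes> m \<in> M" using mult.hyps m by auto
    have "inv a \<otimes> (inv s \<otimes> m) = inv (s \<otimes> a) \<otimes> m"
      "inv (inv s \<otimes> (b \<otimes> x)) \<otimes> (inv s \<otimes> m) = inv (b \<otimes> x) \<otimes> m"
      using mult.hyps mult.prems x(1) m(1) by (simp_all add: free_group_simps)
    then have "inv c \<otimes> (inv s \<otimes> m) \<in> M"
      using c(4)[OF sm] x(3)[OF m(1) sm m(3)] m(2) by simp
    then show ?thesis using mult.hyps c(1) m(1) by (simp add: free_group_simps)
  qed
  ultimately show ?case using mult.hyps c(1) by (intro bexI[of _ "s \<otimes> c"] conjI ballI impI) auto
qed

text \<open>
  A common divisor of maximal length is greatest: its least common multiple with another common
  divisor is a common divisor too, and is not longer.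
\<close>

lemma left_gcd:
  assumes "a \<in> M" "b \<in> M"
  shows "\<exists>d\<in>M. inv d \<otimes> a \<in> M \<and> inv d \<otimes> b \<in> M \<and>
    (\<forall>e\<in>M. inv e \<otimes> a \<in> M \<longrightarrow> inv e \<otimes> b \<in> M \<longrightarrow> inv e \<otimes> d \<in> M)"
proof -
  define C where "C = {d \<in> M. inv d \<otimes> a \<in> M \<and> inv d \<otimes> b \<in> M}"
  have "len d \<le> len a" if "d \<in> C" for d
    using len_mult[of d "inv d \<otimes> a"] that assms by (simp add: C_def)
  moreover have "\<one> \<in> C" using assms by (simp add: C_def)
  ultimately have "\<exists>d. d \<in> C \<and> (\<forall>e. e \<in> C \<longrightarrow> len e \<le> len d)"
    by (intro ex_has_greatest_nat[of "\<lambda>d. d \<in> C" \<one> len "Suc (len a)"]) (auto simp: less_Suc_eq_le)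
  then obtain d where d: "d \<in> C" "\<And>e. e \<in> C \<Longrightarrow> len e \<le> len d" by blast
  have "inv e \<otimes> d \<in> M" if e: "e \<in> C" for e
  proof -
    obtain c where c: "c \<in> M" "inv d \<otimes> c \<in> M" "inv e \<otimes> c \<in> M"
      "\<And>m. m \<in> M \<Longrightarrow> inv d \<otimes> m \<in> M \<Longrightarrow> inv e \<otimes> m \<in> M \<Longrightarrow> inv c \<otimes> m \<in> M"
      using left_lcm[of d e] d(1) e by (auto simp: C_def)
    then have "c \<in> C" using assms d(1) e by (simp add: C_def)
    then have "len (inv d \<otimes> c) = 0"
      using d len_mult[of d "inv d \<otimes> c"] c by (fastforce simp: C_def)
    then have "inv d \<otimes> c = \<one>" using len_0 c by blast
    then have "c = d" using c d(1) inv_mult_cancel(2)[of d c] by (simp add: C_def)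
    then show ?thesis using c by simp
  qed
  then show ?thesis using d(1) by (auto simp: C_def)
qed

text \<open>
  The map \<open>x \<mapsto> E x\<^sup>-\<^sup>1\<close> with \<open>E\<close> a large power of \<open>D\<close> reverses the order: it turns right divisors of \<open>E\<close>
  into left divisors of \<open>E\<close>. So a right gcd comes from a left lcm.
\<close>

lemma right_gcd:
  assumes "a \<in> M" "b \<in> M"
  shows "\<exists>d\<in>M. a \<otimes> inv d \<in> M \<and> b \<otimes> inv d \<in> M \<and>
    (\<forall>e\<in>M. a \<otimes> inv e \<in> M \<longrightarrow> b \<otimes> inv e \<in> M \<longrightarrow> d \<otimes> inv e \<in> M)"
proof -
  obtain k :: nat where k: "D [^] k \<otimes> inv a \<in> M" "D [^] k \<otimes> inv b \<in> M"
    using right_divides_pow_D[OF assms] by blast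
  define E where "E = D [^] k"
  have E: "E \<in> M" "E \<otimes> inv a \<in> M" "E \<otimes> inv b \<in> M" using k by (simp_all add: E_def)
  obtain c where c: "c \<in> M" "inv (E \<otimes> inv a) \<otimes> c \<in> M" "inv (E \<otimes> inv b) \<otimes> c \<in> M"
    "\<And>m. m \<in> M \<Longrightarrow> inv (E \<otimes> inv a) \<otimes> m \<in> M \<Longrightarrow> inv (E \<otimes> inv b) \<otimes> m \<in> M \<Longrightarrow> inv c \<otimes> m \<in> M"
    using left_lcm[OF E(2,3)] by blast
  have "inv c \<otimes> E \<in> M" using c(4)[OF E(1)] E(1) assms by (simp add: free_group_simps)
  moreover have "a \<otimes> inv (inv c \<otimes> E) \<in> M" "b \<otimes> inv (inv c \<otimes> E) \<in> M"
    using c(1-3) E(1) assms by (simp_all add: free_group_simps)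
  moreover have "inv c \<otimes> E \<otimes> inv e \<in> M"
    if e: "e \<in> M" "a \<otimes> inv e \<in> M" "b \<otimes> inv e \<in> M" for e
  proof -
    have "(E \<otimes> inv a) \<otimes> (a \<otimes> inv e) \<in> M" using E e by blast
    then have "E \<otimes> inv e \<in> M" using E(1) e assms by (simp add: free_group_simps)
    from c(4)[OF this] show ?thesis using c(1) E(1) e assms by (simp add: free_group_simps)
  qed
  ultimately show ?thesis by (intro bexI[of _ "inv c \<otimes> E"] conjI ballI impI)
qed

text \<open>
  A common multiple of minimal length is least, since its right gcd with another common multiple
  is again a common multiple. Powers of \<open>D\<close> provide common multiples.
\<close>

lemma right_lcm:
  assumes "a \<in> M" "b \<in> M"
  shows "\<exists>c\<in>M. c \<otimes> inv a \<in> M \<and> c \<otimes> inv b \<in> M \<and>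
    (\<forall>m\<in>M. m \<otimes> inv a \<in> M \<longrightarrow> m \<otimes> inv b \<in> M \<longrightarrow> m \<otimes> inv c \<in> M)"
proof -
  define C where "C = {c \<in> M. c \<otimes> inv a \<in> M \<and> c \<otimes> inv b \<in> M}"
  obtain k :: nat where "D [^] k \<in> C"
    using right_divides_pow_D[OF assms] by (auto simp: C_def)
  then have "\<exists>c. c \<in> C \<and> (\<forall>m. m \<in> C \<longrightarrow> len c \<le> len m)"
    by (rule ex_has_least_nat[of "\<lambda>c. c \<in> C" "D [^] k" len])
  then obtain c where c: "c \<in> C" "\<And>m. m \<in> C \<Longrightarrow> len c \<le> len m" by blast
  have "m \<otimes> inv c \<in> M" if m: "m \<in> C" for m
  proof -
    obtain d where d: "d \<in> M" "c \<otimes> inv d \<in> M" "m \<otimes> inv d \<in> M"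
      "\<And>e. e \<in> M \<Longrightarrow> c \<otimes> inv e \<in> M \<Longrightarrow> m \<otimes> inv e \<in> M \<Longrightarrow> d \<otimes> inv e \<in> M"
      using right_gcd[of c m] c(1) m by (auto simp: C_def)
    then have "d \<in> C" using assms c(1) m by (simp add: C_def)
    moreover have "len c = len (c \<otimes> inv d) + len d"
      using len_mult[of "c \<otimes> inv d" d] c(1) d by (simp add: C_def m_assoc)
    ultimately have "len (c \<otimes> inv d) = 0" using c by fastforce
    then have "c \<otimes> inv d = \<one>" using len_0 d by blast
    then have "c = d" using c(1) d inv_equality[of c "inv d"] by (simp add: C_def)
    then show ?thesis using d by simp
  qed
  then show ?thesis using c(1) by (auto simp: C_def)
qed

lemma has_gcds_lcms_M: "has_gcds_lcms monoid_M"
  unfolding has_gcds_lcms_def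
proof (intro ballI conjI)
  fix a b assume "a \<in> carrier monoid_M" "b \<in> carrier monoid_M"
  then have ab: "a \<in> M" "b \<in> M" by simp_all
  from left_gcd[OF ab] show "\<exists>d\<in>carrier monoid_M. d gcdof\<^bsub>monoid_M\<^esub> a b"
    unfolding isgcd_def using ab by (simp add: divides_iff cong: conj_cong) (meson divides_iff)
  from left_lcm[OF ab] show "\<exists>m\<in>carrier monoid_M. m lcmof\<^bsub>monoid_M\<^esub> a b"
    unfolding islcm_def using ab by (simp add: divides_iff cong: conj_cong) (meson divides_iff)
qed

lemma has_gcds_lcms_opp_M: "has_gcds_lcms (opp monoid_M)"
  unfolding has_gcds_lcms_def
proof (intro ballI conjI)
  have c: "carrier (opp monoid_M) = M" by (simp add: opp_def)
  fix a b assume "a \<in> carrier (opp monoid_M)" "b \<in> carrier (opp monoid_M)"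
  then have ab: "a \<in> M" "b \<in> M" by (simp_all add: c)
  from right_gcd[OF ab] show "\<exists>d\<in>carrier (opp monoid_M). d gcdof\<^bsub>opp monoid_M\<^esub> a b"
    unfolding isgcd_def c using ab by (simp add: divides_opp_iff cong: conj_cong) (meson divides_opp_iff)
  from right_lcm[OF ab] show "\<exists>m\<in>carrier (opp monoid_M). m lcmof\<^bsub>opp monoid_M\<^esub> a b"
    unfolding islcm_def c using ab by (simp add: divides_opp_iff cong: conj_cong) (meson divides_opp_iff)
qed

text \<open>
  A divisor of \<open>D\<close> is a product of at most \<open>len D\<close> simple elements other than \<open>1\<close>.
\<close>

lemma finite_divisors: "finite {x \<in> M. inv x \<otimes> D \<in> M}"
proof (rule finite_subset)
  let ?L = "{xs. set xs \<subseteq> S - {\<one>} \<and> length xs \<le> len D}"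
  show "finite (list_prod G ` ?L)"
    using finite_S finite_lists_length_le by blast
  show "{x \<in> M. inv x \<otimes> D \<in> M} \<subseteq> list_prod G ` ?L"
  proof
    fix x assume "x \<in> {x \<in> M. inv x \<otimes> D \<in> M}"
    then have x: "x \<in> M" "len x \<le> len D"
      using len_mult[of x "inv x \<otimes> D"] by auto
    have "\<exists>xs. set xs \<subseteq> S - {\<one>} \<and> length xs \<le> len x \<and> list_prod G xs = x"
      using x(1)
    proof (induction rule: M_induct)
      case one
      show ?case by (rule exI[of _ "[]"]) simp
    next
      case (mult s x)
      then obtain xs where xs: "set xs \<subseteq> S - {\<one>}" "length xs \<le> len x" "list_prod G xs = x"
        by blast
      show ?case
      proof (cases "s = \<one>")
        case True
        then show ?thesis using xs mult.hyps by (intro exI[of _ xs]) simp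
      next
        case False
        then have "len s \<noteq> 0" using len_0[OF S_closed[OF mult.hyps(1)]] by auto
        then show ?thesis
          using False xs mult.hyps by (intro exI[of _ "s # xs"]) (simp add: len_mult)
      qed
    qed
    then obtain xs where "set xs \<subseteq> S - {\<one>}" "length xs \<le> len x" "x = list_prod G xs"
      by blast
    then show "x \<in> list_prod G ` ?L" using x(2) by (intro image_eqI[of _ _ xs]) simp_all
  qed
qed

lemma list_prod_monoid_M [simp]: "list_prod monoid_M xs = list_prod G xs"
  by (simp add: list_prod_def)

lemma garside_element_D: "garside_element monoid_M D"
  unfolding garside_element_def
proof (intro conjI ballI)
  have L: "divisors monoid_M D = {x \<in> M. inv x \<otimes> D \<in> M}"
    by (auto simp: divisors_def divides_iff)
  have R: "divisors (opp monoid_M) D = {x \<in> M. D \<otimes> inv x \<in> M}"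
    using divides_opp_iff by (auto simp: divisors_def opp_def)
  show "D \<in> carrier monoid_M" by simp
  have "inv x \<otimes> D \<in> M \<longleftrightarrow> D \<otimes> inv x \<in> M" if "x \<in> M" for x
    using that conj_D[of "D \<otimes> inv x"] conj_inv_D[of "inv x \<otimes> D"]
    by (auto simp: free_group_simps)
  then show "divisors monoid_M D = divisors (opp monoid_M) D" by (auto simp: L R)
  show "finite (divisors monoid_M D)" by (simp add: L finite_divisors)
  fix x assume "x \<in> carrier monoid_M"
  then obtain xs where "set xs \<subseteq> S" "list_prod G xs = x" using M_products by auto
  then show "\<exists>ds. set ds \<subseteq> divisors monoid_M D \<and> list_prod monoid_M ds = x"
    using S_D by (intro exI[of _ xs]) (auto simp: L)
qed

lemma Units_M: "Units monoid_M = {\<one>}"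
proof -
  have "x = \<one>" if "x \<in> M" "y \<in> M" "x \<otimes> y = \<one>" for x y
    using that len_mult[of x y] len_0[of x] by simp
  then show ?thesis by (auto simp: Units_def)
qed

theorem garside_group_G: "garside_group G"
  unfolding garside_group_def
proof (intro exI conjI)
  show "garside_monoid monoid_M"
    unfolding garside_monoid_def
    using monoid.monoid_cancelI[OF monoid_M] has_gcds_lcms_M has_gcds_lcms_opp_M Units_M
      garside_element_D by auto
  have "carrier G = {inv a \<otimes> b | a b. a \<in> M \<and> b \<in> M}"
  proof (intro equalityI subsetI)
    fix g assume "g \<in> carrier G"
    then show "g \<in> {inv a \<otimes> b | a b. a \<in> M \<and> b \<in> M}" using fraction by fast
  qed auto
  moreover have "(\<lambda>x. x) \<in> hom monoid_M G" by (rule homI) auto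
  ultimately show "group_of_fractions monoid_M G (\<lambda>x. x)"
    unfolding group_of_fractions_def using is_group by (intro conjI) auto
qed

end

section \<open>Cancellation in the monoid of an interval\<close>

text \<open>
  The partial monoid on \<open>P = [1, w]\<close> only depends on the following properties of reflection length.
  Two elements of \<open>P\<close> are composable if their product lies in \<open>P\<close> and lengths add up; then \<open>u v\<close> is
  defined if and only if \<open>v\<close> is below the complement of \<open>u\<close> (\<open>composable_iff\<close>).
\<close>

locale absolute_length = group W for W (structure) +
  fixes L :: "'a \<Rightarrow> nat" and w :: 'a
  assumes w_closed [simp]: "w \<in> carrier W"
    and L_0: "x \<in> carrier W \<Longrightarrow> L x = 0 \<longleftrightarrow> x = \<one>"
    and L_mult: "x \<in> carrier W \<Longrightarrow> y \<in> carrier W \<Longrightarrow> L (x \<otimes> y) \<le> L x + L y"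
    and L_conj: "x \<in> carrier W \<Longrightarrow> y \<in> carrier W \<Longrightarrow> L (inv y \<otimes> x \<otimes> y) = L x"
begin

definition le :: "'a \<Rightarrow> 'a \<Rightarrow> bool" where
  "le x y \<longleftrightarrow> L y = L x + L (inv x \<otimes> y)"

definition P :: "'a set" where
  "P = {x \<in> carrier W. le x w}"

lemma P_iff: "x \<in> carrier W \<Longrightarrow> x \<in> P \<longleftrightarrow> L w = L x + L (inv x \<otimes> w)"
  by (simp add: P_def le_def)

lemma P_L: "x \<in> P \<Longrightarrow> L w = L x + L (inv x \<otimes> w)"
  by (simp add: P_def le_def)

lemma P_closed [simp]: "x \<in> P \<Longrightarrow> x \<in> carrier W"
  by (simp add: P_def)

lemma L_one [simp]: "L \<one> = 0"
  by (simp add: L_0)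

lemma le_refl [simp]: "x \<in> carrier W \<Longrightarrow> le x x"
  by (simp add: le_def)

lemma le_antisym: "le x y \<Longrightarrow> le y x \<Longrightarrow> x \<in> carrier W \<Longrightarrow> y \<in> carrier W \<Longrightarrow> x = y"
  using L_0[of "inv x \<otimes> y"] inv_mult_cancel(2)[of x y] by (simp add: le_def)

lemma le_trans:
  assumes "le x y" "le y z" "x \<in> carrier W" "y \<in> carrier W" "z \<in> carrier W"
  shows "le x z"
proof -
  have "L (inv x \<otimes> z) \<le> L (inv x \<otimes> y) + L (inv y \<otimes> z)"
    using L_mult[of "inv x \<otimes> y" "inv y \<otimes> z"] assms(3-5) by (simp add: free_group_simps)
  moreover have "L z \<le> L x + L (inv x \<otimes> z)"
    using L_mult[of x "inv x \<otimes> z"] assms(3-5) by simp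
  ultimately show ?thesis using assms(1,2) by (simp add: le_def)
qed

lemma le_P: "le x y \<Longrightarrow> x \<in> carrier W \<Longrightarrow> y \<in> P \<Longrightarrow> x \<in> P"
  using le_trans[of x y w] by (simp add: P_def del: P_closed)

lemma one_P [simp]: "\<one> \<in> P"
  by (simp add: P_iff)

lemma w_P [simp]: "w \<in> P"
  by (simp add: P_iff)

lemma L_conj': "x \<in> carrier W \<Longrightarrow> y \<in> carrier W \<Longrightarrow> L (y \<otimes> x \<otimes> inv y) = L x"
  using L_conj[of x "inv y"] by simp

text \<open>
  The complement of \<open>x\<^sup>-\<^sup>1 w\<close> is \<open>w\<^sup>-\<^sup>1 x w\<close>, which has the same length as \<open>x\<close>.
\<close>

lemma compl_P [simp]: "x \<in> P \<Longrightarrow> inv x \<otimes> w \<in> P"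
  using L_conj[of x w] P_L[of x] by (simp add: P_iff free_group_simps)

lemma conj_P [simp]: "x \<in> P \<Longrightarrow> inv w \<otimes> x \<otimes> w \<in> P" "x \<in> P \<Longrightarrow> w \<otimes> x \<otimes> inv w \<in> P"
  using compl_P[of "inv x \<otimes> w"] L_conj'[of "inv x \<otimes> w" w] L_conj'[of x w] P_L[of x]
  by (simp_all add: P_iff[of "w \<otimes> (x \<otimes> inv w)"] free_group_simps)

definition composable :: "'a \<Rightarrow> 'a \<Rightarrow> bool" where
  "composable u v \<longleftrightarrow> u \<in> P \<and> v \<in> P \<and> u \<otimes> v \<in> P \<and> L (u \<otimes> v) = L u + L v"

lemma composableD:
  "composable u v \<Longrightarrow> u \<in> P" "composable u v \<Longrightarrow> v \<in> P" "composable u v \<Longrightarrow> u \<otimes> v \<in> P"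
  "composable u v \<Longrightarrow> L (u \<otimes> v) = L u + L v"
  by (simp_all add: composable_def)

lemma composable_iff:
  assumes "u \<in> P" "v \<in> carrier W"
  shows "composable u v \<longleftrightarrow> le v (inv u \<otimes> w)"
proof
  have u: "u \<in> carrier W" "L w = L u + L (inv u \<otimes> w)" using assms P_L by simp_all
  assume "composable u v"
  then have "L w = L u + L v + L (inv (u \<otimes> v) \<otimes> w)"
    using P_L[of "u \<otimes> v"] by (simp add: composable_def)
  then show "le v (inv u \<otimes> w)" using u assms(2) by (simp add: le_def free_group_simps)
next
  have u: "u \<in> carrier W" "L w = L u + L (inv u \<otimes> w)" using assms P_L by simp_all
  assume v: "le v (inv u \<otimes> w)"
  have "L w \<le> L (u \<otimes> v) + L (inv (u \<otimes> v) \<otimes> w)"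
    using L_mult[of "u \<otimes> v" "inv (u \<otimes> v) \<otimes> w"] u assms(2) by simp
  moreover have "L (u \<otimes> v) \<le> L u + L v" using L_mult u assms(2) by simp
  ultimately have "L (u \<otimes> v) = L u + L v" "L w = L (u \<otimes> v) + L (inv (u \<otimes> v) \<otimes> w)"
    using u v assms(2) by (simp_all add: le_def free_group_simps)
  moreover have "v \<in> P" using le_P[OF v assms(2) compl_P[OF assms(1)]] .
  ultimately show "composable u v"
    using assms u(1) by (simp add: composable_def P_iff[of "u \<otimes> v"])
qed

lemma composable_factor:
  assumes "le u p" "u \<in> carrier W" "p \<in> P"
  shows "composable u (inv u \<otimes> p)"
proof -
  have "L (inv u \<otimes> w) \<le> L (inv u \<otimes> p) + L (inv p \<otimes> w)"
    using L_mult[of "inv u \<otimes> p" "inv p \<otimes> w"] assms(2,3) by (simp add: free_group_simps)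
  moreover have u: "u \<in> P" using le_P assms by blast
  ultimately have "le (inv u \<otimes> p) (inv u \<otimes> w)"
    using P_L[OF u] P_L[OF assms(3)] assms by (simp add: le_def free_group_simps)
  then show ?thesis using composable_iff[OF u] assms by simp
qed

lemma le_composable: "composable u v \<Longrightarrow> le u (u \<otimes> v)"
  by (simp add: composable_def le_def)

text \<open>
  Both sides say that the lengths of \<open>u\<close>, \<open>v\<close>, \<open>z\<close> add up along \<open>u v z\<close>, which lies in \<open>P\<close>.
\<close>

lemma composable_assoc:
  assumes uv: "composable u v" and z: "z \<in> carrier W"
  shows "composable (u \<otimes> v) z \<longleftrightarrow> composable v z \<and> composable u (v \<otimes> z)"
proof
  note P = composableD(1-3)[OF uv, THEN P_closed]
  have Lu: "L w = L u + L (inv u \<otimes> w)" using P_L[OF composableD(1)[OF uv]] .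
  assume c: "composable (u \<otimes> v) z"
  have "L (u \<otimes> (v \<otimes> z)) \<le> L u + L (v \<otimes> z)" "L (v \<otimes> z) \<le> L v + L z"
    using L_mult P z by simp_all
  then have L: "L (v \<otimes> z) = L v + L z" "L (u \<otimes> (v \<otimes> z)) = L u + L (v \<otimes> z)"
    using composableD(4)[OF uv] composableD(4)[OF c] P z by (simp_all add: m_assoc)
  have uvz: "u \<otimes> (v \<otimes> z) \<in> P" using composableD(3)[OF c] P z by (simp add: m_assoc)
  then have "L w = L (u \<otimes> (v \<otimes> z)) + L (inv (u \<otimes> (v \<otimes> z)) \<otimes> w)" by (rule P_L)
  then have "le (v \<otimes> z) (inv u \<otimes> w)"
    using L Lu P z by (simp add: le_def free_group_simps)
  then have "v \<otimes> z \<in> P" using le_P[of "v \<otimes> z" "inv u \<otimes> w"] P z composableD(1)[OF uv] by simp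
  then show "composable v z \<and> composable u (v \<otimes> z)"
    using L uvz composableD[OF uv] composableD[OF c] by (simp add: composable_def)
next
  assume "composable v z \<and> composable u (v \<otimes> z)"
  then show "composable (u \<otimes> v) z"
    using uv z by (auto simp: composable_def m_assoc)
qed

lemma le_mult_left:
  assumes "composable u x" "composable u y"
  shows "le (u \<otimes> x) (u \<otimes> y) \<longleftrightarrow> le x y"
  using assms by (auto simp: composable_def le_def free_group_simps)

lemma composable_conj: "composable u v \<Longrightarrow> composable (inv w \<otimes> u \<otimes> w) (inv w \<otimes> v \<otimes> w)"
  using L_conj[of u w] L_conj[of v w] L_conj[of "u \<otimes> v" w] conj_P(1)[of u] conj_P(1)[of v]
    conj_P(1)[of "u \<otimes> v"]
  by (auto simp: composable_def free_group_simps)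

lemma composable_conj': "composable u v \<Longrightarrow> composable (w \<otimes> u \<otimes> inv w) (w \<otimes> v \<otimes> inv w)"
  using L_conj'[of u w] L_conj'[of v w] L_conj'[of "u \<otimes> v" w] conj_P(2)[of u] conj_P(2)[of v]
    conj_P(2)[of "u \<otimes> v"]
  by (auto simp: composable_def free_group_simps)

text \<open>
  Equality of positive words in the monoid presented by the partial product. The rule \<open>one\<close>
  identifies the letter \<open>1\<close> with the empty word; the partial product alone removes it only from
  words with another letter.
\<close>

inductive peq :: "'a list \<Rightarrow> 'a list \<Rightarrow> bool" where
  refl: "set m \<subseteq> P \<Longrightarrow> peq m m"
| sym: "peq m n \<Longrightarrow> peq n m"
| trans: "peq m n \<Longrightarrow> peq n k \<Longrightarrow> peq m k"
| comp: "composable u v \<Longrightarrow> set m \<subseteq> P \<Longrightarrow> peq (u # v # m) (u \<otimes> v # m)"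
| one: "set m \<subseteq> P \<Longrightarrow> peq (\<one> # m) m"
| cons: "x \<in> P \<Longrightarrow> peq m n \<Longrightarrow> peq (x # m) (x # n)"

declare peq.trans [trans]

lemma peq_P: assumes "peq m n" shows "set m \<subseteq> P" "set n \<subseteq> P"
  using assms by (induction rule: peq.induct) (auto dest: composableD)

lemma peq_append_right: "peq m n \<Longrightarrow> set k \<subseteq> P \<Longrightarrow> peq (m @ k) (n @ k)"
proof (induction rule: peq.induct)
  case (sym m n) then show ?case by (blast intro: peq.sym)
next
  case (trans m n k) then show ?case by (blast intro: peq.trans)
qed (simp_all add: peq.refl peq.comp peq.one peq.cons)

lemma peq_map:
  assumes "\<And>u v. composable u v \<Longrightarrow> composable (f u) (f v) \<and> f (u \<otimes> v) = f u \<otimes> f v"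
    and "f \<one> = \<one>" "\<And>x. x \<in> P \<Longrightarrow> f x \<in> P" "peq m n"
  shows "peq (map f m) (map f n)"
proof -
  have f: "set (map f m) \<subseteq> P" if "set m \<subseteq> P" for m using that assms(3) by auto
  show ?thesis using assms(4)
  proof (induction rule: peq.induct)
    case (refl m) then show ?case using peq.refl[OF f] by blast
  next
    case (sym m n) then show ?case by (blast intro: peq.sym)
  next
    case (trans m n k) then show ?case by (blast intro: peq.trans)
  next
    case (comp u v m) then show ?case using assms(1)[of u v] peq.comp[of "f u" "f v", OF _ f] by simp
  next
    case (one m) then show ?case using peq.one[OF f] assms(2) by simp
  next
    case (cons x m n) then show ?case using peq.cons assms(3) by simp
  qed
qed

abbreviation \<sigma> :: "'a \<Rightarrow> 'a" where "\<sigma> x \<equiv> inv w \<otimes> x \<otimes> w"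

abbreviation \<tau> :: "'a \<Rightarrow> 'a" where "\<tau> x \<equiv> w \<otimes> x \<otimes> inv w"

lemma peq_map_\<sigma>: "peq m n \<Longrightarrow> peq (map \<sigma> m) (map \<sigma> n)"
  by (rule peq_map[of \<sigma>])
    (simp_all add: composable_conj conj_P(1), simp add: composable_def free_group_simps)

lemma peq_map_\<tau>: "peq m n \<Longrightarrow> peq (map \<tau> m) (map \<tau> n)"
  by (rule peq_map[of \<tau>])
    (simp_all add: composable_conj' conj_P(2), simp add: composable_def free_group_simps)

lemma map_\<tau>_\<sigma>: "set m \<subseteq> P \<Longrightarrow> map \<tau> (map \<sigma> m) = m"
  by (induction m) (auto simp: free_group_simps)

lemma peq_sum_L: "peq m n \<Longrightarrow> sum_list (map L m) = sum_list (map L n)"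
  by (induction rule: peq.induct) (auto dest: composableD)

lemma composable_compl: "x \<in> P \<Longrightarrow> composable x (inv x \<otimes> w)"
  by (simp add: composable_iff)

lemma composable_compl':
  assumes "x \<in> P" shows "composable (inv x \<otimes> w) (\<sigma> x)"
  using composable_compl[of "inv x \<otimes> w"] assms by (simp add: free_group_simps)

text \<open>
  \<open>x w = w \<sigma>(x)\<close>, because both sides are \<open>x (x\<^sup>-\<^sup>1 w) \<sigma>(x)\<close>.
\<close>

lemma peq_w:
  assumes "set m \<subseteq> P"
  shows "peq (m @ [w]) (w # map \<sigma> m)"
  using assms
proof (induction m)
  case Nil
  then show ?case by (simp add: peq.refl)
next
  case (Cons x m)
  then have x: "x \<in> P" and m: "set m \<subseteq> P" by simp_all
  then have m': "set (map \<sigma> m) \<subseteq> P" by auto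
  have "peq (x # m @ [w]) (x # w # map \<sigma> m)" using Cons.IH[OF m] x by (rule peq.cons[rotated])
  also have "peq (x # w # map \<sigma> m) (x # (inv x \<otimes> w) # \<sigma> x # map \<sigma> m)"
    using peq.sym[OF peq.comp[OF composable_compl'[OF x] m']] x
    by (intro peq.cons) (auto simp: free_group_simps)
  also have "peq (x # (inv x \<otimes> w) # \<sigma> x # map \<sigma> m) (w # \<sigma> x # map \<sigma> m)"
    using peq.comp[OF composable_compl[OF x], of "\<sigma> x # map \<sigma> m"] x m' by simp
  finally show ?case by simp
qed

end

locale interval_germ = absolute_length +
  assumes finite_P: "finite P"
    and meet: "x \<in> P \<Longrightarrow> y \<in> P \<Longrightarrow> \<exists>z\<in>P. le z x \<and> le z y \<and> (\<forall>u\<in>P. le u x \<longrightarrow> le u y \<longrightarrow> le u z)"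
    and join: "x \<in> P \<Longrightarrow> y \<in> P \<Longrightarrow> \<exists>z\<in>P. le x z \<and> le y z \<and> (\<forall>u\<in>P. le x u \<longrightarrow> le y u \<longrightarrow> le z u)"
begin

definition glb :: "'a \<Rightarrow> 'a \<Rightarrow> 'a" where
  "glb x y = (SOME z. z \<in> P \<and> le z x \<and> le z y \<and> (\<forall>u\<in>P. le u x \<longrightarrow> le u y \<longrightarrow> le u z))"

lemma glb:
  assumes "x \<in> P" "y \<in> P"
  shows "glb x y \<in> P" "le (glb x y) x" "le (glb x y) y"
    "\<And>u. u \<in> P \<Longrightarrow> le u x \<Longrightarrow> le u y \<Longrightarrow> le u (glb x y)"
proof -
  have "\<exists>z. z \<in> P \<and> le z x \<and> le z y \<and> (\<forall>u\<in>P. le u x \<longrightarrow> le u y \<longrightarrow> le u z)"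
    using meet[OF assms] by blast
  from someI_ex[OF this]
  show "glb x y \<in> P" "le (glb x y) x" "le (glb x y) y"
    "\<And>u. u \<in> P \<Longrightarrow> le u x \<Longrightarrow> le u y \<Longrightarrow> le u (glb x y)"
    unfolding glb_def[symmetric] by blast+
qed

text \<open>
  The largest left factor of \<open>v\<close> that \<open>u\<close> can absorb, so that \<open>u (absorb u v)\<close> is the largest divisor in
  \<open>P\<close> of the two-letter word \<open>u, v\<close>.
\<close>

definition absorb :: "'a \<Rightarrow> 'a \<Rightarrow> 'a" where
  "absorb u v = glb (inv u \<otimes> w) v"

lemma absorb:
  assumes "u \<in> P" "v \<in> P"
  shows "absorb u v \<in> P" "composable u (absorb u v)" "le (absorb u v) v"
    "composable (absorb u v) (inv (absorb u v) \<otimes> v)"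
    "\<And>z. composable u z \<Longrightarrow> le z v \<Longrightarrow> le z (absorb u v)"
proof -
  note g = glb[of "inv u \<otimes> w" v, OF compl_P[OF assms(1)] assms(2), folded absorb_def]
  show "absorb u v \<in> P" "le (absorb u v) v" by (fact g)+
  show "composable u (absorb u v)" using g assms by (simp add: composable_iff)
  show "composable (absorb u v) (inv (absorb u v) \<otimes> v)" using g assms by (simp add: composable_factor)
  show "le z (absorb u v)" if "composable u z" "le z v" for z
    using that g(4)[of z] composableD(2)[OF that(1)] composable_iff[of u z] assms by simp
qed

text \<open>
  Whether \<open>u\<close> and \<open>v\<close> absorb \<open>a\<close> one after the other or as the single letter \<open>u v\<close>, they arrive at the
  same element: everything that \<open>u\<close> absorbs from \<open>v d\<close> begins with \<open>v\<close>, hence has the form \<open>v e'\<close>, and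
  then \<open>u v\<close> absorbs \<open>e'\<close> from \<open>a\<close>. This makes the head of a word well defined on the monoid.
\<close>

lemma absorb_assoc:
  assumes uv: "composable u v" and a: "a \<in> P"
  shows "absorb u (v \<otimes> absorb v a) = v \<otimes> absorb (u \<otimes> v) a"
proof -
  note P = composableD(1-3)[OF uv]
  define d e where "d = absorb v a" and "e = absorb (u \<otimes> v) a"
  note d = absorb[OF P(2) a, folded d_def] and e = absorb[OF P(3) a, folded e_def]
  note vd = composableD(3)[OF d(2)]
  define x where "x = absorb u (v \<otimes> d)"
  note x = absorb[OF P(1) vd, folded x_def]
  have ve: "composable v e" "composable u (v \<otimes> e)"
    using composable_assoc[OF uv, of e] e by auto
  have "le (v \<otimes> e) (v \<otimes> d)"
    using d(5)[OF ve(1) e(3)] le_mult_left[OF ve(1) d(2)] by simp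
  from x(5)[OF ve(2) this] have 1: "le (v \<otimes> e) x" .
  have "le v x" using x(5)[OF uv le_composable[OF d(2)]] .
  from composable_factor[OF this] have vx: "composable v (inv v \<otimes> x)" using P x by simp
  have "composable (u \<otimes> v) (inv v \<otimes> x)"
    using composable_assoc[OF uv, of "inv v \<otimes> x"] vx x P by simp
  moreover have "le (inv v \<otimes> x) d"
    using le_mult_left[OF vx d(2)] x(1,3) P by simp
  then have "le (inv v \<otimes> x) a" using le_trans[OF _ d(3)] x d(1) a P by simp
  ultimately have "le (inv v \<otimes> x) e" by (rule e(5))
  then have "le x (v \<otimes> e)" using le_mult_left[OF vx ve(1)] x P by simp
  then show ?thesis
    unfolding d_def[symmetric] e_def[symmetric] x_def[symmetric]
    using le_antisym[OF _ 1] x ve P e by simp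
qed

text \<open>
  Following Michel, a word over \<open>P\<close> is normalized from the right: \<open>head m\<close> will be the largest divisor
  of \<open>m\<close> in \<open>P\<close>, and \<open>rest m\<close> the remaining cofactor.
\<close>

primrec head :: "'a list \<Rightarrow> 'a" where
  "head [] = \<one>"
| "head (x # m) = x \<otimes> absorb x (head m)"

primrec rest :: "'a list \<Rightarrow> 'a list" where
  "rest [] = []"
| "rest (x # m) = (inv (absorb x (head m)) \<otimes> head m) # rest m"

lemma head_rest_P:
  assumes "set m \<subseteq> P"
  shows "head m \<in> P \<and> set (rest m) \<subseteq> P"
  using assms
proof (induction m)
  case (Cons x m)
  then show ?case using absorb[of x "head m"] composableD by auto
qed simp

lemma peq_head_rest:
  assumes "set m \<subseteq> P"
  shows "peq (head m # rest m) m"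
  using assms
proof (induction m)
  case Nil
  then show ?case using peq.one[of "[]"] by simp
next
  case (Cons x m)
  then have x: "x \<in> P" and m: "set m \<subseteq> P" by simp_all
  define d where "d = absorb x (head m)"
  note h = head_rest_P[OF m]
  note d = absorb[OF x, of "head m", folded d_def]
  have dh: "inv d \<otimes> head m \<in> P" using d h composableD by blast
  have "peq (x \<otimes> d # inv d \<otimes> head m # rest m) (x # d # inv d \<otimes> head m # rest m)"
    using peq.sym[OF peq.comp[OF d(2)]] h dh by simp
  also have "peq (x # d # inv d \<otimes> head m # rest m) (x # head m # rest m)"
    using peq.cons[OF x peq.comp[OF d(4)]] h d(1) by simp
  also have "peq (x # head m # rest m) (x # m)"
    using Cons.IH[OF m] x by (rule peq.cons[rotated])
  finally show ?case by (simp add: d_def)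
qed

text \<open>
  Head and rest are invariants of the element of the monoid. The interesting case is a relation \<open>u
  v = u \<otimes> v\<close> at the front, which is \<open>absorb_assoc\<close>.
\<close>

lemma peq_head_rest_eq: "peq m n \<Longrightarrow> head m = head n \<and> peq (rest m) (rest n)"
proof (induction rule: peq.induct)
  case (refl m)
  then show ?case using head_rest_P peq.refl by blast
next
  case (sym m n)
  then show ?case by (auto intro: peq.sym)
next
  case (trans m n k)
  then show ?case by (auto intro: peq.trans)
next
  case (comp u v m)
  note P = composableD(1-3)[OF comp(1)] and h = head_rest_P[OF comp(2)]
  define a where "a = head m"
  define d e where "d = absorb v a" and "e = absorb (u \<otimes> v) a"
  have a: "a \<in> P" using h by (simp add: a_def)
  note d = absorb[OF P(2) a, folded d_def] and e = absorb[OF P(3) a, folded e_def]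
  have x: "absorb u (v \<otimes> d) = v \<otimes> e" using absorb_assoc[OF comp(1) a] by (simp add: d_def e_def)
  have "le e d" using d(5)[OF _ e(3)] composable_assoc[OF comp(1), of e] e by simp
  from composable_factor[OF this] have ed: "composable e (inv e \<otimes> d)" using d e by simp
  have "composable (inv e \<otimes> d) (inv d \<otimes> a)"
    using composable_assoc[OF ed, of "inv d \<otimes> a"] d e a by simp
  from peq.comp[OF this] have "peq ((inv e \<otimes> d) # (inv d \<otimes> a) # rest m) (inv e \<otimes> a # rest m)"
    using h a d(1) e(1) by (simp add: free_group_simps)
  moreover have "inv (v \<otimes> e) \<otimes> (v \<otimes> d) = inv e \<otimes> d"
    using P d(1) e(1) by (simp add: free_group_simps)
  ultimately show ?case
    using x P e(1) by (simp add: a_def[symmetric] d_def[symmetric] e_def[symmetric] m_assoc)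
next
  case (one m)
  note h = head_rest_P[OF one]
  have "composable \<one> (head m)" using h by (simp add: composable_def)
  from absorb(5)[OF one_P _ this] absorb(1,3)[OF one_P, of "head m"] h
  have "absorb \<one> (head m) = head m" by (intro le_antisym) auto
  then show ?case using h peq.one by simp
next
  case (cons x m n)
  note h = head_rest_P[OF peq_P(1)[OF cons(2)]]
  have "inv (absorb x (head m)) \<otimes> head m \<in> P"
    using absorb(4)[OF cons(1), of "head m"] h composableD by blast
  then show ?case using cons peq.cons by auto
qed

text \<open>
  If \<open>d\<close> is what \<open>x\<close> absorbs from \<open>head m\<close>, then \<open>m = d (rest (x m))\<close> and \<open>head (x m) = x d\<close>. So \<open>x m\<close>
  determines \<open>d\<close> and the rest, hence \<open>m\<close>.
\<close>

lemma peq_left_cancel: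
  assumes "peq (x # m) (x # n)"
  shows "peq m n"
proof -
  have x: "x \<in> P" and m: "set m \<subseteq> P" and n: "set n \<subseteq> P" using peq_P[OF assms] by auto
  have *: "peq (absorb x (head k) # rest (x # k)) k" if k: "set k \<subseteq> P" for k
  proof -
    note h = head_rest_P[OF k]
    have "peq (absorb x (head k) # rest (x # k)) (head k # rest k)"
      using peq.comp[OF absorb(4)[OF x, of "head k"], of "rest k"] h absorb(1)[OF x] by simp
    then show ?thesis using peq_head_rest[OF k] by (rule peq.trans)
  qed
  have "head (x # m) = head (x # n)" "peq (rest (x # m)) (rest (x # n))"
    using peq_head_rest_eq[OF assms] by blast+
  moreover from this(1) have "absorb x (head m) = absorb x (head n)"
    using x absorb(1)[OF x] head_rest_P[OF m] head_rest_P[OF n] by simp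
  ultimately have "peq (absorb x (head m) # rest (x # m)) (absorb x (head n) # rest (x # n))"
    using peq.cons absorb(1)[OF x] head_rest_P[OF n] by simp
  then show ?thesis using *[OF m] *[OF n] by (blast intro: peq.sym peq.trans)
qed

lemma peq_right_cancel_w:
  assumes "peq (m @ [w]) (n @ [w])"
  shows "peq m n"
proof -
  have mn: "set m \<subseteq> P" "set n \<subseteq> P" using peq_P[OF assms] by auto
  have "peq (w # map \<sigma> m) (w # map \<sigma> n)"
    using assms peq_w[OF mn(1)] peq_w[OF mn(2)] by (blast intro: peq.sym peq.trans)
  from peq_map_\<tau>[OF peq_left_cancel[OF this]] show ?thesis
    using map_\<tau>_\<sigma> mn by metis
qed

end

section \<open>Embedding of the monoid into the interval group\<close>

context absolute_length
begin

lemma le_w: "x \<in> P \<Longrightarrow> le x w"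
  unfolding P_def by blast

definition germ_relations :: "('a word \<times> 'a word) set" where
  "germ_relations = {(positive [u, v], positive [u \<otimes> v]) | u v. composable u v}"

abbreviation germ_group :: "'a word set monoid" where
  "germ_group \<equiv> presented_group P germ_relations"

abbreviation gen :: "'a \<Rightarrow> 'a word set" where
  "gen \<equiv> presented_gen P germ_relations"

definition cls :: "'a list \<Rightarrow> 'a word set" where
  "cls m = list_prod germ_group (map gen m)"

sublocale G: group germ_group
  by (rule group_presented_group)

lemma positive_words [simp]: "positive m \<in> words X \<longleftrightarrow> set m \<subseteq> X"
  by (auto simp: positive_def words_def)

lemma cls_eq: "set m \<subseteq> P \<Longrightarrow> cls m = word_eq P germ_relations `` {positive m}"
  by (simp add: cls_def eval_word_presented_gen flip: eval_word_positive)

lemma cls_simps [simp]: "cls [] = \<one>\<^bsub>germ_group\<^esub>" "cls (x # m) = gen x \<otimes>\<^bsub>germ_group\<^esub> cls m"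
  by (simp_all add: cls_def)

lemma cls_closed [simp]: "set m \<subseteq> P \<Longrightarrow> cls m \<in> carrier germ_group"
  unfolding cls_def by (rule G.list_prod_closed) auto

lemma cls_append:
  "set m \<subseteq> P \<Longrightarrow> set n \<subseteq> P \<Longrightarrow> cls (m @ n) = cls m \<otimes>\<^bsub>germ_group\<^esub> cls n"
  unfolding cls_def map_append by (rule G.list_prod_append) auto

lemma gen_mult:
  assumes "composable u v"
  shows "gen u \<otimes>\<^bsub>germ_group\<^esub> gen v = gen (u \<otimes> v)"
proof -
  note P = composableD(1-3)[OF assms]
  have "(positive [u, v], positive [u \<otimes> v]) \<in> germ_relations"
    using assms by (auto simp: germ_relations_def)
  from presented_group_rel[OF this, of P] P show ?thesis by simp
qed

lemma gen_one: "gen \<one> = \<one>\<^bsub>germ_group\<^esub>"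
proof -
  have "composable \<one> \<one>" by (simp add: composable_def)
  from gen_mult[OF this] show ?thesis
    using G.r_cancel_one[of "gen \<one>" "gen \<one>"] by simp
qed

lemma cls_eq_if_peq: "peq m n \<Longrightarrow> cls m = cls n"
proof (induction rule: peq.induct)
  case (comp u v m)
  note P = composableD(1-3)[OF comp(1)]
  have "gen u \<otimes>\<^bsub>germ_group\<^esub> (gen v \<otimes>\<^bsub>germ_group\<^esub> cls m) = gen (u \<otimes> v) \<otimes>\<^bsub>germ_group\<^esub> cls m"
    using P comp(2) gen_mult[OF comp(1)] by (simp flip: G.m_assoc)
  then show ?case by simp
next
  case (one m)
  then show ?case by (simp add: gen_one)
qed simp_all

lemma cls_w: "set m \<subseteq> P \<Longrightarrow> cls m \<otimes>\<^bsub>germ_group\<^esub> gen w = gen w \<otimes>\<^bsub>germ_group\<^esub> cls (map \<sigma> m)"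
  using cls_eq_if_peq[OF peq_w, of m] cls_append[of m "[w]"] by simp

end

context interval_germ
begin

text \<open>
  The pair \<open>(m, k)\<close> stands for the fraction \<open>m w\<^sup>-\<^sup>k\<close>. Letters of the group act on fractions from the
  left, the inverse of \<open>x\<close> by \<open>x\<^sup>-\<^sup>1 m w\<^sup>-\<^sup>k = (x\<^sup>-\<^sup>1 w) \<sigma>(m) w\<^sup>-\<^sup>k\<^sup>-\<^sup>1\<close>. The value of this action on the
  trivial fraction separates positive words that differ in the monoid.
\<close>

fun act :: "'a \<times> bool \<Rightarrow> 'a list \<times> nat \<Rightarrow> 'a list \<times> nat" where
  "act (x, True) (m, k) = (x # m, k)"
| "act (x, False) (m, k) = (inv x \<otimes> w # map \<sigma> m, Suc k)"

definition fraction_eq :: "'a list \<times> nat \<Rightarrow> 'a list \<times> nat \<Rightarrow> bool" where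
  "fraction_eq p q \<longleftrightarrow> peq (fst p @ replicate (snd q) w) (fst q @ replicate (snd p) w)"

lemma peq_right_cancel_pow_w: "peq (m @ replicate k w) (n @ replicate k w) \<Longrightarrow> peq m n"
proof (induction k)
  case (Suc k)
  then show ?case
    using peq_right_cancel_w[of "m @ replicate k w" "n @ replicate k w"]
    by (simp add: replicate_append_same[symmetric])
qed simp

lemma set_replicate_w: "set (replicate k w) \<subseteq> P"
  by auto

lemma fraction_eq_refl: "set m \<subseteq> P \<Longrightarrow> fraction_eq (m, k) (m, k)"
  by (auto simp: fraction_eq_def intro!: peq.refl)

text \<open>
  Clearing denominators needs right cancellation of \<open>w\<close>, and this is where cancellativity of the
  monoid is used to embed it into the group.
\<close>

lemma fraction_eq_trans:
  assumes "fraction_eq p q" "fraction_eq q r"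
  shows "fraction_eq p r"
proof -
  obtain a i b j c k where pqr: "p = (a, i)" "q = (b, j)" "r = (c, k)" by (metis surj_pair)
  have *: "replicate i w @ replicate j w = replicate j w @ replicate i w" for i j
    by (metis add.commute replicate_add)
  have "peq (a @ replicate j w @ replicate k w) (b @ replicate i w @ replicate k w)"
    using peq_append_right[OF _ set_replicate_w, of "a @ replicate j w" "b @ replicate i w" k] assms(1)
    by (simp add: pqr fraction_eq_def)
  moreover have "peq (b @ replicate k w @ replicate i w) (c @ replicate j w @ replicate i w)"
    using peq_append_right[OF _ set_replicate_w, of "b @ replicate k w" "c @ replicate j w" i] assms(2)
    by (simp add: pqr fraction_eq_def)
  ultimately have "peq ((a @ replicate k w) @ replicate j w) ((c @ replicate i w) @ replicate j w)"
    using peq.trans *[of j k] *[of k i] *[of j i] by (metis append.assoc)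
  then show ?thesis using peq_right_cancel_pow_w by (simp add: pqr fraction_eq_def)
qed

lemma fraction_eq_act:
  assumes "fraction_eq p q" "fst l \<in> P"
  shows "fraction_eq (act l p) (act l q)"
proof -
  obtain x b m i n j where l: "l = (x, b)" "p = (m, i)" "q = (n, j)" by (metis surj_pair)
  have mn: "peq (m @ replicate j w) (n @ replicate i w)" using assms(1) by (simp add: l fraction_eq_def)
  show ?thesis
  proof (cases b)
    case True
    then show ?thesis using peq.cons[OF _ mn, of x] assms(2) by (simp add: l fraction_eq_def)
  next
    case False
    have "peq (map \<sigma> (m @ replicate j w) @ [w]) (map \<sigma> (n @ replicate i w) @ [w])"
      using peq_append_right[OF peq_map_\<sigma>[OF mn], of "[w]"] by simp
    then have "peq (map \<sigma> m @ replicate (Suc j) w) (map \<sigma> n @ replicate (Suc i) w)"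
      by (simp add: replicate_append_same free_group_simps)
    from peq.cons[OF _ this, of "inv x \<otimes> w"] show ?thesis
      using assms(2) False by (simp add: l fraction_eq_def)
  qed
qed

definition frac :: "'a word \<Rightarrow> 'a list \<times> nat" where
  "frac u = foldr act u ([], 0)"

lemma frac_simps: "frac [] = ([], 0)" "frac (l # u) = act l (frac u)"
  by (simp_all add: frac_def)

lemma frac_positive: "frac (positive m) = (m, 0)"
  by (induction m) (simp_all add: frac_def positive_def)

lemma frac_P: "u \<in> words P \<Longrightarrow> set (fst (frac u)) \<subseteq> P"
proof (induction u)
  case (Cons l u)
  obtain x b m i where l: "l = (x, b)" "frac u = (m, i)" by (metis surj_pair)
  show ?case using Cons by (cases b) (auto simp: frac_simps l)
qed (simp add: frac_simps)

lemma fraction_eq_prefix: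
  "fraction_eq (frac u) (frac v) \<Longrightarrow> p \<in> words P \<Longrightarrow> fraction_eq (frac (p @ u)) (frac (p @ v))"
  by (induction p) (simp_all add: frac_simps fraction_eq_act)

lemma fraction_eq_word_eq:
  assumes "(u, v) \<in> word_eq P germ_relations"
  shows "fraction_eq (frac u) (frac v)"
  using assms
proof (induction rule: word_eq.induct)
  case (refl u)
  then show ?case using fraction_eq_refl[OF frac_P, of u "snd (frac u)"] by simp
next
  case (sym u v)
  then show ?case by (simp add: fraction_eq_def peq.sym)
next
  case (trans u v z)
  then show ?case by (blast intro: fraction_eq_trans)
next
  case (cancel u v x b)
  obtain m k where m: "frac v = (m, k)" by (metis surj_pair)
  have mP: "set m \<subseteq> P" using frac_P[OF cancel(2)] m by simp
  have mP': "set (map \<sigma> m) \<subseteq> P" using mP by auto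
  have "peq (w # map \<sigma> m @ replicate k w) (m @ w # replicate k w)"
    using peq_append_right[OF peq.sym[OF peq_w[OF mP]] set_replicate_w, of k] by simp
  moreover have "peq (fst (frac ((x, b) # (x, \<not> b) # v))) (w # map \<sigma> m)"
    using peq.comp[OF composable_compl[OF cancel(3)] mP'] peq.comp[OF composable_compl'[OF cancel(3)] mP']
      cancel(3) by (cases b) (simp_all add: frac_simps m free_group_simps)
  then have "peq (fst (frac ((x, b) # (x, \<not> b) # v)) @ replicate k w) ((w # map \<sigma> m) @ replicate k w)"
    by (rule peq_append_right[OF _ set_replicate_w])
  ultimately have "fraction_eq (frac ((x, b) # (x, \<not> b) # v)) (frac v)"
    using peq.trans by (cases b) (auto simp: fraction_eq_def frac_simps m)
  then show ?case using fraction_eq_prefix[of "(x, b) # (x, \<not> b) # v" v u] cancel by simp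
next
  case (rel u v l r)
  then obtain x y where xy: "composable x y" "l = positive [x, y]" "r = positive [x \<otimes> y]"
    by (auto simp: germ_relations_def)
  obtain m k where m: "frac v = (m, k)" by (metis surj_pair)
  have mP: "set (m @ replicate k w) \<subseteq> P" using frac_P[OF rel(2)] m by auto
  have "fraction_eq (frac (l @ v)) (frac (r @ v))"
    using peq.comp[OF xy(1) mP] by (simp add: xy frac_simps positive_def m fraction_eq_def)
  then show ?case using fraction_eq_prefix rel by simp
qed

text \<open>
  Positive words that are equal in the group give equal fractions with trivial denominator, so
  they are equal in the monoid.
\<close>

lemma cls_eq_iff:
  assumes "set m \<subseteq> P" "set n \<subseteq> P"
  shows "cls m = cls n \<longleftrightarrow> peq m n"
proof
  assume "cls m = cls n"
  then have "(positive m, positive n) \<in> word_eq P germ_relations"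
    using assms class_eqD[of P germ_relations "positive m" "positive n"] by (simp add: cls_eq)
  from fraction_eq_word_eq[OF this] show "peq m n" by (simp add: frac_positive fraction_eq_def)
qed (rule cls_eq_if_peq)

definition germ_monoid :: "'a word set set" where
  "germ_monoid = cls ` lists P"

lemma cls_mem: "set m \<subseteq> P \<Longrightarrow> cls m \<in> germ_monoid"
  unfolding germ_monoid_def by (rule imageI) auto

lemma germ_monoidE:
  assumes "A \<in> germ_monoid"
  obtains m where "set m \<subseteq> P" "A = cls m"
  using assms by (auto simp: germ_monoid_def)

definition germ_len :: "'a word set \<Rightarrow> nat" where
  "germ_len A = (SOME k. \<exists>m. set m \<subseteq> P \<and> A = cls m \<and> k = sum_list (map L m))"

lemma germ_len:
  assumes "set m \<subseteq> P"
  shows "germ_len (cls m) = sum_list (map L m)"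
proof -
  have "\<exists>n. set n \<subseteq> P \<and> cls m = cls n \<and> germ_len (cls m) = sum_list (map L n)"
    unfolding germ_len_def by (rule someI[of _ "sum_list (map L m)"]) (use assms in blast)
  then show ?thesis using cls_eq_iff[OF assms] peq_sum_L by metis
qed

lemma gen_inv_mult:
  assumes "le u p" "u \<in> P" "p \<in> P"
  shows "inv\<^bsub>germ_group\<^esub> gen u \<otimes>\<^bsub>germ_group\<^esub> gen p = gen (inv u \<otimes> p)"
proof -
  have c: "composable u (inv u \<otimes> p)" using composable_factor[OF assms(1)] assms by simp
  have "gen u \<otimes>\<^bsub>germ_group\<^esub> gen (inv u \<otimes> p) = gen p" using gen_mult[OF c] assms by simp
  then show ?thesis
    using composableD(2)[OF c] assms G.inv_mult_cancel(1)[of "gen u" "gen (inv u \<otimes> p)"] by simp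
qed

text \<open>
  With the converse below: the simple divisors of an element are the elements of \<open>P\<close> below its head.
  Hence joins in \<open>P\<close> are least common multiples in the monoid.
\<close>

lemma le_head_if_divides:
  assumes "x \<in> P" "set m \<subseteq> P" "inv\<^bsub>germ_group\<^esub> gen x \<otimes>\<^bsub>germ_group\<^esub> cls m \<in> germ_monoid"
  shows "le x (head m)"
proof -
  obtain n where n: "set n \<subseteq> P" "inv\<^bsub>germ_group\<^esub> gen x \<otimes>\<^bsub>germ_group\<^esub> cls m = cls n"
    using assms(3) by (auto simp: germ_monoid_def)
  then have "cls m = cls (x # n)"
    using assms G.inv_mult_cancel(2)[of "gen x" "cls m"] by simp
  then have "head m = x \<otimes> absorb x (head n)"
    using cls_eq_iff[of m "x # n"] peq_head_rest_eq assms n by fastforce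
  then show ?thesis using le_composable absorb(2) assms(1) head_rest_P[OF n(1)] by simp
qed

lemma divides_if_le_head:
  assumes "x \<in> P" "set m \<subseteq> P" "le x (head m)"
  shows "inv\<^bsub>germ_group\<^esub> gen x \<otimes>\<^bsub>germ_group\<^esub> cls m \<in> germ_monoid"
proof -
  note h = head_rest_P[OF assms(2)]
  have c: "composable x (inv x \<otimes> head m)" using composable_factor assms h by simp
  have "cls m = gen (head m) \<otimes>\<^bsub>germ_group\<^esub> cls (rest m)"
    using cls_eq_if_peq[OF peq_head_rest[OF assms(2)]] by simp
  then have "inv\<^bsub>germ_group\<^esub> gen x \<otimes>\<^bsub>germ_group\<^esub> cls m = cls (inv x \<otimes> head m # rest m)"
    using gen_inv_mult[OF assms(3,1)] h assms by (simp flip: G.m_assoc)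
  then show ?thesis using h composableD(2)[OF c] cls_mem[of "inv x \<otimes> head m # rest m"] by simp
qed

lemma gen_mem [simp]: "x \<in> P \<Longrightarrow> gen x \<in> germ_monoid"
  using cls_mem[of "[x]"] by simp

sublocale garside_submonoid germ_group germ_monoid "gen ` P" "gen w" germ_len
proof unfold_locales
  show "germ_monoid \<subseteq> carrier germ_group"
    by (rule subsetI, elim germ_monoidE) simp
  show "\<one>\<^bsub>germ_group\<^esub> \<in> germ_monoid"
    using cls_mem[of "[]"] by simp
  show "finite (gen ` P)" using finite_P by simp
  show "gen ` P \<subseteq> germ_monoid" by auto
  show "gen w \<in> germ_monoid" by simp
  show "generate germ_group (gen ` P) = carrier germ_group"
  proof (intro equalityI subsetI)
    fix A assume "A \<in> carrier germ_group"
    then obtain u where u: "u \<in> words P" "A = eval_word germ_group gen u"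
      by (auto simp: presented_group_carrier eval_word_presented_gen)
    have "eval_word germ_group gen u \<in> generate germ_group (gen ` P)"
      using u(1)
    proof (induction u)
      case Nil
      then show ?case by (simp add: generate.one)
    next
      case (Cons l u)
      then show ?case
        by (cases l) (auto intro!: generate.eng intro: generate.incl generate.inv)
    qed
    then show "A \<in> generate germ_group (gen ` P)" using u(2) by simp
  next
    fix A assume "A \<in> generate germ_group (gen ` P)"
    then show "A \<in> carrier germ_group" by (rule G.generate_in_carrier[rotated]) auto
  qed
next
  fix A B assume AB: "A \<in> germ_monoid" "B \<in> germ_monoid"
  then obtain m n where m: "set m \<subseteq> P" "A = cls m" and n: "set n \<subseteq> P" "B = cls n"
    by (auto simp: germ_monoid_def)
  then have AB: "A \<otimes>\<^bsub>germ_group\<^esub> B = cls (m @ n)" by (simp add: cls_append)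
  show "A \<otimes>\<^bsub>germ_group\<^esub> B \<in> germ_monoid"
    unfolding AB using m n by (simp add: cls_mem)
  show "germ_len (A \<otimes>\<^bsub>germ_group\<^esub> B) = germ_len A + germ_len B"
    using germ_len[of "m @ n"] germ_len[OF m(1)] germ_len[OF n(1)] m n AB by simp
next
  fix A assume "A \<in> germ_monoid"
  then obtain m where m: "set m \<subseteq> P" "A = cls m" by (auto simp: germ_monoid_def)
  show "\<exists>As. set As \<subseteq> gen ` P \<and> list_prod germ_group As = A"
    using m by (intro exI[of _ "map gen m"]) (auto simp: cls_def)
  show "inv\<^bsub>germ_group\<^esub> gen w \<otimes>\<^bsub>germ_group\<^esub> A \<otimes>\<^bsub>germ_group\<^esub> gen w \<in> germ_monoid"
  proof -
    have "set (map \<sigma> m) \<subseteq> P" using m by auto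
    moreover from this have "inv\<^bsub>germ_group\<^esub> gen w \<otimes>\<^bsub>germ_group\<^esub> A \<otimes>\<^bsub>germ_group\<^esub> gen w = cls (map \<sigma> m)"
      using cls_w[OF m(1)] m by (simp add: G.m_assoc)
    ultimately show ?thesis using cls_mem by simp
  qed
  show "gen w \<otimes>\<^bsub>germ_group\<^esub> A \<otimes>\<^bsub>germ_group\<^esub> inv\<^bsub>germ_group\<^esub> gen w \<in> germ_monoid"
  proof -
    have \<tau>: "set (map \<tau> m) \<subseteq> P" using m by auto
    have "map \<sigma> (map \<tau> m) = m" using m(1) by (induction m) (auto simp: free_group_simps)
    then have "gen w \<otimes>\<^bsub>germ_group\<^esub> A = cls (map \<tau> m) \<otimes>\<^bsub>germ_group\<^esub> gen w"
      using cls_w[OF \<tau>] m by simp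
    then have "gen w \<otimes>\<^bsub>germ_group\<^esub> A \<otimes>\<^bsub>germ_group\<^esub> inv\<^bsub>germ_group\<^esub> gen w = cls (map \<tau> m)"
      using m \<tau> by (simp add: G.m_assoc)
    then show ?thesis using \<tau> cls_mem by simp
  qed
  show "A = \<one>\<^bsub>germ_group\<^esub>" if "germ_len A = 0"
  proof -
    have "\<forall>x\<in>set m. L x = 0" using that m by (simp add: germ_len)
    then have "\<forall>x\<in>set m. x = \<one>" using m(1) L_0 P_closed by blast
    then have "cls m = \<one>\<^bsub>germ_group\<^esub>" by (induction m) (auto simp: gen_one)
    then show ?thesis using m by simp
  qed
next
  fix A assume "A \<in> gen ` P"
  then obtain x where "x \<in> P" "A = gen x" by blast
  then show "inv\<^bsub>germ_group\<^esub> A \<otimes>\<^bsub>germ_group\<^esub> gen w \<in> germ_monoid"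
    using gen_inv_mult[of x w] le_w by simp
next
  fix A B assume "A \<in> gen ` P" "B \<in> gen ` P"
  then obtain x y where xy: "x \<in> P" "A = gen x" "y \<in> P" "B = gen y" by blast
  obtain z where z: "z \<in> P" "le x z" "le y z" "\<And>u. u \<in> P \<Longrightarrow> le x u \<Longrightarrow> le y u \<Longrightarrow> le z u"
    using join[OF xy(1,3)] by blast
  show "\<exists>z\<in>gen ` P. inv\<^bsub>germ_group\<^esub> A \<otimes>\<^bsub>germ_group\<^esub> z \<in> gen ` P \<and>
      inv\<^bsub>germ_group\<^esub> B \<otimes>\<^bsub>germ_group\<^esub> z \<in> gen ` P \<and>
      (\<forall>m\<in>germ_monoid. inv\<^bsub>germ_group\<^esub> A \<otimes>\<^bsub>germ_group\<^esub> m \<in> germ_monoid \<longrightarrow>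
        inv\<^bsub>germ_group\<^esub> B \<otimes>\<^bsub>germ_group\<^esub> m \<in> germ_monoid \<longrightarrow>
        inv\<^bsub>germ_group\<^esub> z \<otimes>\<^bsub>germ_group\<^esub> m \<in> germ_monoid)"
  proof (intro bexI[of _ "gen z"] conjI ballI impI)
    show "inv\<^bsub>germ_group\<^esub> A \<otimes>\<^bsub>germ_group\<^esub> gen z \<in> gen ` P"
      using gen_inv_mult[OF z(2)] composableD(2)[OF composable_factor[OF z(2)]] xy z(1) by simp
    show "inv\<^bsub>germ_group\<^esub> B \<otimes>\<^bsub>germ_group\<^esub> gen z \<in> gen ` P"
      using gen_inv_mult[OF z(3)] composableD(2)[OF composable_factor[OF z(3)]] xy z(1) by simp
    fix C assume C: "C \<in> germ_monoid" "inv\<^bsub>germ_group\<^esub> A \<otimes>\<^bsub>germ_group\<^esub> C \<in> germ_monoid"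
      "inv\<^bsub>germ_group\<^esub> B \<otimes>\<^bsub>germ_group\<^esub> C \<in> germ_monoid"
    then obtain m where m: "set m \<subseteq> P" "C = cls m" by (auto simp: germ_monoid_def)
    have "le z (head m)"
      using C(2,3) m xy head_rest_P[OF m(1)] by (intro z(4)) (auto intro: le_head_if_divides)
    then show "inv\<^bsub>germ_group\<^esub> gen z \<otimes>\<^bsub>germ_group\<^esub> C \<in> germ_monoid"
      using divides_if_le_head z(1) m by simp
  qed (use z in simp)
qed

end

section \<open>Reflection length\<close>

locale coxeter_group = group W for W (structure) +
  fixes R :: "'a set"
  assumes coxeter: "finite_coxeter_system W R"
begin

definition T :: "'a set" where "T = reflections W R"

definition len :: "'a \<Rightarrow> nat" where "len = refl_length W R"

lemma R_closed: "r \<in> R \<Longrightarrow> r \<in> carrier W" and finite_carrier: "finite (carrier W)"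
  using coxeter by (auto simp: finite_coxeter_system_def)

lemma R_square: "r \<in> R \<Longrightarrow> r \<otimes> r = \<one>"
  using coxeter pow_ord_eq_1[of r] R_closed[of r]
  by (auto simp: finite_coxeter_system_def numeral_2_eq_2)

lemma generate_R: "generate W R = carrier W"
proof (intro equalityI subsetI)
  fix g assume "g \<in> carrier W"
  obtain \<phi> where \<phi>: "\<phi> \<in> iso (presented_group R (coxeter_relations W R)) W"
    "\<And>r. r \<in> R \<Longrightarrow> \<phi> (presented_gen R (coxeter_relations W R) r) = r"
    using coxeter by (auto simp: finite_coxeter_system_def)
  have "g \<in> \<phi> ` carrier (presented_group R (coxeter_relations W R))"
    using \<phi>(1) \<open>g \<in> carrier W\<close> by (auto simp: iso_def bij_betw_def)
  then obtain u where u: "u \<in> words R"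
    "g = \<phi> (eval_word (presented_group R (coxeter_relations W R))
      (presented_gen R (coxeter_relations W R)) u)"
    by (auto simp: presented_group_carrier eval_word_presented_gen)
  define f where "f = \<phi> \<circ> presented_gen R (coxeter_relations W R)"
  have "g = eval_word W f u"
    unfolding f_def u(2) using \<phi>(1) u(1)
    by (intro hom_eval_word[OF group_presented_group is_group]) (auto simp: iso_def)
  moreover have "eval_word W f u \<in> generate W R"
    using u(1)
  proof (induction u)
    case (Cons l u)
    obtain r b where l: "l = (r, b)" by (metis surj_pair)
    then have "f r = r" "r \<in> R" using Cons.prems by (simp_all add: f_def \<phi>(2))
    then show ?case
      using Cons by (auto simp: l intro: generate.eng generate.incl generate.inv)
  qed (simp add: generate.one)
  ultimately show "g \<in> generate W R" by simp
next
  fix g assume "g \<in> generate W R"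
  then show "g \<in> carrier W" using generate_in_carrier[of R g] R_closed by blast
qed

lemma T_iff: "t \<in> T \<longleftrightarrow> (\<exists>r\<in>R. \<exists>g\<in>carrier W. t = inv g \<otimes> r \<otimes> g)"
  by (auto simp: T_def reflections_def)

lemma T_closed [simp]: "t \<in> T \<Longrightarrow> t \<in> carrier W"
  using R_closed by (auto simp: T_iff)

lemma R_subset_T: "R \<subseteq> T"
proof
  fix r assume "r \<in> R"
  then have "r = inv \<one> \<otimes> r \<otimes> \<one>" using R_closed by simp
  then show "r \<in> T" unfolding T_iff using \<open>r \<in> R\<close> one_closed by blast
qed

lemma T_conj: "t \<in> T \<Longrightarrow> g \<in> carrier W \<Longrightarrow> inv g \<otimes> t \<otimes> g \<in> T"
proof -
  assume "t \<in> T" "g \<in> carrier W"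
  then obtain r h where rh: "r \<in> R" "h \<in> carrier W" "t = inv h \<otimes> r \<otimes> h" by (auto simp: T_iff)
  have "inv g \<otimes> t \<otimes> g = inv (h \<otimes> g) \<otimes> r \<otimes> (h \<otimes> g)"
    using rh R_closed \<open>g \<in> carrier W\<close> by (simp add: free_group_simps)
  moreover have "h \<otimes> g \<in> carrier W" using rh \<open>g \<in> carrier W\<close> by simp
  ultimately show ?thesis using rh(1) unfolding T_iff by blast
qed

lemma T_square: "t \<in> T \<Longrightarrow> t \<otimes> t = \<one>"
proof -
  assume "t \<in> T"
  then obtain r h where rh: "r \<in> R" "h \<in> carrier W" "t = inv h \<otimes> r \<otimes> h" by (auto simp: T_iff)
  have "t \<otimes> t = inv h \<otimes> (r \<otimes> r) \<otimes> h"
    using rh R_closed by (simp add: free_group_simps)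
  then show ?thesis using rh R_square by simp
qed

lemma T_inv: "t \<in> T \<Longrightarrow> inv t = t"
  using T_square inv_equality by simp

text \<open>
  Reflection length is defined as a least number; it is attained because the simple reflections
  generate and are involutions.
\<close>

lemma reflection_word:
  assumes "g \<in> carrier W"
  shows "\<exists>ts. set ts \<subseteq> T \<and> list_prod W ts = g"
proof -
  have "g \<in> generate W R" using assms generate_R by simp
  then show ?thesis
  proof (induction rule: generate.induct)
    case one
    show ?case by (intro exI[of _ "[]"]) simp
  next
    case (incl r)
    then show ?case using R_subset_T R_closed by (intro exI[of _ "[r]"]) auto
  next
    case (inv r)
    then have "r \<in> T" using R_subset_T by blast
    then show ?case by (intro exI[of _ "[r]"]) (simp add: T_inv)
  next
    case (eng g h)
    then obtain ts us where "set ts \<subseteq> T" "list_prod W ts = g" "set us \<subseteq> T" "list_prod W us = h"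
      by blast
    then show ?case using T_closed by (intro exI[of _ "ts @ us"]) (auto simp: list_prod_append subset_eq)
  qed
qed

lemma len_le: "set ts \<subseteq> T \<Longrightarrow> len (list_prod W ts) \<le> length ts"
  unfolding len_def refl_length_def T_def[symmetric] by (rule Least_le) blast

lemma len_word:
  assumes "g \<in> carrier W"
  obtains ts where "set ts \<subseteq> T" "length ts = len g" "list_prod W ts = g"
proof -
  have "\<exists>k ts. set ts \<subseteq> T \<and> length ts = k \<and> list_prod W ts = g"
    using reflection_word[OF assms] by blast
  from LeastI_ex[OF this] show thesis using that by (auto simp: len_def refl_length_def T_def)
qed

lemma T_lists: "set ts \<subseteq> T \<Longrightarrow> set ts \<subseteq> carrier W"
  using T_closed by blast

lemma len_eq_0_iff:
  assumes "g \<in> carrier W"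
  shows "len g = 0 \<longleftrightarrow> g = \<one>"
proof
  obtain ts where "length ts = len g" "list_prod W ts = g" using len_word[OF assms] .
  then show "g = \<one>" if "len g = 0" using that by simp
  show "len g = 0" if "g = \<one>" using len_le[of "[]"] that by simp
qed

lemma len_mult: "g \<in> carrier W \<Longrightarrow> h \<in> carrier W \<Longrightarrow> len (g \<otimes> h) \<le> len g + len h"
proof -
  assume g: "g \<in> carrier W" and h: "h \<in> carrier W"
  obtain ts where "set ts \<subseteq> T" "length ts = len g" "list_prod W ts = g" using len_word[OF g] .
  moreover obtain us where "set us \<subseteq> T" "length us = len h" "list_prod W us = h"
    using len_word[OF h] .
  ultimately show ?thesis using len_le[of "ts @ us"] T_lists[of ts] T_lists[of us]
    by (simp add: list_prod_append)
qed

lemma len_conj_le: "g \<in> carrier W \<Longrightarrow> h \<in> carrier W \<Longrightarrow> len (inv h \<otimes> g \<otimes> h) \<le> len g"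
proof -
  assume h: "h \<in> carrier W" and g: "g \<in> carrier W"
  obtain ts where ts: "set ts \<subseteq> T" "length ts = len g" "list_prod W ts = g" using len_word[OF g] .
  have "list_prod W (map (\<lambda>t. inv h \<otimes> t \<otimes> h) ts) = inv h \<otimes> list_prod W ts \<otimes> h"
    using T_lists[OF ts(1)] h by (induction ts) (simp_all add: free_group_simps)
  moreover have "set (map (\<lambda>t. inv h \<otimes> t \<otimes> h) ts) \<subseteq> T" using ts(1) T_conj h by auto
  ultimately show ?thesis using len_le[of "map (\<lambda>t. inv h \<otimes> t \<otimes> h) ts"] ts by simp
qed

lemma len_conj:
  assumes "g \<in> carrier W" "h \<in> carrier W"
  shows "len (inv h \<otimes> g \<otimes> h) = len g"
  using len_conj_le[OF assms] len_conj_le[of "inv h \<otimes> g \<otimes> h" "inv h"] assms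
  by (simp add: free_group_simps)

lemma len_eq_1: "g \<in> carrier W \<Longrightarrow> len g = 1 \<Longrightarrow> g \<in> T"
proof -
  assume g: "g \<in> carrier W" "len g = 1"
  obtain ts where ts: "set ts \<subseteq> T" "length ts = len g" "list_prod W ts = g" using len_word[OF g(1)] .
  then obtain t where "ts = [t]" using g(2) by (metis One_nat_def length_0_conv length_Suc_conv)
  then show "g \<in> T" using ts by auto
qed

lemma len_eq_2:
  assumes "g \<in> carrier W" "len g = 2"
  obtains s t where "s \<in> T" "t \<in> T" "g = s \<otimes> t"
proof -
  obtain ts where ts: "set ts \<subseteq> T" "length ts = len g" "list_prod W ts = g" using len_word[OF assms(1)] .
  then obtain s t where "ts = [s, t]" using assms(2) by (auto simp: numeral_2_eq_2 length_Suc_conv)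
  then show thesis using ts that by auto
qed

lemma T_len_le: "t \<in> T \<Longrightarrow> len t \<le> 1"
  using len_le[of "[t]"] by simp

end

locale coxeter_interval = coxeter_group +
  fixes w :: 'a
  assumes w: "w \<in> carrier W"
begin

sublocale absolute_length W len w
proof unfold_locales
  show "w \<in> carrier W" by (rule w)
next
  fix x y assume "x \<in> carrier W" "y \<in> carrier W"
  then show "len (x \<otimes> y) \<le> len x + len y" by (rule len_mult)
next
  fix x y assume "x \<in> carrier W" "y \<in> carrier W"
  then show "len (inv y \<otimes> x \<otimes> y) = len x" by (rule len_conj)
next
  fix x assume "x \<in> carrier W"
  then show "len x = 0 \<longleftrightarrow> x = \<one>" by (rule len_eq_0_iff)
qed

lemma P_eq_interval: "P = interval W R w"
  unfolding P_def le_def unfolding interval_def abs_le_def len_def ..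

lemma germ_relations_eq: "germ_relations = interval_relations W R w"
  unfolding germ_relations_def composable_def P_eq_interval
  unfolding interval_relations_def len_def by auto

lemma le_eq: "le = abs_le W R"
  unfolding fun_eq_iff le_def unfolding abs_le_def len_def by simp

end

text \<open>
  The lattice property supplies the meets that make heads exist and the joins that become least
  common multiples.
\<close>

theorem garside_interval_group:
  assumes "finite_coxeter_system W R" and "w \<in> carrier W"
    and "Lattice.lattice (interval_order W R w)"
  shows "garside_group (interval_group W R w)"
proof -
  interpret coxeter_interval W R w
    using assms by (simp add: coxeter_interval_def coxeter_group_def coxeter_group_axioms_def
      coxeter_interval_axioms_def finite_coxeter_system_def)
  interpret L: lattice "interval_order W R w" by fact
  have carr: "carrier (interval_order W R w) = P"
    and le: "x \<sqsubseteq>\<^bsub>interval_order W R w\<^esub> y \<longleftrightarrow> le x y" for x y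
    by (simp_all add: interval_order_def P_eq_interval le_eq)
  interpret interval_germ W len w
  proof unfold_locales
    show "finite P" using finite_carrier by (rule finite_subset[rotated]) auto
  next
    fix x y assume "x \<in> P" "y \<in> P"
    then show "\<exists>z\<in>P. le z x \<and> le z y \<and> (\<forall>u\<in>P. le u x \<longrightarrow> le u y \<longrightarrow> le u z)"
      using L.inf_of_two_exists[of x y] by (auto simp: greatest_def Lower_def carr le)
  next
    fix x y assume "x \<in> P" "y \<in> P"
    then show "\<exists>z\<in>P. le x z \<and> le y z \<and> (\<forall>u\<in>P. le x u \<longrightarrow> le y u \<longrightarrow> le z u)"
      using L.sup_of_two_exists[of x y] by (auto simp: least_def Upper_def carr le)
  qed
  show ?thesis
    using garside_group_G by (simp add: interval_group_def P_eq_interval germ_relations_eq)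
qed

section \<open>Intervals of length three\<close>

locale rank3_interval = coxeter_interval +
  assumes len_w: "len w = 3"
begin

lemma len_P: "x \<in> P \<Longrightarrow> len x + len (inv x \<otimes> w) = 3"
  using P_L[of x] len_w by simp

lemma len_eq_3: "x \<in> P \<Longrightarrow> len x = 3 \<Longrightarrow> x = w"
  using len_P[of x] len_eq_0_iff[of "inv x \<otimes> w"] inv_mult_cancel(2)[of x w] by simp

lemma len_eq_0: "x \<in> P \<Longrightarrow> len x = 0 \<Longrightarrow> x = \<one>"
  using len_eq_0_iff[of x] by simp

lemma le_len: "le x y \<Longrightarrow> len x \<le> len y"
  by (simp add: le_def)

lemma le_len_eq: "le x y \<Longrightarrow> len x = len y \<Longrightarrow> x \<in> P \<Longrightarrow> y \<in> P \<Longrightarrow> x = y"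
  using len_eq_0_iff[of "inv x \<otimes> y"] inv_mult_cancel(2)[of x y] by (simp add: le_def)

lemma one_le: "x \<in> P \<Longrightarrow> le \<one> x"
  by (simp add: le_def)

lemma partial_order_interval: "partial_order (interval_order W R w)"
proof unfold_locales
  fix x y z
  assume "x \<in> carrier (interval_order W R w)" "y \<in> carrier (interval_order W R w)"
    "z \<in> carrier (interval_order W R w)"
    "x \<sqsubseteq>\<^bsub>interval_order W R w\<^esub> y" "y \<sqsubseteq>\<^bsub>interval_order W R w\<^esub> z"
  then show "x \<sqsubseteq>\<^bsub>interval_order W R w\<^esub> z"
    using le_trans[of x y z] by (simp add: interval_order_def flip: P_eq_interval le_eq)
next
  fix x y
  assume "x \<in> carrier (interval_order W R w)" "y \<in> carrier (interval_order W R w)"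
    "x \<sqsubseteq>\<^bsub>interval_order W R w\<^esub> y" "y \<sqsubseteq>\<^bsub>interval_order W R w\<^esub> x"
  then show "x .=\<^bsub>interval_order W R w\<^esub> y"
    using le_antisym[of x y] by (simp add: interval_order_def flip: P_eq_interval le_eq)
qed (simp_all add: interval_order_def fun_eq_iff flip: P_eq_interval le_eq)

text \<open>
  Two incomparable elements have upper bounds other than \<open>w\<close> only if both have length one and the
  bound has length two. If there is at most one such bound, it is the join, and otherwise the join
  is \<open>w\<close>; dually for meets.
\<close>

lemma lattice_if_no_bowtie:
  assumes bowtie: "\<And>s t c d. {s, t, c, d} \<subseteq> P \<Longrightarrow> len s = 1 \<Longrightarrow> len t = 1 \<Longrightarrow> len c = 2 \<Longrightarrow>
      len d = 2 \<Longrightarrow> le s c \<Longrightarrow> le s d \<Longrightarrow> le t c \<Longrightarrow> le t d \<Longrightarrow> s = t \<or> c = d"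
  shows "Lattice.lattice (interval_order W R w)"
proof -
  have len3: "len x \<le> 3" if "x \<in> P" for x using len_P[OF that] by simp
  have sup: "\<exists>z\<in>P. le x z \<and> le y z \<and> (\<forall>u\<in>P. le x u \<longrightarrow> le y u \<longrightarrow> le z u)"
    if x: "x \<in> P" and y: "y \<in> P" for x y
  proof (cases "le x y \<or> le y x")
    case True
    then show ?thesis using x y by (meson le_refl P_closed)
  next
    case False
    have upper: "len x < len u \<and> len y < len u" if "u \<in> P" "le x u" "le y u" for u
      using that False le_len[of x u] le_len[of y u] le_len_eq[of x u] le_len_eq[of y u] x y
      by (metis le_neq_implies_less)
    have pos: "len x \<noteq> 0" "len y \<noteq> 0"
      using False len_eq_0[OF x] len_eq_0[OF y] one_le x y by auto
    show ?thesis
    proof (cases "\<exists>c\<in>P. len c = 2 \<and> le x c \<and> le y c")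
      case True
      then obtain c where c: "c \<in> P" "len c = 2" "le x c" "le y c" by blast
      have one: "len x = 1" "len y = 1" using upper[OF c(1,3,4)] c(2) pos by auto
      have "le c u" if u: "u \<in> P" "le x u" "le y u" for u
      proof (cases "len u = 2")
        case True
        have "x \<noteq> y" using False x by auto
        then have "c = u" using bowtie[of x y c u] x y c u one True by auto
        then show ?thesis using u by simp
      next
        case False
        then have "len u = 3" using upper[OF u] pos len3[OF u(1)] by linarith
        then show ?thesis using len_eq_3[OF u(1)] le_w[OF c(1)] by simp
      qed
      then show ?thesis using c by blast
    next
      case no: False
      have "le w u" if u: "u \<in> P" "le x u" "le y u" for u
      proof -
        have "len u \<noteq> 2" using no u by blast
        then have "len u = 3" using upper[OF u] pos len3[OF u(1)] by linarith
        then show ?thesis using len_eq_3[OF u(1)] by simp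
      qed
      then show ?thesis using le_w x y w_P by blast
    qed
  qed
  have inf: "\<exists>z\<in>P. le z x \<and> le z y \<and> (\<forall>u\<in>P. le u x \<longrightarrow> le u y \<longrightarrow> le u z)"
    if x: "x \<in> P" and y: "y \<in> P" for x y
  proof (cases "le x y \<or> le y x")
    case True
    then show ?thesis using x y by (meson le_refl P_closed)
  next
    case False
    have lower: "len u < len x \<and> len u < len y" if "u \<in> P" "le u x" "le u y" for u
      using that False le_len[of u x] le_len[of u y] le_len_eq[of u x] le_len_eq[of u y] x y
      by (metis le_neq_implies_less)
    have "len x \<noteq> 3" "len y \<noteq> 3"
      using False len_eq_3[OF x] len_eq_3[OF y] le_w x y by auto
    then have two: "len x \<le> 2" "len y \<le> 2" using len3[OF x] len3[OF y] by auto
    show ?thesis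
    proof (cases "\<exists>a\<in>P. len a = 1 \<and> le a x \<and> le a y")
      case True
      then obtain a where a: "a \<in> P" "len a = 1" "le a x" "le a y" by blast
      have len2: "len x = 2" "len y = 2" using lower[OF a(1,3,4)] a(2) two by auto
      have "le u a" if u: "u \<in> P" "le u x" "le u y" for u
      proof (cases "len u = 1")
        case True
        have "x \<noteq> y" using False x by auto
        then have "u = a" using bowtie[of u a x y] x y a u len2 True by auto
        then show ?thesis using u by simp
      next
        case False
        then have "len u = 0" using lower[OF u] two by linarith
        then show ?thesis using len_eq_0[OF u(1)] one_le[OF a(1)] by simp
      qed
      then show ?thesis using a by blast
    next
      case no: False
      have "le u \<one>" if u: "u \<in> P" "le u x" "le u y" for u
      proof -
        have "len u \<noteq> 1" using no u by blast
        then have "len u = 0" using lower[OF u] two by linarith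
        then show ?thesis using len_eq_0[OF u(1)] by simp
      qed
      then show ?thesis using one_le x y one_P by blast
    qed
  qed
  interpret partial_order "interval_order W R w" by (rule partial_order_interval)
  have carr: "carrier (interval_order W R w) = P"
    and le: "x \<sqsubseteq>\<^bsub>interval_order W R w\<^esub> y \<longleftrightarrow> le x y" for x y
    by (simp_all add: interval_order_def P_eq_interval le_eq)
  show ?thesis
  proof unfold_locales
    fix x y assume "x \<in> carrier (interval_order W R w)" "y \<in> carrier (interval_order W R w)"
    then have xy: "x \<in> P" "y \<in> P" by (simp_all add: carr)
    from sup[OF xy] obtain z where z: "z \<in> P" "le x z" "le y z"
      "\<forall>u\<in>P. le x u \<longrightarrow> le y u \<longrightarrow> le z u" by blast
    have "least (interval_order W R w) z (Upper (interval_order W R w) {x, y})"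
      unfolding least_def Upper_def carr le using z xy by blast
    then show "\<exists>s. least (interval_order W R w) s (Upper (interval_order W R w) {x, y})" ..
    from inf[OF xy] obtain z where z: "z \<in> P" "le z x" "le z y"
      "\<forall>u\<in>P. le u x \<longrightarrow> le u y \<longrightarrow> le u z" by blast
    have "greatest (interval_order W R w) z (Lower (interval_order W R w) {x, y})"
      unfolding greatest_def Lower_def carr le using z xy by blast
    then show "\<exists>s. greatest (interval_order W R w) s (Lower (interval_order W R w) {x, y})" ..
  qed
qed

text \<open>
  An element of length two above \<open>s\<close> is \<open>s s'\<close> with a reflection \<open>s'\<close>, and it is determined by the
  reflection \<open>u\<close> with \<open>s s' u = w\<close>. So bowties can be read off from the factorizations of \<open>w\<close>.
\<close>

lemma lattice_if_triples:
  assumes triples: "\<And>s t u v s1 s2 t1 t2. {s, t, u, v, s1, s2, t1, t2} \<subseteq> T \<Longrightarrow>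
      s \<otimes> s1 \<otimes> u = w \<Longrightarrow> t \<otimes> t1 \<otimes> u = w \<Longrightarrow> s \<otimes> s2 \<otimes> v = w \<Longrightarrow> t \<otimes> t2 \<otimes> v = w \<Longrightarrow>
      s = t \<or> u = v"
  shows "Lattice.lattice (interval_order W R w)"
proof (rule lattice_if_no_bowtie)
  fix s t c d assume P: "{s, t, c, d} \<subseteq> P" and len: "len s = 1" "len t = 1" "len c = 2" "len d = 2"
    and le: "le s c" "le s d" "le t c" "le t d"
  have *: "inv s \<otimes> c \<in> T \<and> inv c \<otimes> w \<in> T \<and> s \<otimes> (inv s \<otimes> c) \<otimes> (inv c \<otimes> w) = w"
    if "s \<in> P" "c \<in> P" "len s = 1" "len c = 2" "le s c" for s c
    using that len_P[of c] by (auto simp: le_def free_group_simps intro!: len_eq_1)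
  have "s = t \<or> inv c \<otimes> w = inv d \<otimes> w"
    using *[of s c] *[of s d] *[of t c] *[of t d] P len le len_eq_1[of s] len_eq_1[of t]
    by (intro triples[of s t _ _ "inv s \<otimes> c" "inv s \<otimes> d" "inv t \<otimes> c" "inv t \<otimes> d"]) auto
  then show "s = t \<or> c = d" using P by auto
qed

text \<open>
  The interval group is generated by \<open>\<Delta>\<close> and the reflections below \<open>w\<close>, with the relations \<open>t\<^sub>1 t\<^sub>2 t\<^sub>3 =
  \<Delta>\<close>. An element \<open>c\<close> of length two must go to \<open>\<Delta> t\<^sup>-\<^sup>1\<close>, where \<open>t\<close> is its complement. The products \<open>u c = w\<close>
  with \<open>u\<close> on the left are respected because \<open>c = s t\<close> gives both \<open>u s t = w\<close> and \<open>s t r = w\<close> with \<open>r\<close> the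
  complement of \<open>c\<close>.
\<close>

lemma interval_group_hom:
  assumes K: "group K" and f: "f \<in> T \<rightarrow> carrier K" and D: "D \<in> carrier K"
    and triples: "\<And>r s t. r \<in> T \<Longrightarrow> s \<in> T \<Longrightarrow> t \<in> T \<Longrightarrow> r \<otimes> s \<otimes> t = w \<Longrightarrow>
      f r \<otimes>\<^bsub>K\<^esub> f s \<otimes>\<^bsub>K\<^esub> f t = D"
  obtains h where "h \<in> hom germ_group K" "h (gen w) = D"
    "\<And>t. t \<in> T \<Longrightarrow> t \<in> P \<Longrightarrow> len t = 1 \<Longrightarrow> h (gen t) = f t"
    "\<And>c. c \<in> P \<Longrightarrow> len c = 2 \<Longrightarrow> h (gen c) = D \<otimes>\<^bsub>K\<^esub> inv\<^bsub>K\<^esub> f (inv c \<otimes> w)"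
proof -
  interpret K: group K by (rule K)
  define F where "F x = (if len x = 0 then \<one>\<^bsub>K\<^esub> else if len x = 1 then f x
    else if len x = 2 then D \<otimes>\<^bsub>K\<^esub> inv\<^bsub>K\<^esub> f (inv x \<otimes> w) else D)" for x
  have f': "f t \<in> carrier K" if "t \<in> T" for t using f that by blast
  have compl: "inv x \<otimes> w \<in> T" if "x \<in> P" "len x = 2" for x
    using len_eq_1[of "inv x \<otimes> w"] len_P[OF that(1)] that by simp
  have F: "F x \<in> carrier K" if x: "x \<in> P" for x
    using len_eq_1[of x] compl[of x] that D f' by (auto simp: F_def)
  have mult: "F u \<otimes>\<^bsub>K\<^esub> F v = F (u \<otimes> v)" if uv: "composable u v" for u v
  proof -
    note P = composableD(1-3)[OF uv] and L = composableD(4)[OF uv]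
    have le3: "len u + len v \<le> 3" using len_P[OF P(3)] L by simp
    have "len u = 0 \<or> len v = 0 \<or> (len u = 1 \<and> len v = 1) \<or> (len u = 1 \<and> len v = 2) \<or>
        (len u = 2 \<and> len v = 1)"
      using le3 by linarith
    then consider "len u = 0" | "len v = 0" | "len u = 1" "len v = 1" | "len u = 1" "len v = 2"
      | "len u = 2" "len v = 1" by (elim disjE conjE)
    then show ?thesis
    proof cases
      case 1
      then show ?thesis using len_eq_0[OF P(1)] P F[OF P(2)] by (simp add: F_def[of \<one>])
    next
      case 2
      then show ?thesis using len_eq_0[OF P(2)] P F[OF P(1)] by (simp add: F_def[of \<one>])
    next
      case 3
      then have T: "u \<in> T" "v \<in> T" "inv (u \<otimes> v) \<otimes> w \<in> T" and "len (u \<otimes> v) = 2"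
        using len_eq_1 compl P L by auto
      moreover have "f u \<otimes>\<^bsub>K\<^esub> f v \<otimes>\<^bsub>K\<^esub> f (inv (u \<otimes> v) \<otimes> w) = D"
        using P by (intro triples T) simp
      then have "f u \<otimes>\<^bsub>K\<^esub> f v = D \<otimes>\<^bsub>K\<^esub> inv\<^bsub>K\<^esub> f (inv (u \<otimes> v) \<otimes> w)"
        using K.inv_solve_right[of "f u \<otimes>\<^bsub>K\<^esub> f v" D "f (inv (u \<otimes> v) \<otimes> w)"] T f' D by auto
      ultimately show ?thesis using 3 by (simp add: F_def)
    next
      case 4
      have uv_w: "u \<otimes> v = w" using len_eq_3[OF P(3)] L 4 by simp
      obtain s t where st: "s \<in> T" "t \<in> T" "v = s \<otimes> t" using len_eq_2[OF P_closed[OF P(2)] 4(2)] .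
      define r where "r = inv v \<otimes> w"
      have T: "u \<in> T" "r \<in> T" using len_eq_1 P 4 compl by (auto simp: r_def)
      have "f u \<otimes>\<^bsub>K\<^esub> f s \<otimes>\<^bsub>K\<^esub> f t = D"
        using uv_w st T by (intro triples) (simp_all add: m_assoc)
      moreover have "f s \<otimes>\<^bsub>K\<^esub> f t \<otimes>\<^bsub>K\<^esub> f r = D"
        using st T P(2) by (intro triples) (simp_all add: r_def)
      then have "f s \<otimes>\<^bsub>K\<^esub> f t = D \<otimes>\<^bsub>K\<^esub> inv\<^bsub>K\<^esub> f r"
        using K.inv_solve_right[of "f s \<otimes>\<^bsub>K\<^esub> f t" D "f r"] st T f' D by auto
      ultimately have "f u \<otimes>\<^bsub>K\<^esub> (D \<otimes>\<^bsub>K\<^esub> inv\<^bsub>K\<^esub> f r) = D"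
        using st T f' by (simp add: K.m_assoc)
      then show ?thesis using 4 uv_w len_w by (simp add: F_def r_def)
    next
      case 5
      have uv_w: "u \<otimes> v = w" using len_eq_3[OF P(3)] L 5 by simp
      then have "inv u \<otimes> w = v" using P by auto
      moreover have "v \<in> T" using len_eq_1 P 5 by simp
      ultimately show ?thesis using 5 uv_w len_w D f' by (simp add: F_def K.m_assoc)
    qed
  qed
  obtain h where h: "h \<in> hom germ_group K" "\<And>x. x \<in> P \<Longrightarrow> h (gen x) = F x"
  proof (rule K.presented_group_hom[of F P germ_relations])
    show "F \<in> P \<rightarrow> carrier K" using F by blast
  next
    fix l r assume "(l, r) \<in> germ_relations"
    then obtain u v where uv: "composable u v" "l = positive [u, v]" "r = positive [u \<otimes> v]"
      by (auto simp: germ_relations_def)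
    note P = composableD(1-3)[OF uv(1)]
    show "eval_word K F l = eval_word K F r"
      using mult[OF uv(1)] F[OF P(1)] F[OF P(2)] F[OF P(3)]
      by (simp add: uv eval_word_positive del: P_closed)
  qed blast
  show thesis
    by (rule that[OF h(1)]) (simp_all add: h(2) F_def len_w)
qed

end

section \<open>Fifteen generators against three\<close>

text \<open>
  The reflection \<open>w\<^sup>-\<^sup>k x w\<^sup>k\<close> in the orbit of \<open>x\<close> has the code \<open>(l, k)\<close> with \<open>k\<close> modulo 3, where \<open>l = 0, \<dots>, 4\<close>
  for \<open>x = a, b, c, d, e\<close>. The six base triples read \<open>c\<^sub>0 b\<^sub>0 a\<^sub>0\<close>, \<open>c\<^sub>0 a\<^sub>0 d\<^sub>2\<close>, \<open>c\<^sub>0 d\<^sub>2 b\<^sub>0\<close>, \<open>a\<^sub>0 b\<^sub>2 d\<^sub>2\<close>, \<open>b\<^sub>0 e\<^sub>2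
  a\<^sub>0\<close>, \<open>e\<^sub>2 b\<^sub>1 a\<^sub>0\<close>. Each has nine different rotations, and together they are the 54 factorizations of
  \<open>w\<close> into three reflections.
\<close>

type_synonym code = "nat \<times> nat"

definition codes :: "code set" where "codes = {..<5} \<times> {..<3}"

definition base_triples :: "(code \<times> code \<times> code) list" where
  "base_triples =
    [((2,0),(1,0),(0,0)), ((2,0),(0,0),(3,2)), ((2,0),(3,2),(1,0)),
     ((0,0),(1,2),(3,2)), ((1,0),(4,2),(0,0)), ((4,2),(1,1),(0,0))]"

fun rotate_triple :: "code \<times> code \<times> code \<Rightarrow> code \<times> code \<times> code" where
  "rotate_triple ((l, k), q, r) = (q, r, (l, Suc k mod 3))"

definition all_triples :: "(code \<times> code \<times> code) list" where
  "all_triples = concat (map (\<lambda>b. map (\<lambda>n. (rotate_triple ^^ n) b) [0..<9]) base_triples)"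

lemma all_triples_codes: "list_all (\<lambda>(p, q, r). p \<in> codes \<and> q \<in> codes \<and> r \<in> codes) all_triples"
  unfolding codes_def by code_simp

lemma base_triples_codes: "(p, q, r) \<in> set base_triples \<Longrightarrow> p \<in> codes \<and> q \<in> codes \<and> r \<in> codes"
  by (auto simp: base_triples_def codes_def)

\<comment> \<open>Products associated to the right need no parentheses.\<close>
notation mult (infixr "\<cdot>\<index>" 70)

context group
begin

definition conj_system :: "(code \<Rightarrow> 'a) \<Rightarrow> 'a \<Rightarrow> bool" where
  "conj_system x D \<longleftrightarrow> D \<in> carrier G \<and> (\<forall>p\<in>codes. x p \<in> carrier G) \<and>
    (\<forall>l<5. \<forall>k<3. D \<cdot> x (l, Suc k mod 3) = x (l, k) \<cdot> D) \<and>
    (\<forall>(p, q, r)\<in>set base_triples. x p \<cdot> x q \<cdot> x r = D)"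

lemma conj_systemD:
  assumes "conj_system x D"
  shows "D \<in> carrier G" "\<And>p. p \<in> codes \<Longrightarrow> x p \<in> carrier G"
    "\<And>l k. l < 5 \<Longrightarrow> k < 3 \<Longrightarrow> D \<cdot> x (l, Suc k mod 3) = x (l, k) \<cdot> D"
    "\<And>p q r. (p, q, r) \<in> set base_triples \<Longrightarrow> x p \<cdot> x q \<cdot> x r = D"
  using assms by (auto simp: conj_system_def)

text \<open>
  If \<open>p q r = D\<close>, then \<open>q r (D\<^sup>-\<^sup>1 p D) = D\<close>: validity is preserved by rotation.
\<close>

lemma conj_system_all_triples:
  assumes x: "conj_system x D" and "(p, q, r) \<in> set all_triples"
  shows "x p \<cdot> x q \<cdot> x r = D"
proof -
  note D = conj_systemD(1)[OF x] and xc = conj_systemD(2)[OF x]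
  define good where "good t = (case t of (p, q, r) \<Rightarrow>
    p \<in> codes \<and> q \<in> codes \<and> r \<in> codes \<and> x p \<cdot> x q \<cdot> x r = D)" for t
  have step: "good (rotate_triple t)" if "good t" for t
  proof -
    obtain l k q r where t: "t = ((l, k), q, r)" by (metis surj_pair)
    have lk: "l < 5" "k < 3" "q \<in> codes" "r \<in> codes" and prod: "x (l, k) \<cdot> x q \<cdot> x r = D"
      using that by (auto simp: good_def t codes_def)
    have l': "(l, Suc k mod 3) \<in> codes" "(l, k) \<in> codes" using lk by (auto simp: codes_def)
    have "x (l, k) \<cdot> x q \<cdot> x r \<cdot> x (l, Suc k mod 3) = D \<cdot> x (l, Suc k mod 3)"
      using prod xc lk l' by (simp add: m_assoc flip: prod)
    also have "\<dots> = x (l, k) \<cdot> D" using conj_systemD(3)[OF x] lk by simp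
    finally have "x q \<cdot> x r \<cdot> x (l, Suc k mod 3) = D"
      using l_cancel[of "x (l, k)" "x q \<cdot> x r \<cdot> x (l, Suc k mod 3)" D]
        xc[OF l'(1)] xc[OF l'(2)] xc[OF lk(3)] xc[OF lk(4)] D by simp
    then show ?thesis using lk l' by (simp add: good_def t)
  qed
  obtain b n where b: "b \<in> set base_triples" "(p, q, r) = (rotate_triple ^^ n) b"
    using assms(2) by (auto simp: all_triples_def)
  obtain p' q' r' where "b = (p', q', r')" by (metis surj_pair)
  then have "good b" using b(1) conj_systemD(4)[OF x] base_triples_codes by (simp add: good_def)
  then have "good ((rotate_triple ^^ n) b)" by (induction n) (simp_all add: step)
  then show ?thesis by (simp add: good_def flip: b(2))
qed

text \<open>
  The five relations of the presentation for \<open>a = s\<^sub>1\<close>, \<open>b = s\<^sub>2\<close>, \<open>c = s\<^sub>3\<close>.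
\<close>

definition H3_a2_triple :: "'a \<Rightarrow> 'a \<Rightarrow> 'a \<Rightarrow> bool" where
  "H3_a2_triple a b c \<longleftrightarrow> a \<in> carrier G \<and> b \<in> carrier G \<and> c \<in> carrier G \<and>
    a \<cdot> b \<cdot> a = b \<cdot> a \<cdot> b \<and> a \<cdot> c \<cdot> a = c \<cdot> a \<cdot> c \<and>
    b \<cdot> c \<cdot> b \<cdot> c \<cdot> b = c \<cdot> b \<cdot> c \<cdot> b \<cdot> c \<and>
    b \<cdot> c \<cdot> b \<cdot> a \<cdot> c \<cdot> b = c \<cdot> b \<cdot> a \<cdot> c \<cdot> b \<cdot> c \<and>
    c \<cdot> b \<cdot> a \<cdot> c \<cdot> b \<cdot> a \<cdot> c \<cdot> b \<cdot> a =
      a \<cdot> c \<cdot> b \<cdot> a \<cdot> c \<cdot> b \<cdot> a \<cdot> c \<cdot> b"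

text \<open>
  The last relation says \<open>D\<^sup>3 = (a c b)\<^sup>3 = a D\<^sup>3 a\<^sup>-\<^sup>1\<close>. For \<open>b\<close>, moving the letter through \<open>D\<^sup>3\<close> takes three
  steps: \<open>cbacba c(bab) = cbacb(aca)ba = (cbacbc)acba = (bcbacb)acba\<close>. The statement for \<open>c\<close> follows
  because \<open>c b a = D\<close>.
\<close>

lemma cube_central:
  assumes "H3_a2_triple a b c"
  defines "D \<equiv> c \<cdot> b \<cdot> a"
  shows "D \<cdot> D \<cdot> D \<cdot> a = a \<cdot> D \<cdot> D \<cdot> D"
    "D \<cdot> D \<cdot> D \<cdot> b = b \<cdot> D \<cdot> D \<cdot> D"
    "D \<cdot> D \<cdot> D \<cdot> c = c \<cdot> D \<cdot> D \<cdot> D"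
proof -
  have [simp]: "a \<in> carrier G" "b \<in> carrier G" "c \<in> carrier G"
    and ab: "a \<cdot> b \<cdot> a = b \<cdot> a \<cdot> b" and ac: "a \<cdot> c \<cdot> a = c \<cdot> a \<cdot> c"
    and bcba: "b \<cdot> c \<cdot> b \<cdot> a \<cdot> c \<cdot> b = c \<cdot> b \<cdot> a \<cdot> c \<cdot> b \<cdot> c"
    and cube: "c \<cdot> b \<cdot> a \<cdot> c \<cdot> b \<cdot> a \<cdot> c \<cdot> b \<cdot> a =
      a \<cdot> c \<cdot> b \<cdot> a \<cdot> c \<cdot> b \<cdot> a \<cdot> c \<cdot> b"
    using assms(1) by (simp_all add: H3_a2_triple_def)
  have D [simp]: "D \<in> carrier G" by (simp add: D_def)
  have "D \<cdot> D \<cdot> D \<cdot> a = (c \<cdot> b \<cdot> a \<cdot> c \<cdot> b \<cdot> a \<cdot> c \<cdot> b \<cdot> a) \<cdot> a"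
    by (simp add: D_def m_assoc)
  also have "\<dots> = a \<cdot> D \<cdot> D \<cdot> D"
    by (subst cube) (simp add: D_def m_assoc)
  finally show a: "D \<cdot> D \<cdot> D \<cdot> a = a \<cdot> D \<cdot> D \<cdot> D" .
  have "D \<cdot> D \<cdot> D \<cdot> b = c \<cdot> b \<cdot> a \<cdot> c \<cdot> b \<cdot> a \<cdot> c \<cdot> b \<cdot> a \<cdot> b"
    by (simp add: D_def m_assoc)
  also have "\<dots> = c \<cdot> b \<cdot> a \<cdot> c \<cdot> b \<cdot> (a \<cdot> c \<cdot> a) \<cdot> b \<cdot> a"
    by (simp add: m_assoc flip: ab)
  also have "\<dots> = (c \<cdot> b \<cdot> a \<cdot> c \<cdot> b \<cdot> c) \<cdot> a \<cdot> c \<cdot> b \<cdot> a"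
    by (subst ac) (simp add: m_assoc)
  also have "\<dots> = b \<cdot> D \<cdot> D \<cdot> D"
    by (subst bcba[symmetric]) (simp add: D_def m_assoc)
  finally show b: "D \<cdot> D \<cdot> D \<cdot> b = b \<cdot> D \<cdot> D \<cdot> D" .
  have "(D \<cdot> D \<cdot> D \<cdot> c) \<cdot> b \<cdot> a = (c \<cdot> D \<cdot> D \<cdot> D) \<cdot> b \<cdot> a"
  proof -
    have "(D \<cdot> D \<cdot> D \<cdot> c) \<cdot> b \<cdot> a = c \<cdot> b \<cdot> a \<cdot> D \<cdot> D \<cdot> D"
      by (simp add: D_def m_assoc)
    also have "\<dots> = c \<cdot> b \<cdot> D \<cdot> D \<cdot> D \<cdot> a" by (simp only: a)
    also have "\<dots> = c \<cdot> (b \<cdot> D \<cdot> D \<cdot> D) \<cdot> a" by (simp add: m_assoc)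
    also have "\<dots> = c \<cdot> (D \<cdot> D \<cdot> D \<cdot> b) \<cdot> a" by (simp only: b)
    finally show ?thesis by (simp add: m_assoc)
  qed
  then show "D \<cdot> D \<cdot> D \<cdot> c = c \<cdot> D \<cdot> D \<cdot> D"
    by (subst (asm) r_cancel) auto
qed

text \<open>
  The orbits of \<open>d = a\<^sup>-\<^sup>1 b a\<close> and \<open>e = b\<^sup>-\<^sup>1 c b\<close> are forced by the second and the fifth base triple.
  Since the base triples contain \<open>d\<^sub>2\<close> and \<open>e\<^sub>2\<close>, the entries with index zero are \<open>\<sigma> d\<close> and \<open>\<sigma> e\<close>, by
  periodicity. Apart from centrality of \<open>D\<^sup>3\<close>, what has to be known are the conjugates \<open>b\<^sub>1 = b\<^sup>-\<^sup>1 c\<^sup>-\<^sup>1 b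
  c b\<close>, from the two relations of length five and six, and \<open>b\<^sub>2 = a\<^sup>-\<^sup>1 c a\<close>, from the two relations of
  length three and periodicity.
\<close>

lemma conj_system_exists:
  assumes "H3_a2_triple a b c"
  obtains x where "conj_system x (c \<cdot> b \<cdot> a)" "x (0,0) = a" "x (1,0) = b" "x (2,0) = c"
proof -
  have [simp]: "a \<in> carrier G" "b \<in> carrier G" "c \<in> carrier G"
    and ab: "a \<cdot> b \<cdot> a = b \<cdot> a \<cdot> b" and ac: "a \<cdot> c \<cdot> a = c \<cdot> a \<cdot> c"
    and bc: "b \<cdot> c \<cdot> b \<cdot> c \<cdot> b = c \<cdot> b \<cdot> c \<cdot> b \<cdot> c"
    and bcba: "b \<cdot> c \<cdot> b \<cdot> a \<cdot> c \<cdot> b = c \<cdot> b \<cdot> a \<cdot> c \<cdot> b \<cdot> c"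
    using assms by (simp_all add: H3_a2_triple_def)
  define D where "D = c \<cdot> b \<cdot> a"
  have D [simp]: "D \<in> carrier G" by (simp add: D_def)
  note central = cube_central[OF assms, folded D_def]
  define \<sigma> where "\<sigma> z = inv D \<cdot> z \<cdot> D" for z
  have \<sigma> [simp]: "\<sigma> z \<in> carrier G" if "z \<in> carrier G" for z using that by (simp add: \<sigma>_def)
  have \<sigma>_mult: "\<sigma> (y \<cdot> z) = \<sigma> y \<cdot> \<sigma> z" if "y \<in> carrier G" "z \<in> carrier G" for y z
    using that by (simp add: \<sigma>_def m_assoc)
  have \<sigma>_inv: "\<sigma> (inv z) = inv (\<sigma> z)" if "z \<in> carrier G" for z
    using that by (simp add: \<sigma>_def free_group_simps)
  have D_\<sigma>: "D \<cdot> \<sigma> z = z \<cdot> D" if "z \<in> carrier G" for z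
    using that by (simp add: \<sigma>_def)
  have \<sigma>3: "\<sigma> (\<sigma> (\<sigma> z)) = z" if "z \<in> carrier G" "D \<cdot> D \<cdot> D \<cdot> z = z \<cdot> D \<cdot> D \<cdot> D" for z
    using that by (simp add: \<sigma>_def m_assoc flip: that(2))
  note \<sigma>3_abc = \<sigma>3[OF _ central(1)] \<sigma>3[OF _ central(2)] \<sigma>3[OF _ central(3)]
  define d e where "d = inv a \<cdot> b \<cdot> a" and "e = inv b \<cdot> c \<cdot> b"
  have [simp]: "d \<in> carrier G" "e \<in> carrier G" by (simp_all add: d_def e_def)
  have \<sigma>3_de: "\<sigma> (\<sigma> (\<sigma> d)) = d" "\<sigma> (\<sigma> (\<sigma> e)) = e"
    using \<sigma>3_abc by (simp_all add: d_def e_def \<sigma>_mult \<sigma>_inv)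
  define y where "y = [a, b, c, \<sigma> d, \<sigma> e]"
  define x :: "code \<Rightarrow> 'a" where "x = (\<lambda>(l, k). (\<sigma> ^^ k) (y ! l))"
  have y: "y ! l \<in> carrier G" "\<sigma> (\<sigma> (\<sigma> (y ! l))) = y ! l" if "l < 5" for l
    using that \<sigma>3_abc \<sigma>3_de by (auto simp: y_def less_Suc_eq numeral_eq_Suc)
  have step: "D \<cdot> x (l, Suc k mod 3) = x (l, k) \<cdot> D" "x (l, k) \<in> carrier G" if "l < 5" "k < 3" for l k
  proof -
    have x: "x (l, 0) = y ! l" "x (l, Suc 0) = \<sigma> (y ! l)" "x (l, 2) = \<sigma> (\<sigma> (y ! l))"
      by (simp_all add: x_def numeral_2_eq_2)
    have "k = 0 \<or> k = Suc 0 \<or> k = 2" using that(2) by auto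
    then show "D \<cdot> x (l, Suc k mod 3) = x (l, k) \<cdot> D" "x (l, k) \<in> carrier G"
      using y[OF that(1)] D_\<sigma>[of "y ! l"] D_\<sigma>[of "\<sigma> (y ! l)"] D_\<sigma>[of "\<sigma> (\<sigma> (y ! l))"]
      by (elim disjE; simp add: x flip: numeral_2_eq_2)+
  qed
  have b1: "\<sigma> b = inv b \<cdot> inv c \<cdot> b \<cdot> c \<cdot> b"
  proof -
    have "\<sigma> b \<cdot> c \<cdot> b = inv D \<cdot> b \<cdot> c \<cdot> b \<cdot> a \<cdot> c \<cdot> b"
      by (simp add: \<sigma>_def D_def m_assoc)
    also have "\<dots> = c \<cdot> b \<cdot> c"
      by (subst bcba) (simp add: D_def free_group_simps)
    also have "\<dots> = inv b \<cdot> inv c \<cdot> b \<cdot> c \<cdot> b \<cdot> c \<cdot> b"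
      by (subst bc) simp
    finally have "\<sigma> b \<cdot> c \<cdot> b = (inv b \<cdot> inv c \<cdot> b \<cdot> c \<cdot> b) \<cdot> c \<cdot> b"
      by (simp add: m_assoc)
    then show ?thesis by (subst (asm) r_cancel) auto
  qed
  have b2: "\<sigma> (\<sigma> b) = inv a \<cdot> c \<cdot> a"
  proof -
    have "D \<cdot> b = c \<cdot> a \<cdot> b \<cdot> a" by (simp add: D_def m_assoc ab)
    also have "\<dots> = (inv a \<cdot> a \<cdot> c \<cdot> a) \<cdot> b \<cdot> a" by (simp add: m_assoc)
    also have "\<dots> = (inv a \<cdot> c \<cdot> a) \<cdot> D" by (subst ac) (simp add: D_def m_assoc)
    finally have Db: "D \<cdot> b = (inv a \<cdot> c \<cdot> a) \<cdot> D" .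
    then have "\<sigma> (inv a \<cdot> c \<cdot> a) = b" by (simp add: \<sigma>_def flip: Db)
    then have "\<sigma> (\<sigma> b) = \<sigma> (\<sigma> (\<sigma> (inv a \<cdot> c \<cdot> a)))" by simp
    also have "\<dots> = inv a \<cdot> c \<cdot> a" using \<sigma>3_abc by (simp add: \<sigma>_mult \<sigma>_inv)
    finally show ?thesis .
  qed
  have x_simps: "x (0, 0) = a" "x (Suc 0, 0) = b" "x (2, 0) = c" "x (Suc 0, Suc 0) = \<sigma> b"
    "x (Suc 0, 2) = \<sigma> (\<sigma> b)" "x (3, 2) = d" "x (4, 2) = e"
    using \<sigma>3_de by (simp_all add: x_def y_def numeral_eq_Suc)
  \<comment> \<open>The second and the fifth triple define d and e, the third uses the braid relation of a and b.\<close>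
  have "c \<cdot> d \<cdot> b = c \<cdot> inv a \<cdot> b \<cdot> a \<cdot> b"
    by (simp add: d_def m_assoc)
  then have "c \<cdot> d \<cdot> b = D" by (simp add: D_def flip: ab)
  moreover have "a \<cdot> \<sigma> (\<sigma> b) \<cdot> d = D"
    unfolding b2 by (simp add: d_def D_def m_assoc)
  moreover have "c \<cdot> b \<cdot> a = D" "c \<cdot> a \<cdot> d = D"
    "b \<cdot> e \<cdot> a = D" "e \<cdot> \<sigma> b \<cdot> a = D"
    by (simp_all add: b1 d_def e_def D_def m_assoc)
  ultimately have "x p \<cdot> x q \<cdot> x r = D" if "(p, q, r) \<in> set base_triples" for p q r
    using that by (auto simp: base_triples_def x_simps)
  then have "conj_system x D"
    using step by (auto simp: conj_system_def codes_def)
  then show thesis using x_simps by (intro that[of x]) (simp_all add: D_def)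
qed

text \<open>
  The converse: each relation arises by comparing two expressions for the same element, \<open>d\<^sub>2\<close> for the
  first, \<open>D b = b\<^sub>2 D\<close> for the second, and the two expressions of \<open>b\<^sub>1\<close> through \<open>e\<^sub>2\<close> and through \<open>d\<^sub>2\<close> for
  the third and the fourth. The last relation holds since three steps of conjugation by \<open>D\<close> lead
  back to \<open>a\<close>.
\<close>

lemma H3_a2_triple_if_conj_system:
  assumes x: "conj_system x D"
  shows "H3_a2_triple (x (0,0)) (x (1,0)) (x (2,0))" "D = x (2,0) \<cdot> x (1,0) \<cdot> x (0,0)"
proof -
  note D [simp] = conj_systemD(1)[OF x]
  define a b c d e where abcde: "a = x (0,0)" "b = x (1,0)" "c = x (2,0)" "d = x (3,2)" "e = x (4,2)"
  define b1 b2 where b12: "b1 = x (1,1)" "b2 = x (1,2)"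
  have [simp]: "a \<in> carrier G" "b \<in> carrier G" "c \<in> carrier G" "d \<in> carrier G" "e \<in> carrier G"
    "b1 \<in> carrier G" "b2 \<in> carrier G"
    using conj_systemD(2)[OF x] by (auto simp: abcde b12 codes_def)
  have "c \<cdot> b \<cdot> a = D" "c \<cdot> a \<cdot> d = D" and cdb: "c \<cdot> d \<cdot> b = D" and ab2d: "a \<cdot> b2 \<cdot> d = D"
    and bea: "b \<cdot> e \<cdot> a = D" and eb1a: "e \<cdot> b1 \<cdot> a = D"
    using conj_systemD(4)[OF x] by (auto simp: base_triples_def abcde b12)
  then have D_def: "D = c \<cdot> b \<cdot> a" and ad: "a \<cdot> d = b \<cdot> a" and db: "d \<cdot> b = b \<cdot> a"
    by auto
  show "D = x (2,0) \<cdot> x (1,0) \<cdot> x (0,0)" using D_def by (simp add: abcde)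
  have ab: "a \<cdot> b \<cdot> a = b \<cdot> a \<cdot> b"
  proof -
    have "a \<cdot> b \<cdot> a = (a \<cdot> d) \<cdot> b" by (simp add: m_assoc db)
    then show ?thesis by (simp add: ad m_assoc)
  qed
  have conj: "D \<cdot> b1 = b \<cdot> D" "D \<cdot> b2 = b1 \<cdot> D" "D \<cdot> b = b2 \<cdot> D"
    using conj_systemD(3)[OF x, of 1 0] conj_systemD(3)[OF x, of 1 1] conj_systemD(3)[OF x, of 1 2]
    by (simp_all add: abcde b12 numeral_2_eq_2)
  have ab2: "a \<cdot> b2 = c \<cdot> a"
  proof -
    have "(a \<cdot> b2) \<cdot> d = (c \<cdot> a) \<cdot> d" using ab2d \<open>c \<cdot> a \<cdot> d = D\<close> by (simp add: m_assoc)
    then show ?thesis by (subst (asm) r_cancel) auto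
  qed
  have ac: "a \<cdot> c \<cdot> a = c \<cdot> a \<cdot> c"
  proof -
    have "(a \<cdot> c \<cdot> a) \<cdot> b \<cdot> a = a \<cdot> D \<cdot> b" by (simp add: D_def m_assoc ab)
    also have "\<dots> = (a \<cdot> b2) \<cdot> D" by (simp add: conj m_assoc)
    also have "\<dots> = (c \<cdot> a \<cdot> c) \<cdot> b \<cdot> a" by (simp add: ab2 D_def m_assoc)
    finally show ?thesis by (subst (asm) r_cancel) auto
  qed
  have b1_right: "b1 \<cdot> c \<cdot> b = c \<cdot> b \<cdot> c"
  proof -
    have d: "d = inv a \<cdot> b \<cdot> a" by (simp flip: ad)
    have "D \<cdot> b2 \<cdot> d = D \<cdot> inv a \<cdot> D" by (simp flip: ab2d)
    then have "b1 \<cdot> D \<cdot> d = D \<cdot> inv a \<cdot> D" using conj(2) by (simp flip: m_assoc)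
    then have "b1 \<cdot> c \<cdot> b \<cdot> b \<cdot> a = c \<cdot> b \<cdot> c \<cdot> b \<cdot> a"
      by (simp add: D_def d m_assoc)
    then have "(b1 \<cdot> c \<cdot> b) \<cdot> b \<cdot> a = (c \<cdot> b \<cdot> c) \<cdot> b \<cdot> a" by (simp add: m_assoc)
    then show ?thesis by (subst (asm) r_cancel) auto
  qed
  have b1_left: "c \<cdot> b \<cdot> b1 = b \<cdot> c \<cdot> b"
  proof -
    have e: "b \<cdot> e = c \<cdot> b"
    proof -
      have "(b \<cdot> e) \<cdot> a = (c \<cdot> b) \<cdot> a" using bea by (simp add: D_def m_assoc)
      then show ?thesis by (subst (asm) r_cancel) auto
    qed
    have "(c \<cdot> b \<cdot> b1) \<cdot> a = (b \<cdot> e) \<cdot> b1 \<cdot> a" unfolding e by (simp add: m_assoc)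
    also have "\<dots> = b \<cdot> D" using eb1a by (simp add: m_assoc)
    also have "\<dots> = (b \<cdot> c \<cdot> b) \<cdot> a" by (simp add: D_def m_assoc)
    finally show ?thesis by (subst (asm) r_cancel) auto
  qed
  have bc: "b \<cdot> c \<cdot> b \<cdot> c \<cdot> b = c \<cdot> b \<cdot> c \<cdot> b \<cdot> c"
  proof -
    have "b \<cdot> c \<cdot> b \<cdot> c \<cdot> b = (c \<cdot> b \<cdot> b1) \<cdot> c \<cdot> b"
      by (simp only: b1_left) (simp add: m_assoc)
    also have "\<dots> = c \<cdot> b \<cdot> b1 \<cdot> c \<cdot> b" by (simp add: m_assoc)
    finally show ?thesis by (simp add: b1_right)
  qed
  have bcba: "b \<cdot> c \<cdot> b \<cdot> a \<cdot> c \<cdot> b = c \<cdot> b \<cdot> a \<cdot> c \<cdot> b \<cdot> c"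
  proof -
    have "b \<cdot> c \<cdot> b \<cdot> a \<cdot> c \<cdot> b = (b \<cdot> D) \<cdot> c \<cdot> b" by (simp add: D_def m_assoc)
    also have "\<dots> = D \<cdot> b1 \<cdot> c \<cdot> b" by (simp add: m_assoc flip: conj(1))
    finally show ?thesis by (simp add: b1_right D_def m_assoc)
  qed
  have cube: "D \<cdot> D \<cdot> D = a \<cdot> c \<cdot> b \<cdot> a \<cdot> c \<cdot> b \<cdot> a \<cdot> c \<cdot> b"
  proof -
    define a1 a2 where "a1 = x (0, 1)" and "a2 = x (0, 2)"
    have [simp]: "a1 \<in> carrier G" "a2 \<in> carrier G"
      using conj_systemD(2)[OF x] by (auto simp: codes_def a1_def a2_def)
    have a12: "D \<cdot> a1 = a \<cdot> D" "D \<cdot> a2 = a1 \<cdot> D" "D \<cdot> a = a2 \<cdot> D"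
      using conj_systemD(3)[OF x, of 0 0] conj_systemD(3)[OF x, of 0 1] conj_systemD(3)[OF x, of 0 2]
      by (simp_all add: abcde a1_def a2_def numeral_2_eq_2)
    have "D \<cdot> D \<cdot> D \<cdot> a = D \<cdot> (D \<cdot> a2) \<cdot> D" by (simp add: a12(3) m_assoc)
    also have "\<dots> = ((D \<cdot> a1) \<cdot> D) \<cdot> D" by (simp only: a12(2)) (simp add: m_assoc)
    also have "\<dots> = a \<cdot> D \<cdot> D \<cdot> D" by (simp only: a12(1)) (simp add: m_assoc)
    also have "\<dots> = (a \<cdot> c \<cdot> b \<cdot> a \<cdot> c \<cdot> b \<cdot> a \<cdot> c \<cdot> b) \<cdot> a"
      by (simp add: D_def m_assoc)
    finally have "(D \<cdot> D \<cdot> D) \<cdot> a =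
      (a \<cdot> c \<cdot> b \<cdot> a \<cdot> c \<cdot> b \<cdot> a \<cdot> c \<cdot> b) \<cdot> a" by (simp add: m_assoc)
    then show ?thesis by (subst (asm) r_cancel) auto
  qed
  show "H3_a2_triple (x (0,0)) (x (1,0)) (x (2,0))"
    unfolding H3_a2_triple_def abcde[symmetric]
    using ab ac bc bcba cube by (simp add: D_def m_assoc)
qed

lemma conj_system_unique:
  assumes x: "conj_system x D" and y: "conj_system y D'"
    and eq: "x (0,0) = y (0,0)" "x (1,0) = y (1,0)" "x (2,0) = y (2,0)"
  shows "D = D'" "p \<in> codes \<Longrightarrow> x p = y p"
proof -
  show D: "D = D'"
    using H3_a2_triple_if_conj_system(2)[OF x] H3_a2_triple_if_conj_system(2)[OF y] eq by simp
  note cx = conj_systemD[OF x] and cy = conj_systemD[OF y[folded D]]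
  have codes: "(l, k) \<in> codes" if "l < 5" "k < 3" for l k using that by (simp add: codes_def)
  have step: "x (l, Suc k mod 3) = y (l, Suc k mod 3)" if "x (l, k) = y (l, k)" "l < 5" "k < 3" for l k
  proof -
    have "D \<cdot> x (l, Suc k mod 3) = D \<cdot> y (l, Suc k mod 3)"
      using cx(3)[OF that(2,3)] cy(3)[OF that(2,3)] that(1) by simp
    then show ?thesis using cx(1,2) cy(2) codes[OF that(2), of "Suc k mod 3"] by (subst (asm) l_cancel) auto
  qed
  have all: "x (l, k) = y (l, k)" if "x (l, j) = y (l, j)" "j < 3" "l < 5" "k < 3" for l j k
  proof -
    have "x (l, (j + i) mod 3) = y (l, (j + i) mod 3)" for i
    proof (induction i)
      case (Suc i)
      then show ?case using step[of l "(j + i) mod 3"] that(3) by (simp add: mod_Suc_eq)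
    qed (use that in simp)
    from this[of "k + 3 - j"] show ?thesis using that by simp
  qed
  have cad: "x (2,0) \<cdot> x (0,0) \<cdot> x (3,2) = x (2,0) \<cdot> x (0,0) \<cdot> y (3,2)"
    using cx(4)[of "(2,0)" "(0,0)" "(3,2)"] cy(4)[of "(2,0)" "(0,0)" "(3,2)"] eq
    by (simp add: base_triples_def)
  have d: "x (3,2) = y (3,2)"
    using cad cx(2) cy(2) codes by simp
  have bea: "x (1,0) \<cdot> x (4,2) \<cdot> x (0,0) = x (1,0) \<cdot> y (4,2) \<cdot> x (0,0)"
    using cx(4)[of "(1,0)" "(4,2)" "(0,0)"] cy(4)[of "(1,0)" "(4,2)" "(0,0)"] eq
    by (simp add: base_triples_def)
  have e: "x (4,2) = y (4,2)"
    using bea cx(2) cy(2) codes by simp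
  show "x p = y p" if p_codes: "p \<in> codes"
  proof -
    obtain l k where p: "p = (l, k)" "l < 5" "k < 3"
      using p_codes by (cases p) (auto simp: codes_def)
    have "l = 0 \<or> l = 1 \<or> l = 2 \<or> l = 3 \<or> l = 4" using p(2) by auto
    then show ?thesis
      using all[of l 0 k] all[of l 2 k] eq d e p by auto
  qed
qed

end

lemma conj_system_hom:
  assumes "group G" "group K" "h \<in> hom G K" "group.conj_system G x D"
  shows "group.conj_system K (h \<circ> x) (h D)"
proof -
  interpret group_hom G K h using assms by (simp add: group_hom_def group_hom_axioms_def)
  note x = G.conj_systemD[OF assms(4)]
  show ?thesis
    unfolding H.conj_system_def
  proof (intro conjI ballI allI impI)
    show "h D \<in> carrier K" using x(1) by simp
    show "(h \<circ> x) p \<in> carrier K" if "p \<in> codes" for p using x(2)[OF that] by simp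
    fix l k :: nat assume lk: "l < 5" "k < 3"
    then have "(l, k) \<in> codes" "(l, Suc k mod 3) \<in> codes" by (auto simp: codes_def)
    then have "h D \<otimes>\<^bsub>K\<^esub> h (x (l, Suc k mod 3)) = h (D \<otimes>\<^bsub>G\<^esub> x (l, Suc k mod 3))"
      "h (x (l, k)) \<otimes>\<^bsub>K\<^esub> h D = h (x (l, k) \<otimes>\<^bsub>G\<^esub> D)" using x(1,2) by simp_all
    then show "h D \<otimes>\<^bsub>K\<^esub> (h \<circ> x) (l, Suc k mod 3) = (h \<circ> x) (l, k) \<otimes>\<^bsub>K\<^esub> h D"
      using x(3)[OF lk] by simp
  next
    fix t assume t: "t \<in> set base_triples"
    obtain p q r where pqr: "t = (p, q, r)" by (metis surj_pair)
    then have "p \<in> codes" "q \<in> codes" "r \<in> codes" using base_triples_codes t by blast+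
    then have "h (x p) \<otimes>\<^bsub>K\<^esub> (h (x q) \<otimes>\<^bsub>K\<^esub> h (x r)) = h (x p \<otimes>\<^bsub>G\<^esub> (x q \<otimes>\<^bsub>G\<^esub> x r))"
      using x(2) by simp
    also have "\<dots> = h D" using x(4) t pqr by simp
    finally show "case t of (p, q, r) \<Rightarrow> (h \<circ> x) p \<otimes>\<^bsub>K\<^esub> ((h \<circ> x) q \<otimes>\<^bsub>K\<^esub> (h \<circ> x) r) = h D"
      by (simp add: pqr)
  qed
qed

section \<open>Presentation and lattice property\<close>

lemma every_code_starts_a_triple:
  "list_all (\<lambda>p. list_ex (\<lambda>(p', q, r). p' = p) all_triples) (List.product [0..<5] [0..<3])"
  by code_simp

text \<open>
  A bowtie consists of two different reflections \<open>s, t\<close> below two different elements of length two,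
  which are represented by their complements \<open>u, v\<close>.
\<close>

definition bowtie_free :: "(code \<times> code \<times> code) list \<Rightarrow> bool" where
  "bowtie_free ts = list_all (\<lambda>(s, _, u). list_all (\<lambda>(t, _, _).
     list_all (\<lambda>(_, _, v). list_all (\<lambda>(t', _, v'). t' \<noteq> t \<or> v' \<noteq> v) ts)
       (filter (\<lambda>(s', _, v). s' = s \<and> v \<noteq> u) ts))
     (filter (\<lambda>(t, _, u'). u' = u \<and> t \<noteq> s) ts)) ts"

lemma bowtie_free_all_triples: "bowtie_free all_triples"
  by code_simp

lemma bowtie_freeD:
  assumes "bowtie_free ts" "(s, a, u) \<in> set ts" "(t, b, u) \<in> set ts" "(s, c, v) \<in> set ts" "(t, d, v) \<in> set ts"
  shows "s = t \<or> u = v"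
proof (rule ccontr)
  assume "\<not> (s = t \<or> u = v)"
  then have "(t, b, u) \<in> set (filter (\<lambda>(t, _, u'). u' = u \<and> t \<noteq> s) ts)"
    "(s, c, v) \<in> set (filter (\<lambda>(s', _, v). s' = s \<and> v \<noteq> u) ts)"
    using assms by auto
  then show False using assms(1,2,5) unfolding bowtie_free_def list_all_iff by fast
qed

text \<open>
  All that is used about the interval: the reflections form a \<open>conj_system\<close> for \<open>w\<close>, and \<open>w\<close> has no
  factorizations other than the 54 rotations of the base triples.
\<close>

locale H3_a2_interval = rank3_interval +
  fixes y :: "code \<Rightarrow> 'a"
  assumes y: "conj_system y w"
    and y_T: "y ` codes = T"
    and y_inj: "inj_on y codes"
    and y_triples: "p \<in> codes \<Longrightarrow> q \<in> codes \<Longrightarrow> r \<in> codes \<Longrightarrow> y p \<otimes> y q \<otimes> y r = w \<Longrightarrow>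
      (p, q, r) \<in> set all_triples"
begin

lemma y_mem [simp]: "p \<in> codes \<Longrightarrow> y p \<in> T"
  using y_T by blast

lemma all_triples_mem:
  "(p, q, r) \<in> set all_triples \<Longrightarrow> p \<in> codes \<and> q \<in> codes \<and> r \<in> codes"
  using all_triples_codes by (auto simp: list_all_iff)

lemma y_prod: "(p, q, r) \<in> set all_triples \<Longrightarrow> y p \<otimes> y q \<otimes> y r = w"
  using conj_system_all_triples[OF y, of p q r] all_triples_mem[of p q r] by (simp add: m_assoc)

lemma T_props:
  assumes "t \<in> T"
  shows "t \<in> P" "len t = 1" "len (inv t \<otimes> w) = 2"
proof -
  obtain p where p: "p \<in> codes" "t = y p" using assms y_T by blast
  then have "p \<in> set (List.product [0..<5] [0..<3])" by (cases p) (auto simp: codes_def)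
  then obtain q r where qr: "(p, q, r) \<in> set all_triples"
    using every_code_starts_a_triple unfolding list_all_iff list_ex_iff by fast
  then have mem: "y q \<in> T" "y r \<in> T" using all_triples_mem by auto
  have "inv t \<otimes> w = y q \<otimes> y r"
    using y_prod[OF qr] mem assms p by (simp add: m_assoc flip: y_prod[OF qr])
  then have "len (inv t \<otimes> w) \<le> 2" using len_le[of "[y q, y r]"] mem by simp
  moreover have "3 \<le> len t + len (inv t \<otimes> w)"
    using len_mult[of t "inv t \<otimes> w"] assms len_w by simp
  ultimately show "len t = 1" "len (inv t \<otimes> w) = 2" using T_len_le[OF assms] by auto
  then show "t \<in> P" using assms len_w P_iff[of t] by simp
qed

lemma lattice_interval: "Lattice.lattice (interval_order W R w)"
proof (rule lattice_if_triples)
  fix s t u v s1 s2 t1 t2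
  assume T: "{s, t, u, v, s1, s2, t1, t2} \<subseteq> T"
    and w: "s \<otimes> s1 \<otimes> u = w" "t \<otimes> t1 \<otimes> u = w" "s \<otimes> s2 \<otimes> v = w" "t \<otimes> t2 \<otimes> v = w"
  define code where "code = inv_into codes y"
  have code: "code z \<in> codes" "y (code z) = z" if "z \<in> T" for z
    using that y_T by (auto simp: code_def inv_into_into f_inv_into_f)
  have "(code s, code s1, code u) \<in> set all_triples" "(code t, code t1, code u) \<in> set all_triples"
    "(code s, code s2, code v) \<in> set all_triples" "(code t, code t2, code v) \<in> set all_triples"
    using w code T by (auto intro!: y_triples)
  then have "code s = code t \<or> code u = code v"
    by (rule bowtie_freeD[OF bowtie_free_all_triples])
  then show "s = t \<or> u = v" using code T by (metis insert_subset)
qed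

text \<open>
  The generators of the interval group form a \<open>conj_system\<close> because the equations that define one
  hold in \<open>W\<close> with lengths adding up.
\<close>

lemma conj_system_gen: "G.conj_system (gen \<circ> y) (gen w)"
  unfolding G.conj_system_def
proof (intro conjI ballI allI impI)
  show "gen w \<in> carrier germ_group" by simp
  show "(gen \<circ> y) p \<in> carrier germ_group" if "p \<in> codes" for p using that T_props(1) by simp
  fix l k :: nat assume lk: "l < 5" "k < 3"
  then have c: "(l, k) \<in> codes" "(l, Suc k mod 3) \<in> codes" by (auto simp: codes_def)
  have "\<sigma> (y (l, k)) = y (l, Suc k mod 3)"
    using conj_systemD(3)[OF y lk] c by (simp add: m_assoc flip: conj_systemD(3)[OF y lk])
  then show "gen w \<otimes>\<^bsub>germ_group\<^esub> (gen \<circ> y) (l, Suc k mod 3) = (gen \<circ> y) (l, k) \<otimes>\<^bsub>germ_group\<^esub> gen w"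
    using cls_w[of "[y (l, k)]"] T_props(1) c by simp
next
  fix t assume t: "t \<in> set base_triples"
  obtain p q r where pqr: "t = (p, q, r)" by (metis surj_pair)
  then have T: "y p \<in> T" "y q \<in> T" "y r \<in> T" using t base_triples_codes by auto
  have prod: "y p \<otimes> (y q \<otimes> y r) = w" using conj_systemD(4)[OF y] t pqr by simp
  then have qr: "y q \<otimes> y r = inv (y p) \<otimes> w" using T by (simp flip: prod)
  then have "composable (y q) (y r)"
    using T_props[OF T(1)] T_props[OF T(2)] T_props[OF T(3)] by (simp add: composable_def)
  moreover have "composable (y p) (y q \<otimes> y r)"
    using composable_compl[of "y p"] T_props[OF T(1)] qr by simp
  ultimately show "case t of (p, q, r) \<Rightarrow> (gen \<circ> y) p \<otimes>\<^bsub>germ_group\<^esub>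
      ((gen \<circ> y) q \<otimes>\<^bsub>germ_group\<^esub> (gen \<circ> y) r) = gen w"
    using prod by (simp add: pqr gen_mult)
qed

\<comment> \<open>The set of generators is to keep its form {1, 2, 3} under simplification.\<close>
declare One_nat_def [simp del]

abbreviation P3 :: "nat word set monoid" where
  "P3 \<equiv> presented_group {1, 2, 3} H3_a2_relations"

abbreviation s :: "nat \<Rightarrow> nat word set" where
  "s \<equiv> presented_gen {1, 2, 3} H3_a2_relations"

sublocale P3: group P3
  by (rule group_presented_group)

lemma s_closed: "s 1 \<in> carrier P3" "s 2 \<in> carrier P3" "s 3 \<in> carrier P3"
  by simp_all

lemma H3_a2_triple_s: "P3.H3_a2_triple (s 1) (s 2) (s 3)"
proof -
  have "(positive [1,2,1], positive [2,1,2]) \<in> H3_a2_relations"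
    "(positive [1,3,1], positive [3,1,3]) \<in> H3_a2_relations"
    "(positive [2,3,2,3,2], positive [3,2,3,2,3]) \<in> H3_a2_relations"
    "(positive [2,3,2,1,3,2], positive [3,2,1,3,2,3]) \<in> H3_a2_relations"
    "(positive [3,2,1,3,2,1,3,2,1], positive [1,3,2,1,3,2,1,3,2]) \<in> H3_a2_relations"
    by (simp_all add: H3_a2_relations_def)
  note this[THEN presented_group_rel, of "{1, 2, 3}"]
  then show ?thesis
    unfolding P3.H3_a2_triple_def using s_closed by simp
qed

text \<open>
  Both groups carry a \<open>conj_system\<close> with first members \<open>s\<^sub>1, s\<^sub>2, s\<^sub>3\<close>. In the presented group it yields
  a homomorphism from the interval group by \<open>interval_group_hom\<close>; in the interval group it yields
  the relations of the presentation, hence a homomorphism back. They are mutually inverse because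
  a \<open>conj_system\<close> is determined by those three members (\<open>conj_system_unique\<close>).
\<close>

theorem interval_group_presentation: "interval_group W R w \<cong> P3"
proof -
  obtain x where x: "P3.conj_system x (s 3 \<otimes>\<^bsub>P3\<^esub> (s 2 \<otimes>\<^bsub>P3\<^esub> s 1))"
    and x_s: "x (0,0) = s 1" "x (1,0) = s 2" "x (2,0) = s 3"
    using P3.conj_system_exists[OF H3_a2_triple_s] .
  define D where "D = s 3 \<otimes>\<^bsub>P3\<^esub> (s 2 \<otimes>\<^bsub>P3\<^esub> s 1)"
  note x = x[folded D_def]
  note Dx = P3.conj_systemD(1)[OF x] P3.conj_systemD(2)[OF x]
  define f where "f t = x (inv_into codes y t)" for t
  have f_y: "f (y p) = x p" if "p \<in> codes" for p using that y_inj by (simp add: f_def)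
  have f_T: "f \<in> T \<rightarrow> carrier P3" unfolding y_T[symmetric] using f_y Dx by auto
  have f_triples: "f r \<otimes>\<^bsub>P3\<^esub> f t \<otimes>\<^bsub>P3\<^esub> f u = D"
    if T: "r \<in> T" "t \<in> T" "u \<in> T" and w: "r \<otimes> t \<otimes> u = w" for r t u
  proof -
    obtain p q o' where pqo: "p \<in> codes" "q \<in> codes" "o' \<in> codes" "r = y p" "t = y q" "u = y o'"
      using T y_T by blast
    then have "(p, q, o') \<in> set all_triples" using y_triples w by simp
    from P3.conj_system_all_triples[OF x this] show ?thesis
      using pqo f_y Dx by (simp add: P3.m_assoc)
  qed
  obtain h where h: "h \<in> hom germ_group P3" "h (gen w) = D"
    "\<And>t. t \<in> T \<Longrightarrow> t \<in> P \<Longrightarrow> len t = 1 \<Longrightarrow> h (gen t) = f t"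
    "\<And>c. c \<in> P \<Longrightarrow> len c = 2 \<Longrightarrow> h (gen c) = D \<otimes>\<^bsub>P3\<^esub> inv\<^bsub>P3\<^esub> f (inv c \<otimes> w)"
  proof (rule interval_group_hom[OF group_presented_group f_T Dx(1) f_triples], goal_cases)
    case (5 h)
    show ?case by (rule that[OF 5(2-5)])
  qed
  have h_y: "h (gen (y p)) = x p" if "p \<in> codes" for p
    using h(3)[of "y p"] T_props[of "y p"] f_y that by simp
  define g where "g i = gen (y (i - 1, 0))" for i :: nat
  have g_simps: "g 1 = gen (y (0, 0))" "g 2 = gen (y (1, 0))" "g 3 = gen (y (2, 0))"
    by (simp_all add: g_def eval_nat_numeral One_nat_def)
  have codes: "(0, 0) \<in> codes" "(1, 0) \<in> codes" "(2, 0) \<in> codes" by (simp_all add: codes_def)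
  have g: "g \<in> {1, 2, 3} \<rightarrow> carrier germ_group" using T_props(1) codes by (auto simp: g_simps)
  have g_triple: "G.H3_a2_triple (g 1) (g 2) (g 3)"
    using G.H3_a2_triple_if_conj_system(1)[OF conj_system_gen] by (simp add: g_simps)
  obtain k where k: "k \<in> hom P3 germ_group" "\<And>i. i \<in> {1, 2, 3} \<Longrightarrow> k (s i) = g i"
  proof (rule G.presented_group_hom[OF g, of H3_a2_relations])
    fix l r assume "(l, r) \<in> H3_a2_relations"
    then show "eval_word germ_group g l = eval_word germ_group g r"
      using g_triple
      by (auto simp: H3_a2_relations_def eval_word_positive G.H3_a2_triple_def)
  qed blast
  have kx: "G.conj_system (k \<circ> x) (k D)"
    by (rule conj_system_hom[OF group_presented_group group_presented_group k(1) x])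
  have "(k \<circ> x) (0,0) = (gen \<circ> y) (0,0)" "(k \<circ> x) (1,0) = (gen \<circ> y) (1,0)"
    "(k \<circ> x) (2,0) = (gen \<circ> y) (2,0)"
    by (simp_all add: x_s k(2) g_simps)
  note unique = G.conj_system_unique[OF kx conj_system_gen this]
  have k_D: "k D = gen w" and k_x: "k (x p) = gen (y p)" if "p \<in> codes" for p
    using unique that by auto
  interpret k: group_hom P3 germ_group k
    using k(1) by (simp add: group_hom_def group_hom_axioms_def group_presented_group)
  interpret h: group_hom germ_group P3 h
    using h(1) by (simp add: group_hom_def group_hom_axioms_def group_presented_group)
  have "germ_group \<cong> P3"
  proof (rule presented_group_isoI[OF h(1) k(1)])
    fix z assume z: "z \<in> P"
    have "len z \<le> 3" using len_P[OF z] by simp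
    then consider "len z = 0" | "len z = 1" | "len z = 2" | "len z = 3" by linarith
    then show "k (h (gen z)) = gen z"
    proof cases
      case 1
      then show ?thesis using len_eq_0[OF z] by (simp add: gen_one)
    next
      case 2
      then have "z \<in> y ` codes" unfolding y_T using len_eq_1[of z] z by simp
      then obtain p where "p \<in> codes" "z = y p" by blast
      then show ?thesis using h_y k_x by simp
    next
      case 3
      then have "inv z \<otimes> w \<in> y ` codes" unfolding y_T using len_eq_1 len_P[OF z] z by simp
      then obtain p where p: "p \<in> codes" "inv z \<otimes> w = y p" by blast
      have "z \<otimes> y p = w" using z by (simp flip: p(2))
      then have zp: "gen z \<otimes>\<^bsub>germ_group\<^esub> gen (y p) = gen w"
        using gen_mult[OF composable_compl[OF z]] p z by simp
      then have "gen w \<otimes>\<^bsub>germ_group\<^esub> inv\<^bsub>germ_group\<^esub> gen (y p) = gen z"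
        using z p T_props(1) by (simp add: G.m_assoc flip: zp)
      then show ?thesis using h(4)[OF z 3] p f_y Dx k_D k_x by simp
    next
      case 4
      then show ?thesis using len_eq_3[OF z] h(2) k_D codes by auto
    qed
  next
    fix i assume "i \<in> {1, 2, 3 :: nat}"
    then show "h (k (s i)) = s i" using k(2) h_y codes x_s by (auto simp: g_simps)
  qed
  then show ?thesis by (simp add: interval_group_def P_eq_interval germ_relations_eq)
qed

end

declare One_nat_def [simp]

section \<open>Normal forms in type H3\<close>

text \<open>
  Permutations as lists of values, so that products can be computed. The representation used below
  has degree seven: the alternating group on the first five points, and the central involution as
  the exchange of the last two.
\<close>

definition perm_lists :: "nat \<Rightarrow> nat list monoid" where
  "perm_lists n = \<lparr>carrier = {p. length p = n \<and> set p = {..<n}},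
     mult = (\<lambda>p q. map ((!) p) q), one = [0..<n]\<rparr>"

lemma group_perm_lists: "group (perm_lists n)"
proof (rule groupI)
  have set: "(!) p ` {..<length p} = set p" for p :: "nat list"
    by (auto simp: set_conv_nth)
  fix p q assume "p \<in> carrier (perm_lists n)" "q \<in> carrier (perm_lists n)"
  then have pq: "length p = n" "set p = {..<n}" "length q = n" "set q = {..<n}"
    by (simp_all add: perm_lists_def)
  show "p \<otimes>\<^bsub>perm_lists n\<^esub> q \<in> carrier (perm_lists n)"
    using pq set[of p] by (simp add: perm_lists_def)
  show "(p \<otimes>\<^bsub>perm_lists n\<^esub> q) \<otimes>\<^bsub>perm_lists n\<^esub> z = p \<otimes>\<^bsub>perm_lists n\<^esub> (q \<otimes>\<^bsub>perm_lists n\<^esub> z)"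
    if "z \<in> carrier (perm_lists n)" for z
    using pq that by (auto simp: perm_lists_def)
next
  fix p assume "p \<in> carrier (perm_lists n)"
  then have p: "length p = n" "set p = {..<n}" by (simp_all add: perm_lists_def)
  show "\<one>\<^bsub>perm_lists n\<^esub> \<otimes>\<^bsub>perm_lists n\<^esub> p = p"
  proof -
    have "[0..<n] ! i = i" if "i \<in> set p" for i using that unfolding p(2) by simp
    then show ?thesis by (simp add: perm_lists_def map_idI)
  qed
  define q where "q = map (inv_into {..<n} ((!) p)) [0..<n]"
  have bij: "bij_betw ((!) p) {..<n} {..<n}"
    using p by (metis bij_betw_nth card_lessThan card_distinct lessThan_iff)
  then have "bij_betw (inv_into {..<n} ((!) p)) {..<n} {..<n}" by (rule bij_betw_inv_into)
  then have "q \<in> carrier (perm_lists n)"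
    by (simp add: perm_lists_def q_def bij_betw_def lessThan_atLeast0)
  moreover have "q \<otimes>\<^bsub>perm_lists n\<^esub> p = \<one>\<^bsub>perm_lists n\<^esub>"
  proof -
    have "q ! (p ! i) = i" if "i < n" for i
      using that bij p inv_into_f_f[of "(!) p" "{..<n}" i] nth_mem[of i p]
      by (simp add: q_def bij_betw_def)
    then show ?thesis
      using p by (intro nth_equalityI) (auto simp: perm_lists_def)
  qed
  ultimately show "\<exists>q\<in>carrier (perm_lists n). q \<otimes>\<^bsub>perm_lists n\<^esub> p = \<one>\<^bsub>perm_lists n\<^esub>" by blast
qed (auto simp: perm_lists_def)

definition model_gens :: "nat list list" where
  "model_gens = [[2,3,0,1,4,6,5], [4,2,1,3,0,6,5], [3,2,1,0,4,6,5]]"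

definition model :: "nat list \<Rightarrow> nat list" where
  "model u = foldr (\<lambda>i p. map ((!) (model_gens ! i)) p) u [0..<7]"

lemma model_eq: "model u = list_prod (perm_lists 7) (map ((!) model_gens) u)"
  by (induction u) (simp_all add: model_def perm_lists_def)

text \<open>
  The principle of coset enumeration: if \<open>X\<close> represents cosets of \<open>H\<close> and right multiplication by
  generators stays inside the union of these cosets, then that union is everything.
\<close>

lemma (in group) generate_subset_products:
  assumes H: "H \<subseteq> carrier G" "\<one> \<in> H" "\<And>h k. h \<in> H \<Longrightarrow> k \<in> H \<Longrightarrow> h \<otimes> k \<in> H"
    and X: "X \<subseteq> carrier G" "\<one> \<in> X"
    and S: "S \<subseteq> carrier G" "\<And>g. g \<in> S \<Longrightarrow> g \<otimes> g = \<one>"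
    and step: "\<And>x g. x \<in> X \<Longrightarrow> g \<in> S \<Longrightarrow> \<exists>h\<in>H. \<exists>x'\<in>X. x \<otimes> g = h \<otimes> x'"
  shows "g \<in> generate G S \<Longrightarrow> \<exists>h\<in>H. \<exists>x\<in>X. g = h \<otimes> x"
proof -
  have HX: "h \<in> carrier G" "x \<in> carrier G" "s \<in> carrier G" if "h \<in> H" "x \<in> X" "s \<in> S" for h x s
    using that assms by auto
  have gen: "\<exists>h'\<in>H. \<exists>x'\<in>X. h \<otimes> x \<otimes> s = h' \<otimes> x'" if "h \<in> H" "x \<in> X" "s \<in> S" for h x s
  proof -
    obtain k x' where "k \<in> H" "x' \<in> X" "x \<otimes> s = k \<otimes> x'" using step \<open>x \<in> X\<close> \<open>s \<in> S\<close> by blast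
    moreover then have "h \<otimes> x \<otimes> s = (h \<otimes> k) \<otimes> x'"
      using HX[OF that] HX[OF _ _ \<open>s \<in> S\<close>, of k x'] by (simp add: m_assoc)
    ultimately show ?thesis using H(3) \<open>h \<in> H\<close> by blast
  qed
  assume g: "g \<in> generate G S"
  then have "\<forall>h\<in>H. \<forall>x\<in>X. \<exists>h'\<in>H. \<exists>x'\<in>X. h \<otimes> x \<otimes> g = h' \<otimes> x'"
  proof (induction rule: generate.induct)
    case one
    have "h \<otimes> x \<otimes> \<one> = h \<otimes> x" if "h \<in> H" "x \<in> X" for h x
      using subsetD[OF H(1) that(1)] subsetD[OF X(1) that(2)] by simp
    then show ?case by blast
  next
    case (incl s)
    then show ?case using gen by blast
  next
    case (inv s)
    then have "inv s = s" using S inv_equality by auto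
    then show ?case using gen inv by simp
  next
    case (eng u v)
    have uv: "u \<in> carrier G" "v \<in> carrier G" using eng(1,2) S(1) generate_in_carrier by blast+
    show ?case
    proof (intro ballI)
      fix h x assume hx: "h \<in> H" "x \<in> X"
      then obtain k y where ky: "k \<in> H" "y \<in> X" "h \<otimes> x \<otimes> u = k \<otimes> y" using eng.IH(1) by blast
      then obtain l z where lz: "l \<in> H" "z \<in> X" "k \<otimes> y \<otimes> v = l \<otimes> z" using eng.IH(2) by blast
      have "h \<otimes> x \<otimes> (u \<otimes> v) = (h \<otimes> x \<otimes> u) \<otimes> v"
        using hx uv H(1) X(1) by (simp add: m_assoc subset_eq)
      then show "\<exists>h'\<in>H. \<exists>x'\<in>X. h \<otimes> x \<otimes> (u \<otimes> v) = h' \<otimes> x'" using ky lz by auto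
    qed
  qed
  then obtain h x where "h \<in> H" "x \<in> X" "\<one> \<otimes> \<one> \<otimes> g = h \<otimes> x" using H(2) X(2) by blast
  moreover have "g \<in> carrier G" using g S(1) generate_in_carrier by blast
  ultimately show ?thesis by auto
qed

text \<open>
  Representatives for the chain of parabolic subgroups \<open>1 \<subset> \<langle>r\<rangle> \<subset> \<langle>r, s\<rangle> \<subset> W\<close>, as words in \<open>0 = r\<close>, \<open>1
  = s\<close>, \<open>2 = t\<close>: there are \<open>2 \<cdot> 5 \<cdot> 12 = 120\<close> products. The twelve right words correspond to the
  vertices of the icosahedron.
\<close>

definition left_words :: "nat list list" where "left_words = [[], [0]]"

definition middle_words :: "nat list list" where
  "middle_words = [[], [1], [1,0], [1,0,1], [1,0,1,0]]"

definition right_words :: "nat list list" where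
  "right_words = [[], [2], [2,1], [2,1,0], [2,1,0,1], [2,1,0,1,0], [2,1,0,1,2], [2,1,0,1,0,2],
     [2,1,0,1,0,2,1], [2,1,0,1,0,2,1,0], [2,1,0,1,0,2,1,0,1], [2,1,0,1,0,2,1,0,1,2]]"

definition normal_words :: "nat list list" where
  "normal_words = concat (map (\<lambda>x. concat (map (\<lambda>y. map (\<lambda>z. x @ y @ z) right_words) middle_words)) left_words)"

locale H3 = coxeter_group +
  fixes r s t :: 'a
  assumes R_eq: "R = {r, s, t}" and distinct: "distinct [r, s, t]"
    and ord_rs: "ord (r \<otimes> s) = 5" and ord_st: "ord (s \<otimes> t) = 3" and ord_rt: "ord (r \<otimes> t) = 2"
begin

lemma gens_closed [simp]: "r \<in> carrier W" "s \<in> carrier W" "t \<in> carrier W"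
  using R_closed R_eq by auto

lemma squares [simp]: "r \<otimes> r = \<one>" "s \<otimes> s = \<one>" "t \<otimes> t = \<one>"
  using R_square R_eq by auto

lemma squares' [simp]:
  "z \<in> carrier W \<Longrightarrow> r \<cdot> r \<cdot> z = z" "z \<in> carrier W \<Longrightarrow> s \<cdot> s \<cdot> z = z"
  "z \<in> carrier W \<Longrightarrow> t \<cdot> t \<cdot> z = z"
  by (simp_all flip: m_assoc)

lemma invs: "inv r = r" "inv s = s" "inv t = t"
  by (simp_all add: inv_equality)

lemma braids:
  "r \<cdot> s \<cdot> r \<cdot> s \<cdot> r = s \<cdot> r \<cdot> s \<cdot> r \<cdot> s"
  "s \<cdot> t \<cdot> s = t \<cdot> s \<cdot> t" "r \<cdot> t = t \<cdot> r"
proof -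
  have "(r \<cdot> s \<cdot> r \<cdot> s \<cdot> r) \<cdot> s \<cdot> r \<cdot> s \<cdot> r \<cdot> s = (r \<cdot> s) [^] (5 :: nat)"
    by (simp add: numeral_eq_Suc m_assoc)
  then have "(r \<cdot> s \<cdot> r \<cdot> s \<cdot> r) \<cdot> s \<cdot> r \<cdot> s \<cdot> r \<cdot> s = \<one>"
    using pow_ord_eq_1[of "r \<cdot> s"] ord_rs by simp
  from inv_equality[OF this] show "r \<cdot> s \<cdot> r \<cdot> s \<cdot> r = s \<cdot> r \<cdot> s \<cdot> r \<cdot> s"
    by (simp add: inv_mult_group invs m_assoc)
  have "(s \<cdot> t \<cdot> s) \<cdot> t \<cdot> s \<cdot> t = (s \<cdot> t) [^] (3 :: nat)"
    by (simp add: numeral_eq_Suc m_assoc)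
  then have "(s \<cdot> t \<cdot> s) \<cdot> t \<cdot> s \<cdot> t = \<one>"
    using pow_ord_eq_1[of "s \<cdot> t"] ord_st by simp
  from inv_equality[OF this] show "s \<cdot> t \<cdot> s = t \<cdot> s \<cdot> t"
    by (simp add: inv_mult_group invs m_assoc)
  have "(r \<cdot> t) \<cdot> r \<cdot> t = (r \<cdot> t) [^] (2 :: nat)"
    by (simp add: numeral_eq_Suc m_assoc)
  then have "(r \<cdot> t) \<cdot> r \<cdot> t = \<one>"
    using pow_ord_eq_1[of "r \<cdot> t"] ord_rt by simp
  from inv_equality[OF this] show "r \<cdot> t = t \<cdot> r"
    by (simp add: inv_mult_group invs)
qed

definition ev :: "nat list \<Rightarrow> 'a" where
  "ev u = list_prod W (map ((!) [r, s, t]) u)"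

lemma generate_rs_subset:
  assumes "g \<in> generate W {r, s}"
  shows "\<exists>x\<in>set left_words. \<exists>y\<in>set middle_words. g = ev x \<cdot> ev y"
proof -
  have "\<exists>h\<in>{\<one>, r}. \<exists>y\<in>{\<one>, s, s \<cdot> r, s \<cdot> r \<cdot> s, s \<cdot> r \<cdot> s \<cdot> r}. g = h \<cdot> y"
  proof (rule generate_subset_products[OF _ _ _ _ _ _ _ _ assms])
    fix y g
    assume "y \<in> {\<one>, s, s \<cdot> r, s \<cdot> r \<cdot> s, s \<cdot> r \<cdot> s \<cdot> r}" "g \<in> {r, s}"
    then show "\<exists>h\<in>{\<one>, r}. \<exists>y'\<in>{\<one>, s, s \<cdot> r, s \<cdot> r \<cdot> s, s \<cdot> r \<cdot> s \<cdot> r}. y \<cdot> g = h \<cdot> y'"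
      using braids(1) by (auto simp: m_assoc)
  qed auto
  moreover have evs: "ev ` set left_words = {\<one>, r}"
    "ev ` set middle_words = {\<one>, s, s \<cdot> r, s \<cdot> r \<cdot> s, s \<cdot> r \<cdot> s \<cdot> r}"
    by (simp_all add: left_words_def middle_words_def ev_def)
  ultimately have "\<exists>h\<in>ev ` set left_words. \<exists>y\<in>ev ` set middle_words. g = h \<cdot> y"
    by (simp only: evs)
  then show ?thesis by blast
qed

text \<open>
  Enumeration of the twelve cosets of \<open>\<langle>r, s\<rangle>\<close>. A generator either moves along the list of
  representatives, or it can be carried to the front as \<open>r\<close> or \<open>s\<close> by the braid relations.
\<close>

lemma generate_R_subset:
  assumes "g \<in> carrier W"
  shows "\<exists>h\<in>generate W {r, s}. \<exists>x\<in>set right_words. g = h \<cdot> ev x"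
proof -
  define x1 x2 x3 x4 where x: "x1 = t" "x2 = x1 \<cdot> s" "x3 = x2 \<cdot> r" "x4 = x3 \<cdot> s"
  define x5 x6 x7 x8 where x': "x5 = x4 \<cdot> r" "x6 = x4 \<cdot> t" "x7 = x5 \<cdot> t" "x8 = x7 \<cdot> s"
  define x9 x10 x11 where x'': "x9 = x8 \<cdot> r" "x10 = x9 \<cdot> s" "x11 = x10 \<cdot> t"
  note x = x x' x''
  let ?H = "generate W {r, s}" and ?X = "{\<one>, x1, x2, x3, x4, x5, x6, x7, x8, x9, x10, x11}"
  have xc [simp]: "x1 \<in> carrier W" "x2 \<in> carrier W" "x3 \<in> carrier W" "x4 \<in> carrier W"
    "x5 \<in> carrier W" "x6 \<in> carrier W" "x7 \<in> carrier W" "x8 \<in> carrier W" "x9 \<in> carrier W"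
    "x10 \<in> carrier W" "x11 \<in> carrier W"
    by (simp_all add: x)
  have H [simp, intro]: "\<one> \<in> ?H" "r \<in> ?H" "s \<in> ?H"
    by (auto intro: generate.one generate.incl)
  have *: "(x \<cdot> r) \<cdot> r = x" "(x \<cdot> s) \<cdot> s = x" "(x \<cdot> t) \<cdot> t = x" if "x \<in> carrier W" for x
    using that by (simp_all add: m_assoc)
  have down: "x2 \<cdot> s = x1" "x3 \<cdot> r = x2" "x4 \<cdot> s = x3" "x5 \<cdot> r = x4" "x6 \<cdot> t = x4"
    "x7 \<cdot> t = x5" "x8 \<cdot> s = x7" "x9 \<cdot> r = x8" "x10 \<cdot> s = x9" "x11 \<cdot> t = x10" "x1 \<cdot> t = \<one>"
    by (simp_all add: x *)
  have x1r: "x1 \<cdot> r = r \<cdot> x1" by (simp add: x braids)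
  have x2t: "x2 \<cdot> t = s \<cdot> x2" by (simp add: x m_assoc braids)
  have x3t: "x3 \<cdot> t = s \<cdot> x3"
  proof -
    have "x3 \<cdot> t = (x2 \<cdot> t) \<cdot> r" by (simp add: x m_assoc braids)
    then show ?thesis by (simp add: x2t x(3) m_assoc)
  qed
  have x5s: "x5 \<cdot> s = r \<cdot> x5"
  proof -
    have "x5 \<cdot> s = x1 \<cdot> s \<cdot> r \<cdot> s \<cdot> r \<cdot> s" by (simp add: x m_assoc)
    also have "\<dots> = (x1 \<cdot> r) \<cdot> s \<cdot> r \<cdot> s \<cdot> r" by (simp add: m_assoc flip: braids(1))
    finally show ?thesis unfolding x1r by (simp add: x m_assoc)
  qed
  have x6s: "x6 \<cdot> s = s \<cdot> x6"
  proof -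
    have "x6 \<cdot> s = x3 \<cdot> s \<cdot> t \<cdot> s" by (simp add: x m_assoc)
    also have "\<dots> = (x3 \<cdot> t) \<cdot> s \<cdot> t" by (simp add: m_assoc braids)
    finally show ?thesis unfolding x3t by (simp add: x m_assoc)
  qed
  have x6r: "x6 \<cdot> r = x7" by (simp add: x m_assoc braids)
  have x7r: "x7 \<cdot> r = x6" unfolding x6r[symmetric] by (simp add: *)
  have x8t: "x8 \<cdot> t = r \<cdot> x8"
  proof -
    have "x8 \<cdot> t = x5 \<cdot> t \<cdot> s \<cdot> t" by (simp add: x m_assoc)
    also have "\<dots> = (x5 \<cdot> s) \<cdot> t \<cdot> s" by (simp add: m_assoc flip: braids)
    finally show ?thesis unfolding x5s by (simp add: x(7,8) m_assoc)
  qed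
  have x9t: "x9 \<cdot> t = r \<cdot> x9"
  proof -
    have "x9 \<cdot> t = (x8 \<cdot> t) \<cdot> r" by (simp add: x(9) m_assoc braids)
    then show ?thesis by (simp add: x8t x(9) m_assoc)
  qed
  have x10r: "x10 \<cdot> r = s \<cdot> x10"
  proof -
    have "x10 \<cdot> r = (x7 \<cdot> r) \<cdot> r \<cdot> s \<cdot> r \<cdot> s \<cdot> r" by (simp add: x(8-10) m_assoc)
    also have "\<dots> = (x6 \<cdot> s) \<cdot> r \<cdot> s \<cdot> r \<cdot> s" unfolding x7r braids(1) by (simp add: m_assoc)
    also have "\<dots> = s \<cdot> (x6 \<cdot> r) \<cdot> s \<cdot> r \<cdot> s" unfolding x6s by (simp add: m_assoc)
    finally show ?thesis unfolding x6r by (simp add: x(8-10) m_assoc)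
  qed
  have x11s: "x11 \<cdot> s = r \<cdot> x11"
  proof -
    have "x11 \<cdot> s = x9 \<cdot> s \<cdot> t \<cdot> s" by (simp add: x(10,11) m_assoc)
    also have "\<dots> = (x9 \<cdot> t) \<cdot> s \<cdot> t" by (simp add: m_assoc braids)
    finally show ?thesis unfolding x9t by (simp add: x(10,11) m_assoc)
  qed
  have x11r: "x11 \<cdot> r = s \<cdot> x11"
  proof -
    have "x11 \<cdot> r = (x10 \<cdot> r) \<cdot> t" by (simp add: x(11) m_assoc braids)
    then show ?thesis by (simp add: x10r x(11) m_assoc)
  qed
  have bottom: "\<one> \<cdot> r = r \<cdot> \<one>" "\<one> \<cdot> s = s \<cdot> \<one>" "\<one> \<cdot> t = x1" by (simp_all add: x)
  note table = bottom down x1r x2t x3t x5s x6s x6r x7r x8t x9t x10r x11s x11r x(2-)[symmetric]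
  have "\<exists>h\<in>?H. \<exists>x'\<in>?X. x \<cdot> g = h \<cdot> x'" if "x \<in> ?X" "g \<in> R" for x g
  proof -
    have "x \<cdot> g \<in> ?X \<or> x \<cdot> g \<in> (\<cdot>) r ` ?X \<or> x \<cdot> g \<in> (\<cdot>) s ` ?X"
      using that unfolding R_eq by (elim insertE emptyE; hypsubst; simp only: table image_insert insert_iff simp_thms)
    moreover have "x \<cdot> g = \<one> \<cdot> x \<cdot> g"
      using that R_closed by auto
    ultimately show ?thesis using H by blast
  qed
  moreover have "h \<cdot> k \<in> ?H" if "h \<in> ?H" "k \<in> ?H" for h k using that by (rule generate.eng)
  moreover have "?H \<subseteq> carrier W" using generate_in_carrier[of "{r, s}"] by auto
  moreover have "g \<in> generate W R" using assms generate_R by simp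
  ultimately have "\<exists>h\<in>?H. \<exists>x\<in>?X. g = h \<cdot> x"
    using R_closed R_square by (intro generate_subset_products[of ?H ?X R g]) auto
  moreover have evs: "ev ` set right_words = ?X"
    unfolding right_words_def by (simp add: ev_def x m_assoc)
  ultimately have "\<exists>h\<in>?H. \<exists>x\<in>ev ` set right_words. g = h \<cdot> x" by (simp only: evs)
  then show ?thesis by blast
qed

end

section \<open>Computations with permutations\<close>

lemma normal_words_letters: "list_all (list_all (\<lambda>i. i < 3)) normal_words"
  by code_simp

text \<open>
  Only the empty normal word acts trivially. Since normal words exhaust the group, the
  representation is faithful.
\<close>

lemma model_kernel: "filter (\<lambda>u. model u = [0..<7]) normal_words = [[]]"
  by code_simp

definition reflection_model :: "nat list list list" where
  "reflection_model =
    [[[2,3,0,1,4,6,5], [4,2,1,3,0,6,5], [3,4,2,0,1,6,5]],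
     [[4,3,2,1,0,6,5], [3,2,1,0,4,6,5], [2,4,0,3,1,6,5]],
     [[2,1,0,4,3,6,5], [4,1,3,2,0,6,5], [3,1,4,0,2,6,5]],
     [[0,2,1,4,3,6,5], [0,4,3,2,1,6,5], [0,3,4,1,2,6,5]],
     [[1,0,2,4,3,6,5], [1,0,3,2,4,6,5], [1,0,4,3,2,6,5]]]"

text \<open>
  The entry \<open>(v, i)\<close> at the code of a reflection says that it is the conjugate of the generator \<open>i\<close> by
  the word \<open>v\<close>.
\<close>

definition reflection_words :: "(nat list \<times> nat) list list" where
  "reflection_words =
    [[([],0), ([],1), ([0,2],1)],
     [([0,1,2,1],1), ([],2), ([0,2,1,0],1)],
     [([0,2,1],1), ([0,1,2],1), ([0],1)],
     [([1],2), ([1],0), ([0,1,2,1,0],1)],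
     [([0,1],1), ([0,1,2,1,0,1],1), ([1,2],0)]]"

definition code_list :: "code list" where
  "code_list = List.product [0..<5] [0..<3]"

lemma set_code_list: "set code_list = codes"
  by (auto simp: code_list_def codes_def)

fun refl_word :: "code \<Rightarrow> nat list" where
  "refl_word (l, k) = (case reflection_words ! l ! k of (v, i) \<Rightarrow> rev v @ i # v)"

fun refl_model :: "code \<Rightarrow> nat list" where
  "refl_model (l, k) = reflection_model ! l ! k"

text \<open>
  The chosen element is \<open>w = c\<^sub>0 b\<^sub>0 a\<^sub>0\<close>. It acts on the first five points as a cycle of length three
  and exchanges the last two points.
\<close>

definition w_word :: "nat list" where
  "w_word = refl_word (2,0) @ refl_word (1,0) @ refl_word (0,0)"

definition w_model :: "nat list" where
  "w_model = [0,1,3,4,2,6,5]"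

lemma model_refl_word: "list_all (\<lambda>p. model (refl_word p) = refl_model p) code_list"
  by code_simp

lemma model_w_word: "model w_word = w_model"
  by code_simp

definition perm_comp :: "nat list \<Rightarrow> nat list \<Rightarrow> nat list" where
  "perm_comp p q = map ((!) p) q"

lemma w_model_mult:
  "list_all (\<lambda>(l, k). perm_comp w_model (refl_model (l, Suc k mod 3)) = perm_comp (refl_model (l, k)) w_model) code_list"
  by code_simp

lemma base_triples_model:
  "list_all (\<lambda>(p, q, r). perm_comp (refl_model p) (perm_comp (refl_model q) (refl_model r)) = w_model) base_triples"
  by code_simp

lemma distinct_model: "distinct (map refl_model code_list)"
  by code_simp

lemma conj_gens_model:
  "list_all (\<lambda>p. list_all (\<lambda>g. list_ex (\<lambda>q. perm_comp g (perm_comp (refl_model p) g) = refl_model q) code_list)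
     model_gens) code_list"
  by code_simp

lemma triples_model:
  "list_all (\<lambda>p. list_all (\<lambda>q.
     list_all (\<lambda>r. (p, q, r) \<in> set all_triples)
       (let m = perm_comp (refl_model p) (refl_model q)
        in filter (\<lambda>r. perm_comp m (refl_model r) = w_model) code_list)) code_list) code_list"
  by code_simp

lemma w_model_len:
  "w_model \<noteq> [0..<7]"
  "list_all (\<lambda>p. w_model \<noteq> refl_model p) code_list"
  "list_all (\<lambda>p. list_all (\<lambda>q. w_model \<noteq> perm_comp (refl_model p) (refl_model q)) code_list) code_list"
  by code_simp+

definition order6 :: "nat list \<Rightarrow> bool" where
  "order6 m = (let m2 = perm_comp m m in if m2 = [0..<7] then False else
     let m3 = perm_comp m2 m in if m3 = [0..<7] then False else perm_comp m3 m3 = [0..<7])"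

text \<open>
  All elements of order six are conjugate.
\<close>

lemma order6_model:
  "list_all (\<lambda>m. list_ex (\<lambda>v. perm_comp v m = perm_comp w_model v) (map model normal_words))
     (filter order6 (map model normal_words))"
  by code_simp

definition coxeter_matrix :: "nat list list" where
  "coxeter_matrix = [[1,5,2], [5,1,3], [2,3,1]]"

lemma coxeter_relations_model:
  "list_all (\<lambda>i. list_all (\<lambda>j. model (concat (replicate (coxeter_matrix ! i ! j) [i, j])) = [0..<7])
     [0..<3]) [0..<3]"
  by code_simp

lemma refl_word_letters:
  "list_all (\<lambda>(l, k). case reflection_words ! l ! k of (v, i) \<Rightarrow> list_all (\<lambda>i. i < 3) (i # v)) code_list"
  by code_simp

lemma perm_comp_eq: "perm_comp p q = p \<otimes>\<^bsub>perm_lists n\<^esub> q"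
  by (simp add: perm_comp_def perm_lists_def)

lemma perm_lists_one: "\<one>\<^bsub>perm_lists n\<^esub> = [0..<n]"
  by (simp add: perm_lists_def)

section \<open>The elements of order six\<close>

context H3
begin

lemma less_3: "i < (3 :: nat) \<longleftrightarrow> i = 0 \<or> i = Suc 0 \<or> i = 2"
  by auto

lemma gen_R: "i < 3 \<Longrightarrow> [r, s, t] ! i \<in> R"
  by (auto simp: R_eq less_3)

lemma R_nth: "x \<in> R \<Longrightarrow> \<exists>i<3. x = [r, s, t] ! i"
  unfolding R_eq by (elim insertE emptyE) (rule exI[of _ 0] exI[of _ 1] exI[of _ 2], simp)+

lemma gen_closed: "i < 3 \<Longrightarrow> [r, s, t] ! i \<in> carrier W"
  using gen_R R_closed by blast

lemma letters_closed: "list_all (\<lambda>i. i < 3) u \<Longrightarrow> set (map ((!) [r, s, t]) u) \<subseteq> carrier W"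
  using gen_closed by (auto simp: list_all_iff)

lemma ev_closed [simp]: "list_all (\<lambda>i. i < 3) u \<Longrightarrow> ev u \<in> carrier W"
  unfolding ev_def by (intro list_prod_closed letters_closed)

lemma ev_append: "list_all (\<lambda>i. i < 3) u \<Longrightarrow> list_all (\<lambda>i. i < 3) v \<Longrightarrow> ev (u @ v) = ev u \<otimes> ev v"
  unfolding ev_def map_append by (intro list_prod_append letters_closed)

lemma ev_simps: "ev [] = \<one>" "ev (i # u) = [r, s, t] ! i \<otimes> ev u"
  by (simp_all add: ev_def)

lemma ev_rev: "list_all (\<lambda>i. i < 3) u \<Longrightarrow> ev (rev u) = inv (ev u)"
proof (induction u)
  case (Cons i u)
  then have i: "i < 3" and u: "list_all (\<lambda>i. i < 3) u" "list_all (\<lambda>i. i < 3) (rev u)"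
    by (simp_all add: list_all_iff)
  have "inv ([r, s, t] ! i) = [r, s, t] ! i" using i by (auto simp: less_3 invs)
  then show ?case
    using Cons.IH[OF u(1)] u i gen_closed[OF i]
    by (simp add: ev_append ev_simps inv_mult_group)
qed (simp add: ev_simps)

lemma normal_word_ex:
  assumes "g \<in> carrier W"
  shows "\<exists>u\<in>set normal_words. list_all (\<lambda>i. i < 3) u \<and> g = ev u"
proof -
  obtain h z where hz: "h \<in> generate W {r, s}" "z \<in> set right_words" "g = h \<otimes> ev z"
    using generate_R_subset[OF assms] by blast
  obtain x y where xy: "x \<in> set left_words" "y \<in> set middle_words" "h = ev x \<otimes> ev y"
    using generate_rs_subset[OF hz(1)] by blast
  have mem: "x @ y @ z \<in> set normal_words"
    using hz(2) xy(1,2) by (auto simp: normal_words_def)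
  then have letters: "list_all (\<lambda>i. i < 3) (x @ y @ z)"
    using normal_words_letters by (auto simp: list_all_iff)
  then have "g = ev (x @ y @ z)" using hz(3) xy(3) by (simp add: ev_append m_assoc)
  then show ?thesis using mem letters by blast
qed

lemma ord_gens:
  assumes "i < 3" "j < 3"
  shows "ord ([r, s, t] ! i \<otimes> [r, s, t] ! j) = coxeter_matrix ! i ! j"
proof -
  have "ord (s \<otimes> r) = 5" "ord (t \<otimes> s) = 3" "ord (t \<otimes> r) = 2"
    using ord_inv[of "r \<otimes> s"] ord_inv[of "s \<otimes> t"] ord_inv[of "r \<otimes> t"] ord_rs ord_st ord_rt
    by (simp_all add: inv_mult_group invs)
  moreover have "ord \<one> = 1" using ord_eq_1[of \<one>] by simp
  ultimately show ?thesis
    using assms ord_rs ord_st ord_rt by (auto simp: less_3 coxeter_matrix_def)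
qed

text \<open>
  The representation exists because the permutations satisfy the nine Coxeter relations.
\<close>

lemma model_hom:
  obtains \<phi> where "\<phi> \<in> hom W (perm_lists 7)" "\<And>i. i < 3 \<Longrightarrow> \<phi> ([r, s, t] ! i) = model_gens ! i"
proof -
  interpret K: group "perm_lists 7" by (rule group_perm_lists)
  let ?P = "presented_group R (coxeter_relations W R)" and ?gen = "presented_gen R (coxeter_relations W R)"
  define f where "f x = (if x = r then model_gens ! 0 else if x = s then model_gens ! 1 else model_gens ! 2)" for x
  have f: "f ([r, s, t] ! i) = model_gens ! i" if "i < 3" for i
    using that distinct by (auto simp: f_def less_3)
  have "model_gens ! i \<in> carrier (perm_lists 7)" if "i < 3" for i
    using that by (auto simp: less_3 model_gens_def perm_lists_def)
  then have f_closed: "f \<in> R \<rightarrow> carrier (perm_lists 7)" by (auto simp: f_def)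
  have rel: "eval_word (perm_lists 7) f l = eval_word (perm_lists 7) f l'"
    if lr: "(l, l') \<in> coxeter_relations W R" for l l'
  proof -
    have "\<exists>x y. (l, l') = (positive (concat (replicate (ord (x \<otimes> y)) [x, y])), []) \<and> x \<in> R \<and> y \<in> R"
      using lr by (simp only: coxeter_relations_def mem_Collect_eq)
    then obtain x y where xy: "x \<in> R" "y \<in> R" "l' = []"
      "l = positive (concat (replicate (ord (x \<otimes> y)) [x, y]))"
      by (elim exE conjE) (simp only: prod.inject)
    obtain i where i: "i < 3" "x = [r, s, t] ! i" using R_nth[OF xy(1)] by blast
    obtain j where j: "j < 3" "y = [r, s, t] ! j" using R_nth[OF xy(2)] by blast
    note ij = i(1) j(1) i(2) j(2)
    define n where "n = coxeter_matrix ! i ! j"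
    have "map f (concat (replicate n [x, y])) = map ((!) model_gens) (concat (replicate n [i, j]))"
      using f[OF ij(1)] f[OF ij(2)] by (induction n) (simp_all add: ij)
    then have "eval_word (perm_lists 7) f l = model (concat (replicate n [i, j]))"
      using ord_gens[OF ij(1,2)] by (simp add: xy(4) n_def eval_word_positive model_eq flip: ij(3,4))
    then show ?thesis
      using coxeter_relations_model ij(1,2) by (simp add: xy(3) list_all_iff perm_lists_one n_def)
  qed
  obtain \<chi> where \<chi>: "\<chi> \<in> hom ?P (perm_lists 7)" "\<And>x. x \<in> R \<Longrightarrow> \<chi> (?gen x) = f x"
    by (rule K.presented_group_hom[OF f_closed rel]) blast+
  obtain \<psi> where \<psi>: "\<psi> \<in> iso ?P W" "\<And>x. x \<in> R \<Longrightarrow> \<psi> (?gen x) = x"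
    using coxeter by (auto simp: finite_coxeter_system_def)
  have inv: "inv_into (carrier ?P) \<psi> \<in> hom W ?P"
    using group.iso_set_sym[OF group_presented_group \<psi>(1)] by (simp add: iso_def)
  have "inv_into (carrier ?P) \<psi> x = ?gen x" if "x \<in> R" for x
    using \<psi> that inv_into_f_f[of \<psi> "carrier ?P" "?gen x"] by (simp add: iso_def bij_betw_def)
  then have gens: "(\<chi> \<circ> inv_into (carrier ?P) \<psi>) ([r, s, t] ! i) = model_gens ! i" if "i < 3" for i
    using \<chi>(2) gen_R[OF that] f[OF that] by simp
  show thesis by (rule that[OF Group.hom_compose[OF inv \<chi>(1)] gens])
qed

text \<open>
  The elements of order six form one conjugacy class. The reflections of \<open>W\<close> are indexed by the
  words in \<open>reflection_words\<close>; faithfulness of the representation turns every equation between them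
  into an equation of permutations. This gives the structure for one element \<open>v\<close> of the class, and
  conjugation carries it to \<open>w\<close>.
\<close>

theorem H3_a2_interval_if_order_6:
  assumes w: "w \<in> carrier W" and ord: "ord w = 6"
  shows "\<exists>y. H3_a2_interval W R w y"
proof -
  interpret K: group "perm_lists 7" by (rule group_perm_lists)
  obtain \<phi> where \<phi>: "\<phi> \<in> hom W (perm_lists 7)" "\<And>i. i < 3 \<Longrightarrow> \<phi> ([r, s, t] ! i) = model_gens ! i"
    by (rule model_hom) blast
  interpret \<phi>: group_hom W "perm_lists 7" \<phi>
    using \<phi>(1) by (simp add: group_hom_def group_hom_axioms_def is_group group_perm_lists)
  have \<phi>_ev: "\<phi> (ev u) = model u" if "list_all (\<lambda>i. i < 3) u" for u
  proof -
    have eq: "map (\<lambda>i. \<phi> ([r, s, t] ! i)) u = map ((!) model_gens) u"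
      using that \<phi>(2) by (auto simp: list_all_iff)
    have "\<phi> (ev u) = list_prod (perm_lists 7) (map (\<lambda>i. \<phi> ([r, s, t] ! i)) u)"
      unfolding ev_def using hom_list_prod[OF is_group group_perm_lists \<phi>(1) letters_closed[OF that]]
      by (simp add: o_def)
    then show ?thesis by (simp only: eq model_eq)
  qed
  have \<phi>_mult: "\<phi> (g \<otimes> h) = perm_comp (\<phi> g) (\<phi> h)" if "g \<in> carrier W" "h \<in> carrier W" for g h
    using that by (simp add: perm_comp_eq[of _ _ 7])
  have \<phi>_one: "g = \<one>" if g: "g \<in> carrier W" "\<phi> g = [0..<7]" for g
  proof -
    obtain u where u: "u \<in> set normal_words" "list_all (\<lambda>i. i < 3) u" "g = ev u"
      using normal_word_ex[OF g(1)] by blast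
    then have "u \<in> set (filter (\<lambda>u. model u = [0..<7]) normal_words)" using \<phi>_ev g(2) by simp
    then have "u = []" unfolding model_kernel by simp
    then show ?thesis using u(3) by (simp add: ev_simps)
  qed
  have \<phi>_inj: "g = h" if "g \<in> carrier W" "h \<in> carrier W" "\<phi> g = \<phi> h" for g h
  proof -
    have "\<phi> (g \<otimes> inv h) = [0..<7]" using that by (simp add: perm_lists_one)
    then show ?thesis using \<phi>_one[of "g \<otimes> inv h"] that inv_equality[of g "inv h"] by simp
  qed
  have word: "list_all (\<lambda>i. i < 3) (refl_word p)" if "p \<in> codes" for p
    using refl_word_letters that unfolding list_all_iff set_code_list
    by (cases p) (fastforce split: prod.splits)
  define z where "z p = ev (refl_word p)" for p
  have z_closed: "z p \<in> carrier W" if "p \<in> codes" for p using word[OF that] by (simp add: z_def)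
  have \<phi>_z: "\<phi> (z p) = refl_model p" if "p \<in> codes" for p
    using model_refl_word \<phi>_ev[OF word[OF that]] that by (simp add: z_def list_all_iff set_code_list)
  have codes: "(0, 0) \<in> codes" "(1, 0) \<in> codes" "(2, 0) \<in> codes" "(0, 1) \<in> codes" "(1, 1) \<in> codes"
    by (simp_all add: codes_def)
  define v where "v = ev w_word"
  have v_eq: "v = z (2,0) \<otimes> (z (1,0) \<otimes> z (0,0))"
    unfolding v_def w_word_def z_def using word[OF codes(1)] word[OF codes(2)] word[OF codes(3)]
    by (subst ev_append; simp add: ev_append)
  have v: "v \<in> carrier W" using z_closed codes by (simp add: v_eq)
  have \<phi>_v: "\<phi> v = w_model"
    unfolding v_def model_w_word[symmetric] w_word_def
    using word[OF codes(1)] word[OF codes(2)] word[OF codes(3)] by (intro \<phi>_ev) simp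
  have z_system: "conj_system z v"
    unfolding conj_system_def
  proof (intro conjI ballI allI impI)
    show "v \<in> carrier W" by (rule v)
    show "z p \<in> carrier W" if "p \<in> codes" for p by (rule z_closed[OF that])
    fix l k :: nat assume lk: "l < 5" "k < 3"
    then have c: "(l, k) \<in> codes" "(l, Suc k mod 3) \<in> codes" by (auto simp: codes_def)
    have "perm_comp w_model (refl_model (l, Suc k mod 3)) = perm_comp (refl_model (l, k)) w_model"
      using w_model_mult c(1) unfolding list_all_iff set_code_list by fast
    then show "v \<otimes> z (l, Suc k mod 3) = z (l, k) \<otimes> v"
      using c z_closed v by (intro \<phi>_inj) (simp_all add: \<phi>_mult \<phi>_z \<phi>_v del: refl_model.simps \<phi>.hom_mult)
  next
    fix t assume t: "t \<in> set base_triples"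
    obtain p q o' where pqo: "t = (p, q, o')" by (metis surj_pair)
    then have c: "p \<in> codes" "q \<in> codes" "o' \<in> codes" using base_triples_codes t by blast+
    have "perm_comp (refl_model p) (perm_comp (refl_model q) (refl_model o')) = w_model"
      using base_triples_model t pqo unfolding list_all_iff by fast
    then have "z p \<otimes> (z q \<otimes> z o') = v"
      using c z_closed v by (intro \<phi>_inj) (simp_all add: \<phi>_mult \<phi>_z \<phi>_v del: refl_model.simps \<phi>.hom_mult)
    then show "case t of (p, q, o') \<Rightarrow> z p \<otimes> (z q \<otimes> z o') = v" by (simp add: pqo)
  qed
  have z_gens: "z (0, 0) = r" "z (0, 1) = s" "z (1, 1) = t"
    by (simp_all add: z_def reflection_words_def ev_simps)
  \<comment> \<open>The reflections are the closure of the generators under conjugation, so it suffices that the fifteen elements are permuted by conjugation with generators.\<close>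
  have z_conj: "inv (ev u) \<otimes> x \<otimes> ev u \<in> z ` codes"
    if "list_all (\<lambda>i. i < 3) u" "x \<in> z ` codes" for u x
    using that
  proof (induction u arbitrary: x)
    case Nil
    then show ?case using z_closed by (auto simp: ev_simps)
  next
    case (Cons i u)
    define g where "g = [r, s, t] ! i"
    have i: "i < 3" and u: "list_all (\<lambda>i. i < 3) u" using Cons.prems by simp_all
    have g: "g \<in> carrier W" "inv g = g" using gen_closed[OF i] i by (auto simp: g_def less_3 invs)
    obtain p where p: "p \<in> codes" "x = z p" using Cons.prems by blast
    have "model_gens ! i \<in> set model_gens" using i by (intro nth_mem) (simp add: model_gens_def)
    then obtain q where q: "q \<in> codes"
      "perm_comp (model_gens ! i) (perm_comp (refl_model p) (model_gens ! i)) = refl_model q"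
      using conj_gens_model p(1) unfolding list_all_iff list_ex_iff set_code_list by fast
    have "g \<otimes> (z p \<otimes> g) = z q"
      using p q g z_closed \<phi>(2)[OF i]
      by (intro \<phi>_inj) (simp_all add: \<phi>_mult \<phi>_z g_def del: refl_model.simps \<phi>.hom_mult)
    moreover have "inv (ev (i # u)) \<otimes> x \<otimes> ev (i # u) = inv (ev u) \<otimes> (g \<otimes> (x \<otimes> g)) \<otimes> ev u"
      using u g p z_closed by (simp add: ev_simps free_group_simps flip: g_def)
    ultimately show ?case using Cons.IH[OF u, of "z q"] p q by simp
  qed
  have z_T: "z ` codes = T"
  proof (intro equalityI subsetI)
    fix x assume "x \<in> T"
    then obtain a g where ag: "a \<in> R" "g \<in> carrier W" "x = inv g \<otimes> a \<otimes> g" by (auto simp: T_iff)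
    obtain u where "list_all (\<lambda>i. i < 3) u" "g = ev u" using normal_word_ex[OF ag(2)] by blast
    moreover have "a \<in> z ` codes"
      using ag(1) codes unfolding R_eq z_gens[symmetric] by blast
    ultimately show "x \<in> z ` codes" using z_conj ag(3) by blast
  next
    fix x assume "x \<in> z ` codes"
    then obtain p where p: "p \<in> codes" "x = z p" by blast
    obtain l k where lk: "p = (l, k)" by (metis surj_pair)
    obtain u i where ui: "reflection_words ! l ! k = (u, i)" by (metis surj_pair)
    have letters: "i < 3" "list_all (\<lambda>i. i < 3) u" "list_all (\<lambda>i. i < 3) (rev u)"
      using refl_word_letters p(1) lk ui unfolding list_all_iff set_code_list by fastforce+
    have "x = inv (ev u) \<otimes> [r, s, t] ! i \<otimes> ev u"
      using letters gen_closed[OF letters(1)]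
      by (simp add: p(2) lk z_def ui ev_append ev_simps ev_rev m_assoc)
    then show "x \<in> T"
      unfolding T_iff using gen_R[OF letters(1)] ev_closed[OF letters(2)] by blast
  qed
  have z_inj: "inj_on z codes"
  proof (rule inj_onI)
    fix p q assume pq: "p \<in> codes" "q \<in> codes" "z p = z q"
    then have "refl_model p = refl_model q" using \<phi>_z by metis
    then show "p = q" using distinct_model pq by (simp add: distinct_map set_code_list inj_on_def)
  qed
  have z_triples: "(p, q, o') \<in> set all_triples"
    if c: "p \<in> codes" "q \<in> codes" "o' \<in> codes" and prod: "z p \<otimes> z q \<otimes> z o' = v" for p q o'
  proof -
    have "perm_comp (perm_comp (refl_model p) (refl_model q)) (refl_model o') = w_model"
      using prod c z_closed \<phi>_mult \<phi>_z \<phi>_v by (metis m_closed)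
    then show ?thesis
      using triples_model c unfolding list_all_iff set_code_list Let_def set_filter by blast
  qed
  \<comment> \<open>Shorter factorizations are excluded by inspection of products of at most two reflections.\<close>
  have len_v: "len v = 3"
  proof -
    have "z (2,0) \<in> T" "z (1,0) \<in> T" "z (0,0) \<in> T" using z_T codes by blast+
    then have "len v \<le> 3"
      using len_le[of "[z (2,0), z (1,0), z (0,0)]"] by (simp add: v_eq numeral_3_eq_3)
    moreover have "len v \<noteq> 0"
      using len_eq_0_iff[OF v] w_model_len(1) \<phi>_v by (auto simp: perm_lists_one)
    moreover have "v \<notin> T"
      using w_model_len(2) \<phi>_v \<phi>_z unfolding z_T[symmetric] list_all_iff set_code_list by auto
    moreover have "v \<noteq> a \<otimes> b" if ab: "a \<in> T" "b \<in> T" for a b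
    proof -
      obtain p q where "p \<in> codes" "q \<in> codes" "a = z p" "b = z q"
        using ab unfolding z_T[symmetric] by blast
      then show ?thesis
        using w_model_len(3) \<phi>_v \<phi>_z \<phi>_mult z_closed unfolding list_all_iff set_code_list by metis
    qed
    ultimately show ?thesis using len_eq_1[OF v] len_eq_2[OF v]
      by (cases "len v = 1 \<or> len v = 2") (blast, linarith)
  qed
  obtain u where u: "u \<in> set normal_words" "list_all (\<lambda>i. i < 3) u" "w = ev u"
    using normal_word_ex[OF w] by blast
  have "order6 (\<phi> w)"
  proof -
    have pow: "w [^] (2 :: nat) \<noteq> \<one>" "w [^] (3 :: nat) \<noteq> \<one>" "w [^] (6 :: nat) = \<one>"
      using pow_eq_id[OF w] ord by simp_all
    have "w \<otimes> w \<noteq> \<one>" "w \<otimes> w \<otimes> w \<noteq> \<one>" "w \<otimes> w \<otimes> w \<otimes> (w \<otimes> w \<otimes> w) = \<one>"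
      using pow w by (simp_all add: numeral_eq_Suc m_assoc)
    then have "\<phi> (w \<otimes> w) \<noteq> [0..<7]" "\<phi> (w \<otimes> w \<otimes> w) \<noteq> [0..<7]"
      "\<phi> (w \<otimes> w \<otimes> w \<otimes> (w \<otimes> w \<otimes> w)) = [0..<7]"
      using \<phi>_one w \<phi>.hom_one by (auto simp: perm_lists_one simp del: \<phi>.hom_mult)
    then show ?thesis
      using w by (simp add: order6_def Let_def \<phi>_mult del: \<phi>.hom_mult)
  qed
  then have "\<phi> w \<in> set (filter order6 (map model normal_words))"
    using u \<phi>_ev by simp
  then obtain x where x: "x \<in> set normal_words" "perm_comp (model x) (\<phi> w) = perm_comp w_model (model x)"
    using order6_model unfolding list_all_iff list_ex_iff by fastforce
  have x_letters: "list_all (\<lambda>i. i < 3) x" using normal_words_letters x(1) by (simp add: list_all_iff)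
  define g where "g = ev x"
  have g: "g \<in> carrier W" using x_letters by (simp add: g_def)
  have "g \<otimes> w = v \<otimes> g"
    using x(2) g w v \<phi>_ev[OF x_letters] by (intro \<phi>_inj) (simp_all add: \<phi>_mult \<phi>_v g_def del: \<phi>.hom_mult)
  then have w_eq: "w = inv g \<otimes> v \<otimes> g" using g w v by (simp add: m_assoc flip: \<open>g \<otimes> w = v \<otimes> g\<close>)
  define c where "c a = inv g \<otimes> a \<otimes> g" for a
  have c_hom: "c \<in> hom W W" using g by (auto simp: hom_def c_def free_group_simps)
  have c_inj: "a = b" if "a \<in> carrier W" "b \<in> carrier W" "c a = c b" for a b
    using that g by (simp add: c_def)
  have "rank3_interval W R w"
    using w len_conj[OF v g] len_v w_eq coxeter_group_axioms
    by (simp add: rank3_interval_def coxeter_interval_def coxeter_interval_axioms_def rank3_interval_axioms_def)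
  moreover have "conj_system (c \<circ> z) w"
    using conj_system_hom[OF is_group is_group c_hom z_system] w_eq by (simp add: c_def)
  moreover have "(c \<circ> z) ` codes = T"
  proof (intro equalityI subsetI)
    fix a assume "a \<in> (c \<circ> z) ` codes"
    then show "a \<in> T" using T_conj[OF _ g] z_T by (auto simp: c_def)
  next
    fix a assume a: "a \<in> T"
    then have "inv (inv g) \<otimes> a \<otimes> inv g \<in> z ` codes" using T_conj[of a "inv g"] g z_T by simp
    moreover have "a = c (inv (inv g) \<otimes> a \<otimes> inv g)" using a g by (simp add: c_def free_group_simps)
    ultimately show "a \<in> (c \<circ> z) ` codes" by (auto simp: image_comp[symmetric])
  qed
  moreover have "inj_on (c \<circ> z) codes"
    using z_inj c_inj z_closed by (auto simp: inj_on_def)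
  moreover have "(p, q, o') \<in> set all_triples"
    if pq: "p \<in> codes" "q \<in> codes" "o' \<in> codes" and prod: "(c \<circ> z) p \<otimes> (c \<circ> z) q \<otimes> (c \<circ> z) o' = w" for p q o'
  proof -
    have closed: "z p \<otimes> z q \<otimes> z o' \<in> carrier W" using z_closed pq by simp
    have "c (z p \<otimes> z q \<otimes> z o') = c v"
      using prod pq z_closed g w_eq by (simp add: c_def free_group_simps)
    from c_inj[OF closed v this] show ?thesis using z_triples pq by blast
  qed
  ultimately have "H3_a2_interval W R w (c \<circ> z)"
    unfolding H3_a2_interval_def H3_a2_interval_axioms_def by blast
  then show ?thesis by (rule exI[of _ "c \<circ> z"])
qed

end

theorem theorem2p23:
  fixes W :: "('a, 'b) monoid_scheme" and R :: "'a set" and w :: 'a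
  assumes "type_H3 W R"
    and "w \<in> H3_a2 W R"
  shows "interval_group W R w \<cong> presented_group {1, 2, 3} H3_a2_relations \<and>
    Lattice.lattice (interval_order W R w) \<and>
    garside_group (interval_group W R w)"
proof -
  have coxeter: "finite_coxeter_system W R" using assms(1) by (simp add: type_H3_def)
  obtain r s t where rst: "R = {r, s, t}" "distinct [r, s, t]" "group.ord W (r \<otimes>\<^bsub>W\<^esub> s) = 5"
    "group.ord W (s \<otimes>\<^bsub>W\<^esub> t) = 3" "group.ord W (r \<otimes>\<^bsub>W\<^esub> t) = 2"
    using assms(1) by (auto simp: type_H3_def)
  have "group W" using coxeter by (simp add: finite_coxeter_system_def)
  interpret H3 W R r s t
    using coxeter rst \<open>group W\<close>
    by (simp add: H3_def H3_axioms_def coxeter_group_def coxeter_group_axioms_def)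
  have w: "w \<in> carrier W" "ord w = 6"
    using assms(2) by (simp_all add: H3_a2_def proper_quasi_coxeter_def quasi_coxeter_def)
  obtain y where "H3_a2_interval W R w y" using H3_a2_interval_if_order_6[OF w] by blast
  then interpret H3_a2_interval W R w y .
  show ?thesis
    using interval_group_presentation lattice_interval garside_interval_group[OF coxeter w(1)]
    by blast
qed

end
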